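(* Let $d\geq 1$ and let $\mathscr{A}\subseteq (0,1)^{d}$ be an analytic set. The following are equivalent: (i) $\mathscr{A}$ is contained in an $F_{\sigma}$, purely unrectifiable subset of $\mathbb{R}^d$; (ii) a typical $f\in\operatorname{Lip}_{1}([0,1]^{d})$ is nowhere differentiable in $\mathscr{A}$, i.e. the set of $f\in\operatorname{Lip}_1([0,1]^d)$ which are not differentiable at any point of $\mathscr{A}$ is residual in $\operatorname{Lip}_1([0,1]^d)$.
   Context: $\operatorname{Lip}_{1}([0,1]^{d})$ denotes the set of all functions $f\colon[0,1]^d\to\mathbb{R}$ with Lipschitz constant at most $1$, viewed as a complete metric space with the supremum metric. A property holds for a typical $f\in\operatorname{Lip}_1([0,1]^d)$ if the set of $f$ with this property is residual (its complement is meagre). A Lipschitz curve is a Lipschitz map $\gamma\colon I\to\mathbb{R}^d$, $I\subseteq\mathbb{R}$ a closed interval, whose derivative is bounded away from zero in norm almost everywhere. A set $P\subseteq\mathbb{R}^d$ is purely unrectifiable if for every Lipschitz curve $\gamma\colon[0,1]\to\mathbb{R}^d$ the set $\gamma^{-1}(P)$ has Lebesgue measure zero. *)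

theory Defs
  imports "HOL-Analysis.Analysis"
begin

text \<open>Analytic subsets of a Euclidean space: empty, or a continuous image of the
  Baire space \<open>\<nat>\<^sup>\<nat>\<close> (type \<open>nat \<Rightarrow> nat\<close> with the product topology of discrete \<open>nat\<close>).\<close>
definition analytic_set :: "'a::euclidean_space set \<Rightarrow> bool" where
  "analytic_set A \<longleftrightarrow> A = {} \<or>
     (\<exists>g :: (nat \<Rightarrow> nat) \<Rightarrow> 'a. continuous_on UNIV g \<and> range g = A)"

definition lipschitz_curve_on :: "real set \<Rightarrow> (real \<Rightarrow> 'a::euclidean_space) \<Rightarrow> bool" where
  "lipschitz_curve_on I \<gamma> \<longleftrightarrow>
     (\<exists>L. L-lipschitz_on I \<gamma>) \<and>
     (\<exists>c>0. AE t in lebesgue_on I.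
        \<exists>v. (\<gamma> has_vector_derivative v) (at t within I) \<and> c \<le> norm v)"

definition purely_unrectifiable :: "'a::euclidean_space set \<Rightarrow> bool" where
  "purely_unrectifiable P \<longleftrightarrow>
     (\<forall>\<gamma> :: real \<Rightarrow> 'a. lipschitz_curve_on {0..1} \<gamma> \<longrightarrow>
        {t \<in> {0..1}. \<gamma> t \<in> P} \<in> null_sets lebesgue)"

text \<open>The space \<open>Lip\<^sub>1([0,1]^d)\<close> with the supremum metric. Functions are represented
  extensionally on the cube \<open>cbox 0 One = [0,1]^d\<close>.\<close>
definition Lip1_metric :: "('a::euclidean_space \<Rightarrow> real) metric" where
  "Lip1_metric = submetric (funspace (cbox 0 One) (euclidean_metric :: real metric))
                           {f. 1-lipschitz_on (cbox 0 One) f}"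

definition Lip1_topology :: "('a::euclidean_space \<Rightarrow> real) topology" where
  "Lip1_topology = mtopology_of Lip1_metric"

definition nowhere_dense_in :: "'a topology \<Rightarrow> 'a set \<Rightarrow> bool" where
  "nowhere_dense_in X S \<longleftrightarrow> S \<subseteq> topspace X \<and> X interior_of (X closure_of S) = {}"

definition meagre_in :: "'a topology \<Rightarrow> 'a set \<Rightarrow> bool" where
  "meagre_in X S \<longleftrightarrow> (countable union_of nowhere_dense_in X) S"

definition residual_in :: "'a topology \<Rightarrow> 'a set \<Rightarrow> bool" where
  "residual_in X S \<longleftrightarrow> S \<subseteq> topspace X \<and> meagre_in X (topspace X - S)"

end

theory Submission
  imports Defs "HOL-Complex_Analysis.Great_Picard"
begin

text \<open>
  Suppose first that \<open>A\<close> lies in a countable union of compact purely unrectifiable sets \<open>K\<close>, and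
  fix a direction \<open>e\<close>. By Arzela--Ascoli, some neighbourhood of \<open>K\<close> is met in arbitrarily small
  length by every curve that is a Lipschitz graph over the line \<open>\<real>e\<close>. Maximising this length over
  graphs ending at a point produces a small potential \<open>g\<close> which grows at unit speed along \<open>e\<close> near
  \<open>K\<close> and is almost constant across \<open>e\<close>. Precomposition with \<open>x \<mapsto> x - g x e\<close> hardly moves a
  function or its Lipschitz constant but makes it constant along \<open>e\<close> near \<open>K\<close>; so a typical
  function can only have derivative 0 at points of \<open>K\<close>. On the other hand a typical function has,
  at every point, difference quotients above 1/2 at arbitrarily small scales.

  Conversely, let \<open>A\<close> be analytic and not so covered. Sets which are covered by \<open>F\<^sub>\<sigma>\<close> sets null on
  all curves with tangents near \<open>e\<close> form \<open>\<sigma>\<close>-ideals, and a piece of \<open>A\<close> outside such an ideal stays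
  outside an ideal for a narrower cone of directions. In the Banach--Mazur game we keep a piece of
  \<open>A\<close>, a direction \<open>e\<close> and a function that is affine with gradient \<open>e\<close> near that piece, whose closure
  fills most of a short curve in direction \<open>e\<close>. Any 1-Lipschitz answer close enough to this function
  grows at almost maximal speed along the curve, so by the weak maximal inequality at all smaller
  scales at some point of the closure, and for 1-Lipschitz functions this controls all directions.
  The limit is differentiable at a point of \<open>A\<close>.
\<close>

section \<open>Vitali coverings\<close>

lemma measure_countable_UN_le:
  assumes "countable C" "\<And>i. i \<in> C \<Longrightarrow> S i \<in> fmeasurable M"
    and sum_le: "\<And>D. D \<subseteq> C \<Longrightarrow> finite D \<Longrightarrow> (\<Sum>i\<in>D. measure M (S i)) \<le> B"
  shows "(\<Union>i\<in>C. S i) \<in> fmeasurable M" "measure M (\<Union>i\<in>C. S i) \<le> B"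
proof -
  have "measure M (\<Union>i\<in>D. S i) \<le> B" if "D \<subseteq> C" "finite D" for D
  proof -
    have "measure M (\<Union>i\<in>D. S i) \<le> (\<Sum>i\<in>D. measure M (S i))"
      using assms(2) that by (intro measure_UNION_le fmeasurableD) auto
    also have "\<dots> \<le> B" using that by (rule sum_le)
    finally show ?thesis .
  qed
  note bound = assms(1,2) this
  show "(\<Union>i\<in>C. S i) \<in> fmeasurable M" by (rule fmeasurable_UN_bound[OF bound])
  show "measure M (\<Union>i\<in>C. S i) \<le> B" by (rule measure_UN_bound[OF bound])
qed

lemma sets_Int_fmeasurable: "A \<in> sets M \<Longrightarrow> B \<in> fmeasurable M \<Longrightarrow> A \<inter> B \<in> fmeasurable M"
  by (metis Int_commute fmeasurable_Int_fmeasurable)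

lemma measure_le_negligible_Diff:
  assumes "E \<in> lmeasurable" "M \<in> lmeasurable" "negligible (E - M)"
  shows "measure lebesgue E \<le> measure lebesgue M"
proof -
  have diff: "E - M \<in> lmeasurable" "measure lebesgue (E - M) = 0"
    using assms(3) by (simp_all add: negligible_imp_measurable negligible_imp_measure0)
  have "measure lebesgue E \<le> measure lebesgue ((E - M) \<union> M)"
    using assms diff by (intro measure_mono_fmeasurable) auto
  also have "\<dots> \<le> measure lebesgue (E - M) + measure lebesgue M"
    using assms diff by (intro measure_Un_le) auto
  finally show ?thesis using diff(2) by simp
qed

lemma lmeasurable_outer_open:
  assumes "E \<in> lmeasurable" "0 < \<epsilon>"
  obtains U where "open U" "E \<subseteq> U" "U \<in> lmeasurable" "measure lebesgue U < measure lebesgue E + \<epsilon>"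
proof -
  obtain U where U: "open U" "E \<subseteq> U" "U - E \<in> lmeasurable" "emeasure lebesgue (U - E) < ennreal \<epsilon>"
    using sets_lebesgue_outer_open[of E \<epsilon>] assms by blast
  have "E \<union> (U - E) \<in> lmeasurable" using assms(1) U(3) by (rule fmeasurable.Un)
  then have m: "U \<in> lmeasurable" using U(2) by (simp add: Un_absorb1)
  have "measure lebesgue (U - E) < \<epsilon>"
    using U(3,4) \<open>0 < \<epsilon>\<close> by (simp add: emeasure_eq_measure2 ennreal_less_iff)
  moreover have "measure lebesgue (U - E) = measure lebesgue U - measure lebesgue E"
    using m assms(1) U(2) by (intro measurable_measure_Diff) auto
  ultimately show thesis using that[OF U(1,2) m] by linarith
qed

lemma thin_cballs_subfamily:
  fixes E :: "'a::euclidean_space set"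
  assumes U: "open U" "E \<subseteq> U"
    and thin: "\<And>x d. x \<in> E \<Longrightarrow> 0 < d \<Longrightarrow> \<exists>a r. 0 < r \<and> r < d \<and> x \<in> cball a r \<and> P a r"
  obtains C where "countable C" "\<And>i. i \<in> C \<Longrightarrow> cball (fst i) (snd i) \<subseteq> U \<and> P (fst i) (snd i)"
    "pairwise (\<lambda>i j. disjnt (cball (fst i) (snd i)) (cball (fst j) (snd j))) C"
    "negligible (E - (\<Union>i\<in>C. cball (fst i) (snd i)))"
proof -
  define K where "K = {(a, r). 0 < r \<and> cball a r \<subseteq> U \<and> P a r}"
  let ?B = "\<lambda>i::'a \<times> real. cball (fst i) (snd i)"
  obtain C where C: "countable C" "C \<subseteq> K" "pairwise (\<lambda>i j. disjnt (?B i) (?B j)) C"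
    "negligible (E - (\<Union>i\<in>C. ?B i))"
  proof (rule Vitali_covering_theorem_cballs)
    show "0 < snd i" if "i \<in> K" for i using that by (auto simp: K_def)
    show "\<exists>i. i \<in> K \<and> x \<in> ?B i \<and> snd i < d" if x: "x \<in> E" and "0 < d" for x d
    proof -
      obtain s where s: "0 < s" "ball x s \<subseteq> U" using U x by (meson openE subsetD)
      obtain a r where ar: "0 < r" "r < min d (s / 2)" "x \<in> cball a r" "P a r"
        using thin[OF x, of "min d (s / 2)"] \<open>0 < d\<close> s(1) by auto
      have "cball a r \<subseteq> ball x s"
      proof
        fix y assume "y \<in> cball a r"
        then show "y \<in> ball x s"
          using ar(2,3) dist_triangle[of x y a] by (simp add: dist_commute)
      qed
      then show ?thesis using ar s(2) by (intro exI[of _ "(a, r)"]) (auto simp: K_def)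
    qed
  qed
  have "?B i \<subseteq> U \<and> P (fst i) (snd i)" if "i \<in> C" for i
    using subsetD[OF C(2) that] by (simp add: K_def case_prod_beta)
  with C show thesis by (intro that[of C]) auto
qed

lemma measure_le_if_thin_cballs:
  fixes E :: "'a::euclidean_space set"
  assumes E: "E \<in> lmeasurable" and "0 \<le> c" and U: "open U" "E \<subseteq> U" "U \<in> lmeasurable"
    and thin: "\<And>x d. x \<in> E \<Longrightarrow> 0 < d \<Longrightarrow> \<exists>a r. 0 < r \<and> r < d \<and> x \<in> cball a r \<and>
      measure lebesgue (E \<inter> cball a r) \<le> c * measure lebesgue (cball a r)"
  shows "measure lebesgue E \<le> c * measure lebesgue U"
proof -
  let ?B = "\<lambda>i::'a \<times> real. cball (fst i) (snd i)"
  obtain C where C: "countable C"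
    "\<And>i. i \<in> C \<Longrightarrow> ?B i \<subseteq> U \<and> measure lebesgue (E \<inter> ?B i) \<le> c * measure lebesgue (?B i)"
    "pairwise (\<lambda>i j. disjnt (?B i) (?B j)) C" "negligible (E - (\<Union>i\<in>C. ?B i))"
    by (rule thin_cballs_subfamily[OF U(1,2) thin]) (assumption | rule that)+
  have sum_le: "(\<Sum>i\<in>D. measure lebesgue (E \<inter> ?B i)) \<le> c * measure lebesgue U" if D: "D \<subseteq> C" "finite D" for D
  proof -
    have "(\<Sum>i\<in>D. measure lebesgue (E \<inter> ?B i)) \<le> (\<Sum>i\<in>D. c * measure lebesgue (?B i))"
      using D C(2) by (intro sum_mono) auto
    also have "\<dots> = c * measure lebesgue (\<Union>i\<in>D. ?B i)"
      using D pairwise_subset[OF C(3) D(1)]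
      by (subst measure_UNION') (simp_all add: sum_distrib_left)
    also have "\<dots> \<le> c * measure lebesgue U"
    proof (intro mult_left_mono measure_mono_fmeasurable)
      show "(\<Union>i\<in>D. ?B i) \<subseteq> U" using D C(2) by blast
    qed (use D U \<open>0 \<le> c\<close> in auto)
    finally show ?thesis .
  qed
  have piece: "E \<inter> ?B i \<in> lmeasurable" for i using E by (auto intro: fmeasurable_Int_fmeasurable)
  note cover = measure_countable_UN_le[OF C(1) piece sum_le]
  have "measure lebesgue E \<le> measure lebesgue (\<Union>i\<in>C. E \<inter> ?B i)"
  proof (rule measure_le_negligible_Diff[OF E])
    show "(\<Union>i\<in>C. E \<inter> ?B i) \<in> lmeasurable" by (rule cover(1))
    have "E - (\<Union>i\<in>C. E \<inter> ?B i) = E - (\<Union>i\<in>C. ?B i)" by blast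
    then show "negligible (E - (\<Union>i\<in>C. E \<inter> ?B i))" using C(4) by simp
  qed
  also have "\<dots> \<le> c * measure lebesgue U" by (rule cover(2))
  finally show ?thesis .
qed

lemma negligible_if_thin_cballs:
  fixes E :: "'a::euclidean_space set"
  assumes E: "E \<in> sets lebesgue" and c: "0 \<le> c" "c < 1"
    and thin: "\<And>x d. x \<in> E \<Longrightarrow> 0 < d \<Longrightarrow> \<exists>a r. 0 < r \<and> r < d \<and> x \<in> cball a r \<and>
      measure lebesgue (E \<inter> cball a r) \<le> c * measure lebesgue (cball a r)"
  shows "negligible E"
proof (rule negligible_on_intervals[THEN iffD2], intro allI)
  fix l u
  let ?E = "E \<inter> cbox l u"
  have m: "?E \<in> lmeasurable"
    using E lmeasurable_cbox by (rule sets_Int_fmeasurable)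
  have thin': "\<exists>a r. 0 < r \<and> r < d \<and> x \<in> cball a r \<and>
      measure lebesgue (?E \<inter> cball a r) \<le> c * measure lebesgue (cball a r)" if x: "x \<in> ?E" "0 < d" for x d
  proof -
    obtain a r where ar: "0 < r" "r < d" "x \<in> cball a r"
      "measure lebesgue (E \<inter> cball a r) \<le> c * measure lebesgue (cball a r)"
      using thin[of x d] x by blast
    have "measure lebesgue (?E \<inter> cball a r) \<le> measure lebesgue (E \<inter> cball a r)"
    proof (intro measure_mono_fmeasurable)
      show "E \<inter> cball a r \<in> lmeasurable"
        using E lmeasurable_cball by (rule sets_Int_fmeasurable)
    qed (use m in auto)
    also have "\<dots> \<le> c * measure lebesgue (cball a r)" by (rule ar(4))
    finally show ?thesis using ar(1-3) by blast
  qed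
  have "measure lebesgue ?E \<le> c * measure lebesgue ?E + \<epsilon>" if "0 < \<epsilon>" for \<epsilon>
  proof -
    obtain U where U: "open U" "?E \<subseteq> U" "U \<in> lmeasurable" "measure lebesgue U < measure lebesgue ?E + \<epsilon>"
      using lmeasurable_outer_open[OF m \<open>0 < \<epsilon>\<close>] by blast
    have "measure lebesgue ?E \<le> c * measure lebesgue U"
      by (rule measure_le_if_thin_cballs[OF m c(1) U(1-3) thin'])
    also have "\<dots> \<le> c * (measure lebesgue ?E + \<epsilon>)"
      using U(4) c(1) by (intro mult_left_mono) auto
    also have "\<dots> \<le> c * measure lebesgue ?E + \<epsilon>"
      using c \<open>0 < \<epsilon>\<close> by (simp add: distrib_left mult_left_le_one_le)
    finally show ?thesis .
  qed
  then have "measure lebesgue ?E \<le> c * measure lebesgue ?E" by (rule field_le_epsilon)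
  then have "(1 - c) * measure lebesgue ?E \<le> 0" by (simp add: algebra_simps)
  then have "measure lebesgue ?E = 0"
    using c(2) measure_nonneg[of lebesgue ?E] by (simp add: mult_le_0_iff)
  with m show "negligible ?E" by (simp add: negligible_iff_measure0)
qed

lemma interval_as_cball:
  fixes p q :: real
  assumes "p < q"
  obtains c r where "0 < r" "q - p = 2 * r" "p = c - r" "q = c + r" "{p..q} = cball c r"
proof
  show "p = (p + q) / 2 - (q - p) / 2" "q = (p + q) / 2 + (q - p) / 2" by argo+
  then show "{p..q} = cball ((p + q) / 2) ((q - p) / 2)" by (simp only: cball_eq_atLeastAtMost)
qed (use assms in auto)

lemma content_cball_real: "0 \<le> r \<Longrightarrow> measure lborel (cball (c::real) r) = 2 * r"
  by (simp add: cball_eq_atLeastAtMost)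

corollary negligible_if_thin_intervals:
  fixes E :: "real set"
  assumes E: "E \<in> sets lebesgue" and c: "0 \<le> c" "c < 1"
    and thin: "\<And>x d. x \<in> E \<Longrightarrow> 0 < d \<Longrightarrow>
      \<exists>p q. p < q \<and> x \<in> {p..q} \<and> q - p < d \<and> measure lebesgue (E \<inter> {p..q}) \<le> c * (q - p)"
  shows "negligible E"
proof (rule negligible_if_thin_cballs[OF E c])
  fix x d :: real assume "x \<in> E" "0 < d"
  then obtain p q where pq: "p < q" "x \<in> {p..q}" "q - p < d" "measure lebesgue (E \<inter> {p..q}) \<le> c * (q - p)"
    using thin by blast
  obtain a r where "0 < r" "q - p = 2 * r" "{p..q} = cball a r"
    using interval_as_cball[OF pq(1)] .
  with pq have "0 < r \<and> r < d \<and> x \<in> cball a r \<and>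
      measure lebesgue (E \<inter> cball a r) \<le> c * measure lebesgue (cball a r)"
    by (simp add: content_cball_real del: mem_cball)
  then show "\<exists>a r. 0 < r \<and> r < d \<and> x \<in> cball a r \<and>
      measure lebesgue (E \<inter> cball a r) \<le> c * measure lebesgue (cball a r)" by blast
qed

corollary exists_dense_interval:
  fixes T :: "real set"
  assumes T: "T \<in> sets lebesgue" "\<not> negligible T" and c: "0 \<le> c" "c < 1" and "0 < d"
  obtains a b where "a < b" "b - a < d" "c * (b - a) < measure lebesgue (T \<inter> {a..b})"
proof -
  have "\<exists>a b. a < b \<and> b - a < d \<and> c * (b - a) < measure lebesgue (T \<inter> {a..b})"
  proof (rule ccontr)
    assume none: "\<not> ?thesis"
    have "negligible T"
    proof (rule negligible_if_thin_intervals[OF T(1) c])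
      fix x \<delta> :: real assume "x \<in> T" "0 < \<delta>"
      define q where "q = x + min d \<delta> / 2"
      have q: "x < q" "q - x < d" "q - x < \<delta>" using \<open>0 < d\<close> \<open>0 < \<delta>\<close> by (auto simp: q_def)
      then have "measure lebesgue (T \<inter> {x..q}) \<le> c * (q - x)" using none by (meson not_less)
      moreover have "x \<in> {x..q}" using q(1) by simp
      ultimately show "\<exists>p q. p < q \<and> x \<in> {p..q} \<and> q - p < \<delta> \<and> measure lebesgue (T \<inter> {p..q}) \<le> c * (q - p)"
        using q by blast
    qed
    with T(2) show False by simp
  qed
  with that show thesis by blast
qed

section \<open>Steep intervals of monotone functions\<close>

definition steep_on :: "(real \<Rightarrow> real) \<Rightarrow> real \<Rightarrow> real \<Rightarrow> real \<Rightarrow> bool" where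
  "steep_on F v p q \<longleftrightarrow> p < q \<and> v * (q - p) \<le> F q - F p"

lemma disjoint_intervals_ordered:
  fixes c c' r r' :: real
  assumes "disjnt (cball c r) (cball c' r')" "c' \<le> c" "0 < r" "0 < r'"
  shows "c' + r' < c - r"
proof (rule ccontr)
  assume "\<not> c' + r' < c - r"
  then have "max (c - r) c' \<in> cball c r \<inter> cball c' r'"
    using assms by (auto simp: dist_real_def)
  then show False using assms(1) by (auto simp: disjnt_def)
qed

lemma sum_increments_le:
  fixes F :: "real \<Rightarrow> real"
  assumes "finite C" "mono_on {a..b} F" "a \<le> b"
    and "\<And>i. i \<in> C \<Longrightarrow> 0 < r i \<and> a \<le> c i - r i \<and> c i + r i \<le> b"
    and "pairwise (\<lambda>i j. disjnt (cball (c i) (r i)) (cball (c j) (r j))) C"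
  shows "(\<Sum>i\<in>C. F (c i + r i) - F (c i - r i)) \<le> F b - F a"
  using assms
proof (induction C arbitrary: b rule: finite_ranking_induct[where f = c])
  case empty
  then show ?case by (simp add: mono_on_def)
next
  case (insert i C)
  have i: "0 < r i" "a \<le> c i - r i" "c i + r i \<le> b" using insert.prems(3)[of i] by auto
  show ?case
  proof (cases "i \<in> C")
    case True
    then show ?thesis using insert by (simp add: insert_absorb)
  next
    case False
    have before: "c j + r j < c i - r i" if "j \<in> C" for j
    proof (rule disjoint_intervals_ordered)
      show "disjnt (cball (c i) (r i)) (cball (c j) (r j))"
        by (rule pairwiseD[OF insert.prems(4)]) (use that False in auto)
      show "c j \<le> c i" "0 < r i" "0 < r j"
        using insert.hyps(2)[OF that] insert.prems(3)[of j] that i by simp_all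
    qed
    have "(\<Sum>i\<in>C. F (c i + r i) - F (c i - r i)) \<le> F (c i - r i) - F a"
    proof (rule insert.IH)
      show "mono_on {a..c i - r i} F"
        using insert.prems(1) by (rule mono_on_subset) (use i in auto)
      show "pairwise (\<lambda>i j. disjnt (cball (c i) (r i)) (cball (c j) (r j))) C"
        using insert.prems(4) by (rule pairwise_subset) auto
      show "0 < r j \<and> a \<le> c j - r j \<and> c j + r j \<le> c i - r i" if "j \<in> C" for j
        using insert.prems(3)[of j] before[OF that] that by auto
    qed (use i in auto)
    moreover have "F (c i + r i) \<le> F b"
      by (rule mono_onD[OF insert.prems(1)]) (use i in auto)
    ultimately show ?thesis
      using False insert.hyps by simp
  qed
qed

lemma measure_UN_steep_cballs:
  fixes F :: "real \<Rightarrow> real"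
  assumes "countable C" and F: "mono_on {a..b} F" "a \<le> b" and "0 < v" "0 \<le> k"
    and C: "\<And>i. i \<in> C \<Longrightarrow> a \<le> c i - r i \<and> c i + r i \<le> b \<and> steep_on F v (c i - r i) (c i + r i)"
    and disj: "pairwise (\<lambda>i j. disjnt (cball (c i) (r i)) (cball (c j) (r j))) C"
  shows "(\<Union>i\<in>C. cball (c i) (k * r i)) \<in> lmeasurable"
    and "v * measure lebesgue (\<Union>i\<in>C. cball (c i) (k * r i)) \<le> k * (F b - F a)"
proof -
  have "(\<Sum>i\<in>D. measure lebesgue (cball (c i) (k * r i))) \<le> k * (F b - F a) / v"
    if D: "D \<subseteq> C" "finite D" for D
  proof -
    have "(\<Sum>i\<in>D. measure lebesgue (cball (c i) (k * r i)))
        \<le> (\<Sum>i\<in>D. k / v * (F (c i + r i) - F (c i - r i)))"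
    proof (rule sum_mono)
      fix i assume "i \<in> D"
      then have i: "0 < r i" "v * (2 * r i) \<le> F (c i + r i) - F (c i - r i)"
        using C D(1) by (auto simp: steep_on_def)
      have "measure lebesgue (cball (c i) (k * r i)) = k / v * (v * (2 * r i))"
        using i(1) \<open>0 < v\<close> \<open>0 \<le> k\<close> content_cball_real[of "k * r i" "c i"] by simp
      also have "\<dots> \<le> k / v * (F (c i + r i) - F (c i - r i))"
        using i(2) \<open>0 < v\<close> \<open>0 \<le> k\<close> by (intro mult_left_mono) auto
      finally show "measure lebesgue (cball (c i) (k * r i)) \<le> k / v * (F (c i + r i) - F (c i - r i))" .
    qed
    also have "\<dots> = k / v * (\<Sum>i\<in>D. F (c i + r i) - F (c i - r i))"
      by (simp add: sum_distrib_left)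
    also have "\<dots> \<le> k / v * (F b - F a)"
    proof (intro mult_left_mono sum_increments_le)
      show "pairwise (\<lambda>i j. disjnt (cball (c i) (r i)) (cball (c j) (r j))) D"
        using disj D(1) by (rule pairwise_subset)
      show "0 < r i \<and> a \<le> c i - r i \<and> c i + r i \<le> b" if "i \<in> D" for i
        using C[of i] D(1) that by (auto simp: steep_on_def)
      show "mono_on {a..b} F" "a \<le> b" "finite D" "0 \<le> k / v"
        using F D(2) \<open>0 < v\<close> \<open>0 \<le> k\<close> by auto
    qed
    finally show ?thesis by simp
  qed
  note bound = measure_countable_UN_le[OF \<open>countable C\<close> lmeasurable_cball this]
  show "(\<Union>i\<in>C. cball (c i) (k * r i)) \<in> lmeasurable" by (rule bound(1))
  show "v * measure lebesgue (\<Union>i\<in>C. cball (c i) (k * r i)) \<le> k * (F b - F a)"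
    using bound(2) \<open>0 < v\<close> by (simp add: field_simps)
qed

definition steep_cballs :: "(real \<Rightarrow> real) \<Rightarrow> real \<Rightarrow> real \<Rightarrow> real \<Rightarrow> (real \<times> real) set" where
  "steep_cballs F v a b = {(c, r). a \<le> c - r \<and> c + r \<le> b \<and> steep_on F v (c - r) (c + r)}"

lemma steep_cballs_cover:
  assumes "steep_on F v p q" "a \<le> p" "q \<le> b"
  obtains c r where "(c, r) \<in> steep_cballs F v a b" "{p..q} = cball c r" "q - p = 2 * r" "0 < r"
proof -
  have "p < q" using assms(1) by (simp add: steep_on_def)
  then obtain c r where "0 < r" "q - p = 2 * r" "p = c - r" "q = c + r" "{p..q} = cball c r"
    by (rule interval_as_cball)
  with assms that[of c r] show thesis by (auto simp: steep_cballs_def)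
qed

lemma measure_steep_set_le:
  fixes F :: "real \<Rightarrow> real"
  assumes F: "mono_on {a..b} F" "a \<le> b" and "0 < v" and E: "E \<in> lmeasurable"
    and steep: "\<And>x d. x \<in> E \<Longrightarrow> 0 < d \<Longrightarrow>
      \<exists>p q. a \<le> p \<and> q \<le> b \<and> x \<in> {p..q} \<and> q - p < d \<and> steep_on F v p q"
  shows "v * measure lebesgue E \<le> F b - F a"
proof -
  obtain C where C: "countable C" "C \<subseteq> steep_cballs F v a b"
     "pairwise (\<lambda>i j. disjnt (cball (fst i) (snd i)) (cball (fst j) (snd j))) C"
     "negligible (E - (\<Union>i\<in>C. cball (fst i) (snd i)))"
  proof (rule Vitali_covering_theorem_cballs)
    show "0 < snd i" if "i \<in> steep_cballs F v a b" for i
      using that by (auto simp: steep_cballs_def steep_on_def)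
    show "\<exists>i. i \<in> steep_cballs F v a b \<and> x \<in> cball (fst i) (snd i) \<and> snd i < d" if x: "x \<in> E" "0 < d" for x d
    proof -
      obtain p q where pq: "a \<le> p" "q \<le> b" "x \<in> {p..q}" "q - p < d" "steep_on F v p q"
        using steep[OF x] by blast
      then obtain c r where "(c, r) \<in> steep_cballs F v a b" "{p..q} = cball c r" "q - p = 2 * r" "0 < r"
        using steep_cballs_cover by metis
      with pq show ?thesis by (intro exI[of _ "(c, r)"]) auto
    qed
  qed
  have "a \<le> fst i - snd i \<and> fst i + snd i \<le> b \<and> steep_on F v (fst i - snd i) (fst i + snd i)" if "i \<in> C" for i
    using C(2) that by (auto simp: steep_cballs_def)
  note cover = measure_UN_steep_cballs[OF C(1) F \<open>0 < v\<close> _ this C(3), of 1, simplified]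
  have "v * measure lebesgue E \<le> v * measure lebesgue (\<Union>i\<in>C. cball (fst i) (snd i))"
    using measure_le_negligible_Diff[OF E cover(1) C(4)] \<open>0 < v\<close> by (intro mult_left_mono) auto
  with cover(2) show ?thesis by linarith
qed

lemma weak_maximal_inequality:
  fixes F :: "real \<Rightarrow> real"
  assumes F: "mono_on {a..b} F" "a \<le> b" and "0 < v"
    and steep: "\<And>x. x \<in> B \<Longrightarrow> \<exists>p q. a \<le> p \<and> q \<le> b \<and> x \<in> {p..q} \<and> steep_on F v p q"
  obtains M where "B \<subseteq> M" "M \<in> lmeasurable" "v * measure lebesgue M \<le> 5 * (F b - F a)"
proof -
  obtain C where C: "countable C" "C \<subseteq> steep_cballs F v a b"
     "pairwise (\<lambda>i j. disjnt (cball (fst i) (snd i)) (cball (fst j) (snd j))) C"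
     "B \<subseteq> (\<Union>i\<in>C. cball (fst i) (5 * snd i))"
  proof (rule Vitali_covering_lemma_cballs)
    show "0 < snd i \<and> snd i \<le> b - a" if "i \<in> steep_cballs F v a b" for i
      using that by (auto simp: steep_cballs_def steep_on_def)
    show "B \<subseteq> (\<Union>i\<in>steep_cballs F v a b. cball (fst i) (snd i))"
    proof
      fix x assume "x \<in> B"
      then obtain p q where pq: "a \<le> p" "q \<le> b" "x \<in> {p..q}" "steep_on F v p q"
        using steep by blast
      then obtain c r where "(c, r) \<in> steep_cballs F v a b" "{p..q} = cball c r"
        using steep_cballs_cover by metis
      with pq(3) show "x \<in> (\<Union>i\<in>steep_cballs F v a b. cball (fst i) (snd i))" by fastforce
    qed
  qed
  have "a \<le> fst i - snd i \<and> fst i + snd i \<le> b \<and> steep_on F v (fst i - snd i) (fst i + snd i)" if "i \<in> C" for i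
    using C(2) that by (auto simp: steep_cballs_def)
  note cover = measure_UN_steep_cballs[OF C(1) F \<open>0 < v\<close> _ this C(3), of 5, simplified]
  show thesis using that[OF C(4)] cover by simp
qed

section \<open>Lipschitz extension\<close>

definition mcshane_extension :: "real \<Rightarrow> 'a::metric_space set \<Rightarrow> ('a \<Rightarrow> real) \<Rightarrow> 'a \<Rightarrow> real" where
  "mcshane_extension L E f x = (INF s\<in>E. f s + L * dist x s)"

lemma mcshane_extension_bdd_below:
  fixes f :: "'a::metric_space \<Rightarrow> real"
  assumes lip: "L-lipschitz_on E f"
  shows "bdd_below ((\<lambda>s. f s + L * dist x s) ` E)"
proof (cases "E = {}")
  case False
  then obtain s0 where s0: "s0 \<in> E" by blast
  have "f s0 - L * dist x s0 \<le> f s + L * dist x s" if "s \<in> E" for s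
  proof -
    have "f s0 - f s \<le> L * dist s0 s"
      using lipschitz_onD[OF lip s0 that] by (simp add: dist_real_def)
    also have "\<dots> \<le> L * (dist x s0 + dist x s)"
      using lipschitz_on_nonneg[OF lip] dist_triangle3[of s0 s x] by (rule mult_left_mono[rotated])
    finally show ?thesis by (simp add: distrib_left)
  qed
  then show ?thesis by (auto intro!: bdd_belowI)
qed simp

lemma mcshane_extension_le:
  assumes "L-lipschitz_on E f" "s \<in> E"
  shows "mcshane_extension L E f x \<le> f s + L * dist x s"
  unfolding mcshane_extension_def using mcshane_extension_bdd_below[OF assms(1)] assms(2) by (rule cINF_lower)

lemma mcshane_extension_greatest:
  assumes "E \<noteq> {}" "\<And>s. s \<in> E \<Longrightarrow> c \<le> f s + L * dist x s"
  shows "c \<le> mcshane_extension L E f x"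
  unfolding mcshane_extension_def using assms by (rule cINF_greatest)

lemma mcshane_extension_attained:
  assumes "finite E" "E \<noteq> {}"
  obtains s where "s \<in> E" "mcshane_extension L E f x = f s + L * dist x s"
proof -
  let ?V = "(\<lambda>s. f s + L * dist x s) ` E"
  have "mcshane_extension L E f x = Min ?V"
    unfolding mcshane_extension_def using assms by (intro cInf_eq_Min) auto
  moreover have "Min ?V \<in> ?V" using assms by (intro Min_in) auto
  ultimately show thesis using that by auto
qed

lemma lipschitz_on_mcshane_extension:
  fixes f :: "'a::metric_space \<Rightarrow> real"
  assumes lip: "L-lipschitz_on E f" and "E \<noteq> {}"
  shows "L-lipschitz_on UNIV (mcshane_extension L E f)"
proof (rule lipschitz_onI)
  show L: "0 \<le> L" using lip by (rule lipschitz_on_nonneg)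
  have le: "mcshane_extension L E f x - L * dist x y \<le> mcshane_extension L E f y" for x y
  proof (rule mcshane_extension_greatest[OF \<open>E \<noteq> {}\<close>])
    fix s assume "s \<in> E"
    have "L * dist x s \<le> L * (dist x y + dist y s)"
      using dist_triangle L by (rule mult_left_mono)
    then show "mcshane_extension L E f x - L * dist x y \<le> f s + L * dist y s"
      using mcshane_extension_le[OF lip \<open>s \<in> E\<close>, of x] by (simp add: distrib_left)
  qed
  show "dist (mcshane_extension L E f x) (mcshane_extension L E f y) \<le> L * dist x y" for x y
    using le[of x y] le[of y x] by (simp add: dist_real_def dist_commute abs_le_iff)
qed

lemma mcshane_extension_eq:
  assumes lip: "L-lipschitz_on E f" and "x \<in> E"
  shows "mcshane_extension L E f x = f x"
proof (rule antisym)
  show "mcshane_extension L E f x \<le> f x" using mcshane_extension_le[OF assms, of x] by simp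
  show "f x \<le> mcshane_extension L E f x"
  proof (rule mcshane_extension_greatest)
    show "f x \<le> f s + L * dist x s" if "s \<in> E" for s
      using lipschitz_onD[OF lip \<open>x \<in> E\<close> that] by (simp add: dist_real_def)
  qed (use \<open>x \<in> E\<close> in blast)
qed

lemma lipschitz_extend_real:
  fixes f :: "'a::metric_space \<Rightarrow> real"
  assumes lip: "L-lipschitz_on E f"
  obtains g where "L-lipschitz_on UNIV g" "\<And>x. x \<in> E \<Longrightarrow> g x = f x"
proof (cases "E = {}")
  case True
  have "L-lipschitz_on UNIV (\<lambda>x::'a. 0::real)"
    using lipschitz_on_nonneg[OF lip] by (simp add: lipschitz_on_def)
  then show thesis using that True by blast
next
  case False
  show thesis
    using that[OF lipschitz_on_mcshane_extension[OF lip False]] mcshane_extension_eq[OF lip] by blast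
qed

lemma lipschitz_on_inner_Basis:
  assumes "L-lipschitz_on S f" "b \<in> Basis"
  shows "L-lipschitz_on S (\<lambda>x. f x \<bullet> b)"
proof (rule lipschitz_onI)
  show "dist (f x \<bullet> b) (f y \<bullet> b) \<le> L * dist x y" if "x \<in> S" "y \<in> S" for x y
    using lipschitz_onD[OF assms(1) that] Basis_le_norm[OF assms(2), of "f x - f y"]
    by (simp add: dist_norm inner_diff_left)
qed (rule lipschitz_on_nonneg[OF assms(1)])

lemma lipschitz_extend_euclidean:
  fixes f :: "'b::metric_space \<Rightarrow> 'a::euclidean_space" and L :: real
  assumes lip: "L-lipschitz_on E f"
  obtains g where "(DIM('a) * L)-lipschitz_on UNIV g" "\<And>x. x \<in> E \<Longrightarrow> g x = f x"
proof -
  have "\<exists>g. L-lipschitz_on UNIV g \<and> (\<forall>x\<in>E. g x = f x \<bullet> b)" if "b \<in> Basis" for b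
    using lipschitz_on_inner_Basis[OF lip that] by (rule lipschitz_extend_real) blast
  then obtain g where g: "\<And>b. b \<in> Basis \<Longrightarrow> L-lipschitz_on UNIV (g b)"
    "\<And>b x. b \<in> Basis \<Longrightarrow> x \<in> E \<Longrightarrow> g b x = f x \<bullet> b"
    by metis
  define h where "h x = (\<Sum>b\<in>Basis. g b x *\<^sub>R b)" for x
  show thesis
  proof
    show "(DIM('a) * L)-lipschitz_on UNIV h"
    proof (rule lipschitz_onI)
      show "0 \<le> DIM('a) * L" using lipschitz_on_nonneg[OF lip] by simp
      fix x y
      have "norm (h x - h y) = norm (\<Sum>b\<in>Basis. (g b x - g b y) *\<^sub>R b)"
        by (simp add: h_def sum_subtractf scaleR_diff_left)
      also have "\<dots> \<le> (\<Sum>b\<in>(Basis::'a set). L * dist x y)"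
      proof (rule sum_norm_le)
        show "norm ((g b x - g b y) *\<^sub>R b) \<le> L * dist x y" if "b \<in> Basis" for b
          using lipschitz_onD[OF g(1)[OF that], of x y] that by (simp add: dist_real_def)
      qed
      finally show "dist (h x) (h y) \<le> DIM('a) * L * dist x y"
        by (simp add: dist_norm)
    qed
    show "h x = f x" if "x \<in> E" for x
      using that g(2) by (simp add: h_def euclidean_representation)
  qed
qed

section \<open>Lipschitz curves are differentiable almost everywhere\<close>

definition slope :: "(real \<Rightarrow> real) \<Rightarrow> real \<Rightarrow> real \<Rightarrow> real" where
  "slope F x h = (F (x + h) - F x) / h"

definition oscillation_set :: "(real \<Rightarrow> real) \<Rightarrow> real \<Rightarrow> real \<Rightarrow> real set" where
  "oscillation_set F u v =
     {x. (\<exists>\<^sub>F h in at 0. slope F x h < u) \<and> (\<exists>\<^sub>F h in at 0. v < slope F x h)}"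

lemma frequently_at_0_real:
  assumes "\<exists>\<^sub>F h in at (0::real). P h" "0 < d"
  obtains h where "h \<noteq> 0" "\<bar>h\<bar> < d" "P h"
  using assms by (auto simp: frequently_at)

lemma slope_interval:
  assumes "h \<noteq> 0"
  obtains p q where "p < q" "x \<in> {p..q}" "q - p = \<bar>h\<bar>" "x - \<bar>h\<bar> \<le> p" "q \<le> x + \<bar>h\<bar>"
    "F q - F p = slope F x h * (q - p)"
proof
  show "min x (x + h) < max x (x + h)" "x \<in> {min x (x + h)..max x (x + h)}"
    "max x (x + h) - min x (x + h) = \<bar>h\<bar>" "x - \<bar>h\<bar> \<le> min x (x + h)" "max x (x + h) \<le> x + \<bar>h\<bar>"
    using assms by auto
  show "F (max x (x + h)) - F (min x (x + h)) = slope F x h * (max x (x + h) - min x (x + h))"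
    using assms by (cases "0 < h") (auto simp: slope_def field_simps)
qed

lemma borel_frequently_at:
  fixes a :: "'b::metric_space"
  assumes "\<And>h. h \<noteq> a \<Longrightarrow> open {x. P x h}"
  shows "{x. \<exists>\<^sub>F h in at a. P x h} \<in> sets borel"
proof -
  define U where "U n = (\<Union>h\<in>{h. h \<noteq> a \<and> dist h a < 1 / Suc n}. {x. P x h})" for n :: nat
  have "{x. \<exists>\<^sub>F h in at a. P x h} = (\<Inter>n. U n)"
  proof (intro equalityI subsetI INT_I)
    fix x n assume "x \<in> {x. \<exists>\<^sub>F h in at a. P x h}"
    moreover have "0 < 1 / real (Suc n)" by simp
    ultimately show "x \<in> U n" unfolding U_def frequently_at by blast
  next
    fix x assume x: "x \<in> (\<Inter>n. U n)"
    have "\<exists>h\<in>UNIV. h \<noteq> a \<and> dist h a < d \<and> P x h" if d: "0 < d" for d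
    proof -
      obtain n where n: "1 / real (Suc n) < d" using nat_approx_posE[OF d] by blast
      have "x \<in> U n" using x by blast
      with n show ?thesis unfolding U_def by fastforce
    qed
    then show "x \<in> {x. \<exists>\<^sub>F h in at a. P x h}" by (simp add: frequently_at)
  qed
  moreover have "open (U n)" for n unfolding U_def using assms by (intro open_UN) auto
  ultimately show ?thesis by (auto intro: sets.countable_INT)
qed

lemma borel_oscillation_set:
  assumes cont: "continuous_on UNIV F"
  shows "oscillation_set F u v \<in> sets borel"
proof -
  have "open {x. slope F x h < u}" "open {x. v < slope F x h}" if "h \<noteq> 0" for h
    using that unfolding slope_def
    by (auto intro!: open_Collect_less continuous_intros continuous_on_compose2[OF cont])
  then have "{x. \<exists>\<^sub>F h in at 0. slope F x h < u} \<inter> {x. \<exists>\<^sub>F h in at 0. v < slope F x h} \<in> sets borel"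
    by (intro sets.Int borel_frequently_at)
  then show ?thesis by (simp add: oscillation_set_def Collect_conj_eq)
qed

lemma measure_frequently_steep_le:
  assumes "mono F" "p \<le> q" "0 < v" and E: "E \<in> sets lebesgue"
    and steep: "\<And>x. x \<in> E \<Longrightarrow> \<exists>\<^sub>F h in at 0. v < slope F x h"
  shows "v * measure lebesgue (E \<inter> {p..q}) \<le> F q - F p"
proof -
  have m: "E \<inter> {p<..<q} \<in> lmeasurable" "E \<inter> {p..q} \<in> lmeasurable"
    using E by (auto intro!: sets_Int_fmeasurable lmeasurable_interval)
  have "E \<inter> {p..q} - E \<inter> {p<..<q} \<subseteq> {p, q}" by auto
  then have "negligible (E \<inter> {p..q} - E \<inter> {p<..<q})"
    by (rule negligible_subset[rotated]) (simp add: negligible_finite)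
  then have "v * measure lebesgue (E \<inter> {p..q}) \<le> v * measure lebesgue (E \<inter> {p<..<q})"
    using m \<open>0 < v\<close> by (intro mult_left_mono measure_le_negligible_Diff) auto
  also have "\<dots> \<le> F q - F p"
  proof (rule measure_steep_set_le[OF _ \<open>p \<le> q\<close> \<open>0 < v\<close> m(1)])
    show "mono_on {p..q} F" using \<open>mono F\<close> by (rule mono_on_subset) auto
    fix x d :: real assume x: "x \<in> E \<inter> {p<..<q}" and "0 < d"
    then have "0 < min d (min (x - p) (q - x))" by auto
    with steep[of x] x obtain h where h: "h \<noteq> 0" "\<bar>h\<bar> < min d (min (x - p) (q - x))" "v < slope F x h"
      by (blast elim: frequently_at_0_real)
    obtain p' q' where pq: "p' < q'" "x \<in> {p'..q'}" "q' - p' = \<bar>h\<bar>" "x - \<bar>h\<bar> \<le> p'" "q' \<le> x + \<bar>h\<bar>"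
      "F q' - F p' = slope F x h * (q' - p')"
      using slope_interval[OF h(1)] by blast
    have "v * (q' - p') \<le> F q' - F p'"
      unfolding pq(6) using h(3) pq(1) by (intro mult_right_mono) auto
    with pq(1) have "steep_on F v p' q'" by (simp add: steep_on_def)
    moreover have "p \<le> p'" "q' \<le> q" "q' - p' < d" using h(2) pq by auto
    ultimately show "\<exists>p' q'. p \<le> p' \<and> q' \<le> q \<and> x \<in> {p'..q'} \<and> q' - p' < d \<and> steep_on F v p' q'"
      using pq(2) by blast
  qed
  finally show ?thesis .
qed

lemma negligible_oscillation_set:
  assumes "mono F" and cont: "continuous_on UNIV F" and "0 < u" "u < v"
  shows "negligible (oscillation_set F u v)"
proof (rule negligible_if_thin_intervals)
  let ?E = "oscillation_set F u v"
  show E: "?E \<in> sets lebesgue"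
    using borel_oscillation_set[OF cont] by (simp add: sets_completionI_sets)
  show "0 \<le> u / v" "u / v < 1" using assms(3,4) by auto
  fix x d :: real assume "x \<in> ?E" "0 < d"
  then obtain h where h: "h \<noteq> 0" "\<bar>h\<bar> < d" "slope F x h < u"
    unfolding oscillation_set_def by (blast elim: frequently_at_0_real)
  obtain p q where pq: "p < q" "x \<in> {p..q}" "q - p = \<bar>h\<bar>" "F q - F p = slope F x h * (q - p)"
    using slope_interval[OF h(1)] by blast
  have "v * measure lebesgue (?E \<inter> {p..q}) \<le> F q - F p"
    using \<open>mono F\<close> pq(1) assms(3,4) E
    by (intro measure_frequently_steep_le) (auto simp: oscillation_set_def)
  also have "\<dots> \<le> u * (q - p)"
    unfolding pq(4) using h(3) pq(1) by (intro mult_right_mono) auto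
  finally have "measure lebesgue (?E \<inter> {p..q}) \<le> u / v * (q - p)"
    using assms(3,4) by (simp add: field_simps)
  moreover have "q - p < d" using pq(3) h(2) by simp
  ultimately show "\<exists>p q. p < q \<and> x \<in> {p..q} \<and> q - p < d \<and> measure lebesgue (?E \<inter> {p..q}) \<le> u / v * (q - p)"
    using pq(1,2) by blast
qed

lemma frequently_less_if_Liminf_less:
  fixes f :: "'b \<Rightarrow> 'c::complete_linorder"
  assumes "Liminf F f < l"
  shows "\<exists>\<^sub>F x in F. f x < l"
proof (rule ccontr)
  assume "\<not> ?thesis"
  then have "l \<le> Liminf F f" by (intro Liminf_bounded) (simp add: not_frequently not_less)
  with assms show False by simp
qed

lemma frequently_greater_if_Limsup_greater:
  fixes f :: "'b \<Rightarrow> 'c::complete_linorder"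
  assumes "l < Limsup F f"
  shows "\<exists>\<^sub>F x in F. l < f x"
proof (rule ccontr)
  assume "\<not> ?thesis"
  then have "Limsup F f \<le> l" by (intro Limsup_bounded) (simp add: not_frequently not_less)
  with assms show False by simp
qed

lemma tendsto_if_not_oscillating:
  fixes q :: "'b \<Rightarrow> real"
  assumes "F \<noteq> bot" and bounds: "\<forall>\<^sub>F h in F. a \<le> q h" "\<forall>\<^sub>F h in F. q h \<le> b"
    and no_osc: "\<And>u v. u \<in> \<rat> \<Longrightarrow> v \<in> \<rat> \<Longrightarrow> a < u \<Longrightarrow> u < v \<Longrightarrow>
      (\<exists>\<^sub>F h in F. q h < u) \<Longrightarrow> (\<exists>\<^sub>F h in F. v < q h) \<Longrightarrow> False"
  obtains D where "(q \<longlongrightarrow> D) F"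
proof -
  let ?l = "Liminf F (\<lambda>h. ereal (q h))" and ?L = "Limsup F (\<lambda>h. ereal (q h))"
  have l: "ereal a \<le> ?l" using bounds(1) by (intro Liminf_bounded) simp
  have L: "?L \<le> ereal b" using bounds(2) by (intro Limsup_bounded) simp
  have "\<not> ?l < ?L"
  proof
    assume "?l < ?L"
    then obtain s t where st: "?l < ereal s" "ereal s < ereal t" "ereal t < ?L"
      using ereal_dense2 by metis
    obtain u where u: "u \<in> \<rat>" "s < u" "u < t" using Rats_dense_in_real[of s t] st(2) by auto
    obtain v where v: "v \<in> \<rat>" "u < v" "v < t" using Rats_dense_in_real[of u t] u(3) by auto
    have "?l < ereal u" using st(1) u(2) by (meson ereal_less(2) less_ereal.simps(1) less_trans)
    have "ereal v < ?L" using st(3) v(3) by (meson less_ereal.simps(1) less_trans)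
    have "\<exists>\<^sub>F h in F. q h < u" using frequently_less_if_Liminf_less[OF \<open>?l < ereal u\<close>] by simp
    moreover have "\<exists>\<^sub>F h in F. v < q h" using frequently_greater_if_Limsup_greater[OF \<open>ereal v < ?L\<close>] by simp
    moreover have "a < u" using le_less_trans[OF l \<open>?l < ereal u\<close>] by simp
    ultimately show False using no_osc u(1) v(1,2) by blast
  qed
  then have "?l = ?L" using Liminf_le_Limsup[OF \<open>F \<noteq> bot\<close>, of "\<lambda>h. ereal (q h)"] by simp
  obtain D where "?l = ereal D" using l L unfolding \<open>?l = ?L\<close> by (cases ?L) auto
  with \<open>?l = ?L\<close> have "((\<lambda>h. ereal (q h)) \<longlongrightarrow> ereal D) F"
    using Liminf_eq_Limsup[OF \<open>F \<noteq> bot\<close>] by metis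
  then show thesis using that by simp
qed

lemma differentiable_if_not_oscillating:
  assumes bounds: "\<And>h. h \<noteq> 0 \<Longrightarrow> a \<le> slope F x h" "\<And>h. h \<noteq> 0 \<Longrightarrow> slope F x h \<le> b"
    and no_osc: "\<And>u v. u \<in> \<rat> \<Longrightarrow> v \<in> \<rat> \<Longrightarrow> a < u \<Longrightarrow> u < v \<Longrightarrow> x \<notin> oscillation_set F u v"
  shows "F differentiable (at x)"
proof -
  obtain D where "(slope F x \<longlongrightarrow> D) (at 0)"
  proof (rule tendsto_if_not_oscillating)
    show "\<forall>\<^sub>F h in at 0. a \<le> slope F x h" "\<forall>\<^sub>F h in at 0. slope F x h \<le> b"
      using bounds by (auto simp: eventually_at_filter)
    show False if "u \<in> \<rat>" "v \<in> \<rat>" "a < u" "u < v"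
      "\<exists>\<^sub>F h in at 0. slope F x h < u" "\<exists>\<^sub>F h in at 0. v < slope F x h" for u v
      using no_osc that by (auto simp: oscillation_set_def)
  qed (use that in simp_all)
  then have "(F has_field_derivative D) (at x)" by (simp add: DERIV_def slope_def[abs_def])
  then show ?thesis by (auto simp: real_differentiable_def)
qed

lemma negligible_not_differentiable_real:
  fixes f :: "real \<Rightarrow> real"
  assumes lip: "L-lipschitz_on UNIV f"
  shows "negligible {x. \<not> f differentiable (at x)}"
proof -
  have L: "0 \<le> L" using lip by (rule lipschitz_on_nonneg)
  \<comment> \<open>adding a linear function makes all slopes at least 1\<close>
  define F where "F x = f x + (L + 1) * x" for x
  have slope_bounds: "1 \<le> slope F x h" "slope F x h \<le> 2 * L + 1" if "h \<noteq> 0" for x h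
  proof -
    have "slope F x h = (f (x + h) - f x) / h + (L + 1)"
      using that by (simp add: slope_def F_def field_simps)
    moreover have "\<bar>(f (x + h) - f x) / h\<bar> \<le> L"
      using lipschitz_onD[OF lip, of "x + h" x] that
      by (simp add: dist_real_def abs_divide divide_le_eq)
    ultimately show "1 \<le> slope F x h" "slope F x h \<le> 2 * L + 1" by linarith+
  qed
  have "mono F"
  proof (rule monoI)
    fix x y :: real assume "x \<le> y"
    then show "F x \<le> F y" using slope_bounds(1)[of "y - x" x]
      by (cases "x = y") (auto simp: slope_def field_simps)
  qed
  have cont: "continuous_on UNIV F"
    unfolding F_def by (intro continuous_intros lipschitz_on_continuous_on[OF lip])
  define I where "I = {(u, v). u \<in> \<rat> \<and> v \<in> \<rat> \<and> 0 < u \<and> u < (v::real)}"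
  have "countable I"
    by (rule countable_subset[of _ "\<rat> \<times> \<rat>"]) (auto simp: I_def countable_rat)
  then have "negligible (\<Union>(u, v)\<in>I. oscillation_set F u v)"
    using negligible_oscillation_set[OF \<open>mono F\<close> cont]
    by (intro negligible_countable_Union) (auto simp: I_def)
  moreover have "{x. \<not> f differentiable (at x)} \<subseteq> (\<Union>(u, v)\<in>I. oscillation_set F u v)"
  proof (rule subsetI, rule ccontr)
    fix x assume x: "x \<in> {x. \<not> f differentiable (at x)}"
      and "x \<notin> (\<Union>(u, v)\<in>I. oscillation_set F u v)"
    then have "x \<notin> oscillation_set F u v" if "u \<in> \<rat>" "v \<in> \<rat>" "1 < u" "u < v" for u v
      using that by (auto simp: I_def)
    then have "F differentiable (at x)"
      using slope_bounds by (intro differentiable_if_not_oscillating[of 1 F x "2 * L + 1"]) auto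
    then have "(\<lambda>y. F y - (L + 1) * y) differentiable (at x)" by (intro derivative_intros) auto
    then show False using x by (simp add: F_def)
  qed
  ultimately show ?thesis by (rule negligible_subset)
qed

theorem negligible_not_differentiable_lipschitz:
  fixes f :: "real \<Rightarrow> 'a::euclidean_space"
  assumes lip: "L-lipschitz_on S f"
  shows "negligible {x \<in> S. \<not> f differentiable (at x within S)}"
proof -
  obtain g where g: "(DIM('a) * L)-lipschitz_on UNIV g" "\<And>x. x \<in> S \<Longrightarrow> g x = f x"
    using lipschitz_extend_euclidean[OF lip] by blast
  have "negligible (\<Union>b\<in>Basis. {x. \<not> (\<lambda>x. g x \<bullet> b) differentiable (at x)})"
    using lipschitz_on_inner_Basis[OF g(1)]
    by (intro negligible_Union) (auto intro: negligible_not_differentiable_real)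
  moreover have "{x \<in> S. \<not> f differentiable (at x within S)}
      \<subseteq> (\<Union>b\<in>Basis. {x. \<not> (\<lambda>x. g x \<bullet> b) differentiable (at x)})"
  proof (rule subsetI, rule ccontr)
    fix x assume x: "x \<in> {x \<in> S. \<not> f differentiable (at x within S)}"
      and "x \<notin> (\<Union>b\<in>Basis. {x. \<not> (\<lambda>x. g x \<bullet> b) differentiable (at x)})"
    then have "g differentiable (at x)"
      using differentiable_componentwise_within[of g x UNIV] by auto
    then have "g differentiable (at x within S)" by (rule differentiable_at_withinI)
    then have "f differentiable (at x within S)"
      by (rule differentiable_transform_within[of _ _ _ 1]) (use x g(2) in auto)
    with x show False by simp
  qed
  ultimately show ?thesis by (rule negligible_subset)
qed

section \<open>Ideals of sets and their kernels\<close>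

definition sigma_ideal :: "('a set \<Rightarrow> bool) \<Rightarrow> bool" where
  "sigma_ideal I \<longleftrightarrow> (\<forall>X Y. I Y \<longrightarrow> X \<subseteq> Y \<longrightarrow> I X) \<and> (\<forall>\<X>. countable \<X> \<longrightarrow> (\<forall>X\<in>\<X>. I X) \<longrightarrow> I (\<Union>\<X>))"

definition ideal_kernel :: "('a::metric_space set \<Rightarrow> bool) \<Rightarrow> 'a set \<Rightarrow> 'a set" where
  "ideal_kernel I X = {x. \<forall>r>0. \<not> I (X \<inter> ball x r)}"

lemma sigma_ideal_subset: "sigma_ideal I \<Longrightarrow> I Y \<Longrightarrow> X \<subseteq> Y \<Longrightarrow> I X"
  unfolding sigma_ideal_def by blast

lemma sigma_ideal_Union: "sigma_ideal I \<Longrightarrow> countable \<X> \<Longrightarrow> (\<And>X. X \<in> \<X> \<Longrightarrow> I X) \<Longrightarrow> I (\<Union>\<X>)"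
  unfolding sigma_ideal_def by blast

lemma sigma_ideal_empty: "sigma_ideal I \<Longrightarrow> I {}"
  using sigma_ideal_Union[of I "{}"] by simp

lemma closed_ideal_kernel:
  assumes I: "sigma_ideal I"
  shows "closed (ideal_kernel I X)"
proof -
  have "open (- ideal_kernel I X)"
  proof (rule openI)
    fix x assume "x \<in> - ideal_kernel I X"
    then obtain r where r: "r > 0" "I (X \<inter> ball x r)" by (auto simp: ideal_kernel_def)
    have "ball x (r / 2) \<subseteq> - ideal_kernel I X"
    proof
      fix y assume y: "y \<in> ball x (r / 2)"
      have "ball y (r / 2) \<subseteq> ball x r"
      proof
        fix z assume "z \<in> ball y (r / 2)"
        with y show "z \<in> ball x r" using dist_triangle[of x z y] by simp
      qed
      then have "I (X \<inter> ball y (r / 2))" using sigma_ideal_subset[OF I r(2)] by blast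
      then show "y \<in> - ideal_kernel I X" using r(1) by (auto simp: ideal_kernel_def intro!: exI[of _ "r / 2"])
    qed
    then show "\<exists>r>0. ball x r \<subseteq> - ideal_kernel I X" using r(1) by (intro exI[of _ "r / 2"]) auto
  qed
  then show ?thesis by (simp add: closed_def)
qed

lemma ideal_Diff_kernel:
  fixes X :: "'a::{metric_space, second_countable_topology} set"
  assumes I: "sigma_ideal I"
  shows "I (X - ideal_kernel I X)"
proof -
  define \<B> where "\<B> = {ball x r |x r. I (X \<inter> ball x r)}"
  obtain \<B>' where \<B>': "\<B>' \<subseteq> \<B>" "countable \<B>'" "\<Union>\<B>' = \<Union>\<B>"
    using Lindelof[of \<B>] by (auto simp: \<B>_def)
  have "I (\<Union>((\<inter>) X ` \<B>'))"
    using \<B>' by (intro sigma_ideal_Union[OF I]) (auto simp: \<B>_def)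
  moreover have "X - ideal_kernel I X \<subseteq> \<Union>((\<inter>) X ` \<B>')"
  proof
    fix x assume "x \<in> X - ideal_kernel I X"
    then obtain r where "x \<in> X" "r > 0" "I (X \<inter> ball x r)" by (auto simp: ideal_kernel_def)
    then have "x \<in> \<Union>\<B>" unfolding \<B>_def by (intro UnionI[of "ball x r"]) auto
    then show "x \<in> \<Union>((\<inter>) X ` \<B>')" using \<B>'(3) \<open>x \<in> X\<close> by blast
  qed
  ultimately show ?thesis by (rule sigma_ideal_subset[OF I])
qed

lemma not_ideal_kernel:
  fixes X :: "'a::{metric_space, second_countable_topology} set"
  assumes I: "sigma_ideal I" and "\<not> I X"
  shows "\<not> I (ideal_kernel I X)"
proof
  assume "I (ideal_kernel I X)"
  then have "I (\<Union>{X - ideal_kernel I X, ideal_kernel I X})"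
    using ideal_Diff_kernel[OF I] by (intro sigma_ideal_Union[OF I]) auto
  then have "I X" by (rule sigma_ideal_subset[OF I]) blast
  with \<open>\<not> I X\<close> show False ..
qed

lemma ideal_kernel_point:
  fixes X :: "'a::{metric_space, second_countable_topology} set"
  assumes I: "sigma_ideal I" and "\<not> I X"
  obtains x where "x \<in> X" "x \<in> ideal_kernel I X"
proof -
  have "X - ideal_kernel I X \<noteq> X" using ideal_Diff_kernel[OF I, of X] \<open>\<not> I X\<close> by auto
  with that show thesis by blast
qed

lemma ideal_kernel_subset_closure:
  assumes I: "sigma_ideal I"
  shows "ideal_kernel I X \<subseteq> closure X"
proof
  fix x assume x: "x \<in> ideal_kernel I X"
  have "X \<inter> ball x r \<noteq> {}" if "0 < r" for r
    using x that sigma_ideal_empty[OF I] by (auto simp: ideal_kernel_def)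
  then show "x \<in> closure X"
    by (fastforce simp: closure_approachable dist_commute)
qed

section \<open>Sets that are null on curves near a direction\<close>

definition near_curves :: "'a::real_normed_vector \<Rightarrow> real \<Rightarrow> (real \<Rightarrow> 'a) set" where
  "near_curves e \<sigma> = {\<gamma>. \<sigma>-lipschitz_on UNIV (\<lambda>t. \<gamma> t - t *\<^sub>R e)}"

definition dir_null :: "'a::euclidean_space \<Rightarrow> real \<Rightarrow> 'a set \<Rightarrow> bool" where
  "dir_null e \<sigma> P \<longleftrightarrow> (\<forall>\<gamma>\<in>near_curves e \<sigma>. negligible {t. \<gamma> t \<in> P})"

definition dir_small :: "'a::euclidean_space \<Rightarrow> real \<Rightarrow> 'a set \<Rightarrow> bool" where
  "dir_small e \<sigma> X \<longleftrightarrow> (\<exists>F. X \<subseteq> F \<and> fsigma_in euclidean F \<and> dir_null e \<sigma> F)"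

lemma near_curvesD:
  assumes "\<gamma> \<in> near_curves e \<sigma>"
  shows "norm (\<gamma> s - \<gamma> t - (s - t) *\<^sub>R e) \<le> \<sigma> * \<bar>s - t\<bar>"
proof -
  have "dist (\<gamma> s - s *\<^sub>R e) (\<gamma> t - t *\<^sub>R e) \<le> \<sigma> * dist s t"
    using assms by (auto simp: near_curves_def intro: lipschitz_onD)
  then show ?thesis by (simp add: dist_norm algebra_simps)
qed

lemma near_curve_lipschitz:
  assumes "\<gamma> \<in> near_curves e \<sigma>" "norm e = 1"
  shows "(1 + \<sigma>)-lipschitz_on UNIV \<gamma>"
proof (rule lipschitz_onI)
  show "0 \<le> 1 + \<sigma>" using assms(1) lipschitz_on_nonneg by (fastforce simp: near_curves_def)
  fix s t
  have "norm (\<gamma> s - \<gamma> t) \<le> norm (\<gamma> s - \<gamma> t - (s - t) *\<^sub>R e) + norm ((s - t) *\<^sub>R e)"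
    using norm_triangle_ineq[of "\<gamma> s - \<gamma> t - (s - t) *\<^sub>R e" "(s - t) *\<^sub>R e"] by simp
  also have "\<dots> \<le> \<sigma> * \<bar>s - t\<bar> + \<bar>s - t\<bar>"
    using near_curvesD[OF assms(1)] assms(2) by (intro add_mono) auto
  finally show "dist (\<gamma> s) (\<gamma> t) \<le> (1 + \<sigma>) * dist s t"
    by (simp add: dist_norm dist_real_def algebra_simps)
qed

lemma norm_vector_derivative_le_lipschitz:
  fixes f :: "real \<Rightarrow> 'a::real_normed_vector"
  assumes lip: "L-lipschitz_on UNIV f" and deriv: "(f has_vector_derivative v) (at t)"
  shows "norm v \<le> L"
proof (rule field_le_epsilon)
  fix \<epsilon> :: real assume "0 < \<epsilon>"
  then obtain d where d: "0 < d" "\<And>u. norm (u - t) < d \<Longrightarrow> norm (f u - f t - (u - t) *\<^sub>R v) \<le> \<epsilon> * norm (u - t)"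
    using deriv unfolding has_vector_derivative_def has_derivative_within_alt by blast
  define h where "h = d / 2"
  have h: "0 < h" "h < d" using d(1) by (auto simp: h_def)
  have "norm (h *\<^sub>R v) \<le> norm (f (t + h) - f t) + norm (f (t + h) - f t - h *\<^sub>R v)"
    using norm_triangle_ineq4[of "f (t + h) - f t" "f (t + h) - f t - h *\<^sub>R v"] by simp
  also have "\<dots> \<le> L * h + \<epsilon> * h"
    using lipschitz_onD[OF lip, of "t + h" t] d(2)[of "t + h"] h by (simp add: dist_norm)
  finally have "h * norm v \<le> h * (L + \<epsilon>)" using h by (simp add: algebra_simps)
  then show "norm v \<le> L + \<epsilon>" using h by simp
qed

lemma near_curve_derivative:
  assumes "\<gamma> \<in> near_curves e \<sigma>" "(\<gamma> has_vector_derivative v) (at t)"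
  shows "norm (v - e) \<le> \<sigma>"
proof (rule norm_vector_derivative_le_lipschitz)
  show "\<sigma>-lipschitz_on UNIV (\<lambda>t. \<gamma> t - t *\<^sub>R e)" using assms(1) by (simp add: near_curves_def)
  show "((\<lambda>t. \<gamma> t - t *\<^sub>R e) has_vector_derivative v - e) (at t)"
    using assms(2) by (auto intro!: derivative_eq_intros)
qed

lemma dir_null_subset: "dir_null e \<sigma> Q \<Longrightarrow> P \<subseteq> Q \<Longrightarrow> dir_null e \<sigma> P"
  unfolding dir_null_def by (meson negligible_subset Collect_mono subsetD)

lemma dir_null_Union:
  assumes "countable \<P>" "\<And>P. P \<in> \<P> \<Longrightarrow> dir_null e \<sigma> P"
  shows "dir_null e \<sigma> (\<Union>\<P>)"
  unfolding dir_null_def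
proof
  fix \<gamma> assume "\<gamma> \<in> near_curves e \<sigma>"
  then have "negligible (\<Union>P\<in>\<P>. {t. \<gamma> t \<in> P})"
    using assms by (intro negligible_countable_Union) (auto simp: dir_null_def)
  moreover have "{t. \<gamma> t \<in> \<Union>\<P>} = (\<Union>P\<in>\<P>. {t. \<gamma> t \<in> P})" by blast
  ultimately show "negligible {t. \<gamma> t \<in> \<Union>\<P>}" by simp
qed

lemma sigma_ideal_dir_small: "sigma_ideal (dir_small e \<sigma>)"
  unfolding sigma_ideal_def
proof (intro conjI allI impI)
  show "dir_small e \<sigma> X" if "dir_small e \<sigma> Y" "X \<subseteq> Y" for X Y
    using that unfolding dir_small_def by blast
  fix \<X> :: "'a set set" assume \<X>: "countable \<X>" "\<forall>X\<in>\<X>. dir_small e \<sigma> X"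
  obtain F where F: "\<And>X. X \<in> \<X> \<Longrightarrow> X \<subseteq> F X \<and> fsigma_in euclidean (F X) \<and> dir_null e \<sigma> (F X)"
    using \<X>(2) unfolding dir_small_def by metis
  have "\<Union>\<X> \<subseteq> \<Union>(F ` \<X>)" using F by fastforce
  moreover have "fsigma_in euclidean (\<Union>(F ` \<X>))"
    using F \<X>(1) by (intro fsigma_in_Union) auto
  moreover have "dir_null e \<sigma> (\<Union>(F ` \<X>))"
    using F \<X>(1) by (intro dir_null_Union) auto
  ultimately show "dir_small e \<sigma> (\<Union>\<X>)" unfolding dir_small_def by blast
qed

lemma not_dir_null_kernel:
  assumes "\<not> dir_small e \<sigma> X"
  shows "\<not> dir_null e \<sigma> (ideal_kernel (dir_small e \<sigma>) X)"
proof -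
  have "fsigma_in euclidean (ideal_kernel (dir_small e \<sigma>) X)"
    using closed_ideal_kernel[OF sigma_ideal_dir_small, of e \<sigma> X] by (simp add: closed_imp_fsigma_in)
  with not_ideal_kernel[OF sigma_ideal_dir_small assms] show ?thesis
    unfolding dir_small_def by blast
qed

lemma dir_small_common_cover:
  assumes "finite N" "\<And>e. e \<in> N \<Longrightarrow> dir_small e \<sigma> X"
  obtains F where "X \<subseteq> F" "fsigma_in euclidean F" "\<And>e. e \<in> N \<Longrightarrow> dir_null e \<sigma> F"
proof -
  have "\<exists>F. X \<subseteq> F \<and> fsigma_in euclidean F \<and> (\<forall>e\<in>N. dir_null e \<sigma> F)"
    using assms
  proof (induction N)
    case empty
    have "fsigma_in euclidean (UNIV :: 'a set)"
      using fsigma_in_topspace[of "euclidean :: 'a topology"] by simp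
    then show ?case by blast
  next
    case (insert e N)
    then obtain F where F: "X \<subseteq> F" "fsigma_in euclidean F" "\<forall>e\<in>N. dir_null e \<sigma> F" by auto
    obtain G where G: "X \<subseteq> G" "fsigma_in euclidean G" "dir_null e \<sigma> G"
      using insert.prems[of e] by (auto simp: dir_small_def)
    have "fsigma_in euclidean (F \<inter> G)" using F G by (intro fsigma_in_Int)
    then show ?case using F G by (intro exI[of _ "F \<inter> G"]) (auto intro: dir_null_subset)
  qed
  then show thesis using that by blast
qed

section \<open>Decomposing a curve into pieces near directions\<close>

definition secants_near :: "(real \<Rightarrow> 'a::real_normed_vector) \<Rightarrow> real set \<Rightarrow> 'a \<Rightarrow> real \<Rightarrow> nat \<Rightarrow> real set" where
  "secants_near \<gamma> S w \<epsilon> m = {t \<in> S. \<forall>u\<in>S. \<bar>u - t\<bar> < 1 / Suc m \<longrightarrow>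
      norm (\<gamma> u - \<gamma> t - (u - t) *\<^sub>R w) \<le> \<epsilon> * \<bar>u - t\<bar>}"

lemma secants_near_if_derivative:
  assumes "t \<in> S" and deriv: "(\<gamma> has_vector_derivative v) (at t within S)" and "norm (v - w) < \<epsilon>"
  obtains m where "t \<in> secants_near \<gamma> S w \<epsilon> m"
proof -
  have "0 < \<epsilon> - norm (v - w)" using assms(3) by simp
  then obtain d where d: "0 < d" "\<And>u. u \<in> S \<Longrightarrow> norm (u - t) < d \<Longrightarrow>
      norm (\<gamma> u - \<gamma> t - (u - t) *\<^sub>R v) \<le> (\<epsilon> - norm (v - w)) * norm (u - t)"
    using deriv unfolding has_vector_derivative_def has_derivative_within_alt by blast
  obtain m where m: "1 / real (Suc m) < d" using nat_approx_posE[OF d(1)] by blast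
  have "norm (\<gamma> u - \<gamma> t - (u - t) *\<^sub>R w) \<le> \<epsilon> * \<bar>u - t\<bar>" if "u \<in> S" "\<bar>u - t\<bar> < 1 / Suc m" for u
  proof -
    have "norm (\<gamma> u - \<gamma> t - (u - t) *\<^sub>R w) \<le> norm (\<gamma> u - \<gamma> t - (u - t) *\<^sub>R v) + norm ((u - t) *\<^sub>R (v - w))"
      using norm_triangle_ineq[of "\<gamma> u - \<gamma> t - (u - t) *\<^sub>R v" "(u - t) *\<^sub>R (v - w)"] by (simp add: algebra_simps)
    also have "\<dots> \<le> (\<epsilon> - norm (v - w)) * \<bar>u - t\<bar> + \<bar>u - t\<bar> * norm (v - w)"
      using d(2)[OF that(1)] that(2) m by simp
    finally show ?thesis by (simp add: algebra_simps)
  qed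
  then have "t \<in> secants_near \<gamma> S w \<epsilon> m" using \<open>t \<in> S\<close> by (simp add: secants_near_def)
  then show thesis by (rule that)
qed

lemma negligible_affine_preimage:
  fixes c d :: real
  assumes "negligible S" "c \<noteq> 0"
  shows "negligible {t. c * t + d \<in> S}"
proof -
  have "negligible ((\<lambda>x. (x - d) / c) ` S)"
    using assms
    by (intro negligible_differentiable_image_negligible) (auto simp: differentiable_on_def)
  moreover have "{t. c * t + d \<in> S} \<subseteq> (\<lambda>x. (x - d) / c) ` S"
  proof
    fix t assume "t \<in> {t. c * t + d \<in> S}"
    then show "t \<in> (\<lambda>x. (x - d) / c) ` S"
      using assms(2) by (intro image_eqI[of _ _ "c * t + d"]) auto
  qed
  ultimately show ?thesis by (rule negligible_subset)
qed

lemma negligible_near_line_preimage: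
  fixes \<gamma> :: "real \<Rightarrow> 'a::euclidean_space" and \<tau> :: real
  assumes null: "dir_null e (DIM('a) * \<tau>) P" and "0 < c"
    and lip: "(c * \<tau>)-lipschitz_on T (\<lambda>t. \<gamma> t - t *\<^sub>R (c *\<^sub>R e))"
  shows "negligible {t \<in> T. \<gamma> t \<in> P}"
proof -
  obtain \<zeta> where \<zeta>: "(DIM('a) * (c * \<tau>))-lipschitz_on UNIV \<zeta>"
    "\<And>t. t \<in> T \<Longrightarrow> \<zeta> t = \<gamma> t - t *\<^sub>R (c *\<^sub>R e)"
    using lipschitz_extend_euclidean[OF lip] by blast
  define \<eta> where "\<eta> s = \<zeta> (s / c) + s *\<^sub>R e" for s
  have "\<eta> \<in> near_curves e (DIM('a) * \<tau>)"
    unfolding near_curves_def mem_Collect_eq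
  proof (rule lipschitz_onI)
    show "0 \<le> DIM('a) * \<tau>"
      using lipschitz_on_nonneg[OF lip] \<open>0 < c\<close> by (simp add: zero_le_mult_iff)
    fix s t
    have "dist (\<zeta> (s / c)) (\<zeta> (t / c)) \<le> DIM('a) * (c * \<tau>) * dist (s / c) (t / c)"
      by (rule lipschitz_onD[OF \<zeta>(1)]) auto
    also have "dist (s / c) (t / c) = dist s t / c"
      using \<open>0 < c\<close> by (simp add: dist_real_def flip: diff_divide_distrib)
    finally show "dist (\<eta> s - s *\<^sub>R e) (\<eta> t - t *\<^sub>R e) \<le> DIM('a) * \<tau> * dist s t"
      using \<open>0 < c\<close> by (simp add: \<eta>_def)
  qed
  then have "negligible {s. \<eta> s \<in> P}" using null by (simp add: dir_null_def)
  then have "negligible {t. c * t + 0 \<in> {s. \<eta> s \<in> P}}"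
    using \<open>0 < c\<close> by (intro negligible_affine_preimage) auto
  moreover have "{t \<in> T. \<gamma> t \<in> P} \<subseteq> {t. c * t + 0 \<in> {s. \<eta> s \<in> P}}"
    using \<zeta>(2) \<open>0 < c\<close> by (auto simp: \<eta>_def mult.commute)
  ultimately show ?thesis by (rule negligible_subset)
qed

lemma negligible_secants_near_preimage:
  fixes \<gamma> :: "real \<Rightarrow> 'a::euclidean_space" and \<tau> :: real
  assumes null: "dir_null e (DIM('a) * \<tau>) P" and "0 < c" "0 \<le> \<tau>"
  shows "negligible {t \<in> secants_near \<gamma> S (c *\<^sub>R e) (c * \<tau>) m. \<gamma> t \<in> P}"
proof -
  define T where "T j = {t \<in> secants_near \<gamma> S (c *\<^sub>R e) (c * \<tau>) m. \<lfloor>t * Suc m\<rfloor> = j}" for j :: int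
  have "negligible {t \<in> T j. \<gamma> t \<in> P}" for j
  proof (rule negligible_near_line_preimage[OF null \<open>0 < c\<close>], rule lipschitz_onI)
    show "0 \<le> c * \<tau>" using \<open>0 < c\<close> \<open>0 \<le> \<tau>\<close> by simp
    fix u t assume ut: "u \<in> T j" "t \<in> T j"
    have "\<bar>u * Suc m - t * Suc m\<bar> < 1" using ut unfolding T_def by (simp; linarith)
    then have "\<bar>u - t\<bar> * Suc m < 1" by (simp flip: left_diff_distrib add: abs_mult)
    then have "\<bar>u - t\<bar> < 1 / Suc m" by (simp add: field_simps)
    then have "norm (\<gamma> u - \<gamma> t - (u - t) *\<^sub>R (c *\<^sub>R e)) \<le> c * \<tau> * \<bar>u - t\<bar>"
      using ut unfolding T_def secants_near_def by blast
    then show "dist (\<gamma> u - u *\<^sub>R (c *\<^sub>R e)) (\<gamma> t - t *\<^sub>R (c *\<^sub>R e)) \<le> c * \<tau> * dist u t"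
      by (simp add: dist_norm algebra_simps)
  qed
  then have "negligible (\<Union>j. {t \<in> T j. \<gamma> t \<in> P})" by (intro negligible_countable_Union) auto
  moreover have "{t \<in> secants_near \<gamma> S (c *\<^sub>R e) (c * \<tau>) m. \<gamma> t \<in> P} = (\<Union>j. {t \<in> T j. \<gamma> t \<in> P})"
    by (auto simp: T_def)
  ultimately show ?thesis by simp
qed

lemma rational_multiple_near:
  fixes v e :: "'a::real_normed_vector"
  assumes "v \<noteq> 0" "norm e = 1" "norm (sgn v - e) < \<tau> / 2"
  obtains c where "c \<in> \<rat>" "0 < c" "norm (v - c *\<^sub>R e) < c * \<tau>"
proof -
  define n where "n = norm v"
  have n: "0 < n" "n *\<^sub>R sgn v = v" using \<open>v \<noteq> 0\<close> by (simp_all add: n_def norm_scaleR sgn_div_norm)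
  have "0 < \<tau>" using assms(3) norm_ge_zero[of "sgn v - e"] by linarith
  then have "n < n + n * \<tau> / 4" using n(1) by simp
  then obtain c where c: "c \<in> \<rat>" "n < c" "c < n + n * \<tau> / 4" using Rats_dense_in_real by blast
  have "v - c *\<^sub>R e = n *\<^sub>R (sgn v - e) + (n - c) *\<^sub>R e"
    using n(2) by (simp add: algebra_simps)
  then have "norm (v - c *\<^sub>R e) \<le> n * norm (sgn v - e) + (c - n)"
    using norm_triangle_ineq[of "n *\<^sub>R (sgn v - e)" "(n - c) *\<^sub>R e"] n(1) c(2) assms(2) by simp
  also have "n * norm (sgn v - e) \<le> n * (\<tau> / 2)" using assms(3) n(1) by (intro mult_left_mono) auto
  finally have "norm (v - c *\<^sub>R e) < n * \<tau>" using c(3) mult_pos_pos[OF n(1) \<open>0 < \<tau>\<close>] by linarith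
  also have "\<dots> \<le> c * \<tau>" using c(2) \<open>0 < \<tau>\<close> by simp
  finally show thesis using that c(1,2) n(1) by fastforce
qed

lemma negligible_curve_preimage:
  fixes \<gamma> :: "real \<Rightarrow> 'a::euclidean_space" and \<tau> :: real
  assumes "countable N" "0 < \<tau>"
    and null: "\<And>e. e \<in> N \<Longrightarrow> norm e = 1 \<and> dir_null e (DIM('a) * \<tau>) P"
    and tangents: "negligible {t \<in> S. \<nexists>v. (\<gamma> has_vector_derivative v) (at t within S) \<and> v \<noteq> 0 \<and>
                   (\<exists>e\<in>N. norm (sgn v - e) < \<tau> / 2)}" (is "negligible ?B")
  shows "negligible {t \<in> S. \<gamma> t \<in> P}"
proof -
  define I where "I = N \<times> {c \<in> \<rat>. 0 < (c::real)} \<times> (UNIV :: nat set)"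
  define W where "W = (\<lambda>(e, c, m). {t \<in> secants_near \<gamma> S (c *\<^sub>R e) (c * \<tau>) m. \<gamma> t \<in> P})"
  have "countable {c \<in> \<rat>. 0 < (c::real)}"
    by (rule countable_subset[OF _ countable_rat]) auto
  then have "countable I" unfolding I_def using \<open>countable N\<close> by (intro countable_SIGMA) auto
  then have "negligible (\<Union>(W ` I))"
    using null \<open>0 < \<tau>\<close>
    by (intro negligible_countable_Union) (auto simp: I_def W_def intro: negligible_secants_near_preimage)
  with tangents have "negligible (?B \<union> \<Union>(W ` I))" by (rule negligible_Un)
  moreover have "{t \<in> S. \<gamma> t \<in> P} \<subseteq> ?B \<union> \<Union>(W ` I)"
  proof
    fix t assume t: "t \<in> {t \<in> S. \<gamma> t \<in> P}"
    show "t \<in> ?B \<union> \<Union>(W ` I)"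
    proof (cases "t \<in> ?B")
      case False
      with t obtain v e where v: "(\<gamma> has_vector_derivative v) (at t within S)" "v \<noteq> 0" "e \<in> N"
        "norm (sgn v - e) < \<tau> / 2"
        by blast
      obtain c where c: "c \<in> \<rat>" "0 < c" "norm (v - c *\<^sub>R e) < c * \<tau>"
        using rational_multiple_near[OF v(2) _ v(4)] null[OF v(3)] by blast
      obtain m where "t \<in> secants_near \<gamma> S (c *\<^sub>R e) (c * \<tau>) m"
        using secants_near_if_derivative[OF _ v(1) c(3)] t by blast
      then have "t \<in> W (e, c, m)" "(e, c, m) \<in> I"
        using t v(3) c(1,2) by (auto simp: W_def I_def)
      then show ?thesis by blast
    qed simp
  qed
  ultimately show ?thesis by (rule negligible_subset)
qed

lemma bounded_finite_net:
  fixes S :: "'a::heine_borel set"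
  assumes "bounded S" "0 < r"
  obtains N where "finite N" "N \<subseteq> S" "S \<subseteq> (\<Union>x\<in>N. ball x r)"
proof -
  have "closure S \<subseteq> (\<Union>x\<in>S. ball x r)"
    using \<open>0 < r\<close> by (auto simp: closure_approachable)
  moreover have "compact (closure S)" using \<open>bounded S\<close> by (simp add: compact_closure)
  ultimately obtain N where "N \<subseteq> S" "finite N" "closure S \<subseteq> (\<Union>x\<in>N. ball x r)"
    using compactE_image[of "closure S" S "\<lambda>x. ball x r"] by auto
  then show thesis using that closure_subset[of S] by (meson subset_trans)
qed

lemma fsigma_cover_null_on_curves:
  fixes X :: "'a::euclidean_space set"
  assumes D: "D \<subseteq> sphere 0 1" and "0 < \<sigma>" and small: "\<And>e. e \<in> D \<Longrightarrow> dir_small e \<sigma> X"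
  obtains F where "X \<subseteq> F" "fsigma_in euclidean F"
    "\<And>\<gamma> S. negligible {t \<in> S. \<nexists>v. (\<gamma> has_vector_derivative v) (at t within S) \<and> v \<noteq> 0 \<and> sgn v \<in> D}
       \<Longrightarrow> negligible {t \<in> S. \<gamma> t \<in> F}"
proof -
  define \<tau> where "\<tau> = \<sigma> / DIM('a)"
  have \<tau>: "0 < \<tau>" "DIM('a) * \<tau> = \<sigma>" using \<open>0 < \<sigma>\<close> by (auto simp: \<tau>_def)
  have "bounded D" using D bounded_subset bounded_sphere by blast
  then obtain N where N: "finite N" "N \<subseteq> D" "D \<subseteq> (\<Union>e\<in>N. ball e (\<tau> / 2))"
    using bounded_finite_net[of D "\<tau> / 2"] \<tau>(1) by auto
  obtain F where F: "X \<subseteq> F" "fsigma_in euclidean F" "\<And>e. e \<in> N \<Longrightarrow> dir_null e \<sigma> F"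
    using dir_small_common_cover[OF N(1)] small N(2) by (metis subsetD)
  show thesis
  proof (rule that[OF F(1,2)])
    fix \<gamma> :: "real \<Rightarrow> 'a" and S
    assume tangents: "negligible {t \<in> S. \<nexists>v. (\<gamma> has_vector_derivative v) (at t within S) \<and> v \<noteq> 0 \<and> sgn v \<in> D}"
    show "negligible {t \<in> S. \<gamma> t \<in> F}"
    proof (rule negligible_curve_preimage[OF countable_finite[OF N(1)] \<tau>(1)])
      show "norm e = 1 \<and> dir_null e (DIM('a) * \<tau>) F" if "e \<in> N" for e
        using N(2) D F(3)[OF that] that \<tau>(2) by auto
      have "\<exists>e\<in>N. norm (w - e) < \<tau> / 2" if "w \<in> D" for w
      proof -
        obtain e where "e \<in> N" "dist e w < \<tau> / 2" using N(3) \<open>w \<in> D\<close> by (auto simp: subset_iff)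
        then show ?thesis by (auto simp: dist_norm norm_minus_commute[of w])
      qed
      then show "negligible {t \<in> S. \<nexists>v. (\<gamma> has_vector_derivative v) (at t within S) \<and> v \<noteq> 0 \<and>
                   (\<exists>e\<in>N. norm (sgn v - e) < \<tau> / 2)}"
        by (intro negligible_subset[OF tangents]) blast
    qed
  qed
qed

lemma lipschitz_curve_on_iff:
  assumes "S \<in> sets lebesgue"
  shows "lipschitz_curve_on S \<gamma> \<longleftrightarrow> (\<exists>L. L-lipschitz_on S \<gamma>) \<and>
    (\<exists>c>0. negligible {t \<in> S. \<nexists>v. (\<gamma> has_vector_derivative v) (at t within S) \<and> c \<le> norm v})"
proof -
  have "(AE t in lebesgue_on S. P t) \<longleftrightarrow> negligible {t \<in> S. \<not> P t}" for P
  proof -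
    have "(AE t in lebesgue_on S. P t) \<longleftrightarrow> (AE t in lebesgue. t \<in> S \<longrightarrow> P t)"
      using assms by (subst AE_restrict_space_iff) auto
    also have "\<dots> \<longleftrightarrow> (\<exists>Z. negligible Z \<and> {t \<in> S. \<not> P t} \<subseteq> Z)"
      by (auto simp: eventually_ae_filter_negligible)
    also have "\<dots> \<longleftrightarrow> negligible {t \<in> S. \<not> P t}" by (blast intro: negligible_subset)
    finally show ?thesis .
  qed
  then show ?thesis by (simp add: lipschitz_curve_on_def)
qed

lemma purely_unrectifiable_iff:
  "purely_unrectifiable P \<longleftrightarrow> (\<forall>\<gamma>. lipschitz_curve_on {0..1} \<gamma> \<longrightarrow> negligible {t \<in> {0..1}. \<gamma> t \<in> P})"
  by (simp add: purely_unrectifiable_def negligible_iff_null_sets)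

lemma not_dir_small_if_not_covered:
  fixes A :: "'a::euclidean_space set"
  assumes not_covered: "\<nexists>P. A \<subseteq> P \<and> fsigma_in euclidean P \<and> purely_unrectifiable P" and "0 < \<sigma>"
  obtains e :: 'a where "norm e = 1" "\<not> dir_small e \<sigma> A"
proof -
  have "\<exists>e::'a. norm e = 1 \<and> \<not> dir_small e \<sigma> A"
  proof (rule ccontr)
    assume "\<not> ?thesis"
    then have small: "dir_small e \<sigma> A" if "e \<in> sphere 0 1" for e using that by auto
    obtain F where F: "A \<subseteq> F" "fsigma_in euclidean F"
      "\<And>\<gamma> S. negligible {t \<in> S. \<nexists>v. (\<gamma> has_vector_derivative v) (at t within S) \<and> v \<noteq> 0 \<and> sgn v \<in> sphere 0 1}
       \<Longrightarrow> negligible {t \<in> S. \<gamma> t \<in> F}"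
      by (rule fsigma_cover_null_on_curves[OF order_refl \<open>0 < \<sigma>\<close>], erule small, rule that)
    have "purely_unrectifiable F"
      unfolding purely_unrectifiable_iff
    proof (intro allI impI, rule F(3))
      fix \<gamma> :: "real \<Rightarrow> 'a" assume "lipschitz_curve_on {0..1} \<gamma>"
      then obtain c where "c > 0" and tangents:
          "negligible {t \<in> {0..1}. \<nexists>v. (\<gamma> has_vector_derivative v) (at t within {0..1}) \<and> c \<le> norm v}"
        by (auto simp: lipschitz_curve_on_iff)
      have "v \<noteq> 0 \<and> sgn v \<in> sphere 0 1" if "c \<le> norm v" for v :: 'a
        using that \<open>c > 0\<close> by (auto simp: norm_sgn)
      then show "negligible {t \<in> {0..1}. \<nexists>v. (\<gamma> has_vector_derivative v) (at t within {0..1}) \<and> v \<noteq> 0 \<and> sgn v \<in> sphere 0 1}"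
        by (intro negligible_subset[OF tangents]) blast
    qed
    with F(1,2) not_covered show False by blast
  qed
  with that show thesis by blast
qed

lemma norm_sgn_diff_le:
  fixes v e :: "'a::real_normed_vector"
  assumes "norm e = 1" "v \<noteq> 0"
  shows "norm (sgn v - e) \<le> 2 * norm (v - e)"
proof -
  have "sgn v - v = (1 - norm v) *\<^sub>R sgn v"
    using \<open>v \<noteq> 0\<close> by (simp add: sgn_div_norm algebra_simps)
  then have "norm (sgn v - v) = \<bar>1 - norm v\<bar>" using \<open>v \<noteq> 0\<close> by (simp add: norm_sgn)
  also have "\<dots> \<le> norm (v - e)" using norm_triangle_ineq3[of e v] assms(1) by (simp add: norm_minus_commute)
  finally show ?thesis using norm_triangle_ineq[of "sgn v - v" "v - e"] by simp
qed

lemma not_dir_small_refine: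
  fixes e :: "'a::euclidean_space"
  assumes big: "\<not> dir_small e \<sigma> X" and e: "norm e = 1" and "\<sigma> < 1" "0 < \<sigma>'"
  obtains e' :: 'a where "norm e' = 1" "norm (e' - e) \<le> 2 * \<sigma>" "\<not> dir_small e' \<sigma>' X"
proof -
  define D where "D = {e' \<in> sphere 0 1. norm (e' - e) \<le> 2 * \<sigma>}"
  have "\<exists>e'\<in>D. \<not> dir_small e' \<sigma>' X"
  proof (rule ccontr)
    assume "\<not> ?thesis"
    then have small: "dir_small e' \<sigma>' X" if "e' \<in> D" for e' using that by blast
    have sphere: "D \<subseteq> sphere 0 1" by (auto simp: D_def)
    obtain F where F: "X \<subseteq> F" "fsigma_in euclidean F"
      "\<And>\<gamma> S. negligible {t \<in> S. \<nexists>v. (\<gamma> has_vector_derivative v) (at t within S) \<and> v \<noteq> 0 \<and> sgn v \<in> D}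
       \<Longrightarrow> negligible {t \<in> S. \<gamma> t \<in> F}"
      by (rule fsigma_cover_null_on_curves[OF sphere \<open>0 < \<sigma>'\<close>], erule small, rule that)
    have "negligible {t \<in> UNIV. \<gamma> t \<in> F}" if \<gamma>: "\<gamma> \<in> near_curves e \<sigma>" for \<gamma>
    proof (rule F(3), rule negligible_subset[OF negligible_not_differentiable_lipschitz[OF near_curve_lipschitz[OF \<gamma> e]]])
      have "v \<noteq> 0 \<and> sgn v \<in> D" if "(\<gamma> has_vector_derivative v) (at t)" for t v
      proof -
        have ve: "norm (v - e) \<le> \<sigma>" using \<gamma> that by (rule near_curve_derivative)
        then have "v \<noteq> 0" using e \<open>\<sigma> < 1\<close> by auto
        with ve show ?thesis using norm_sgn_diff_le[OF e] by (fastforce simp: D_def norm_sgn)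
      qed
      then show "{t \<in> UNIV. \<nexists>v. (\<gamma> has_vector_derivative v) (at t) \<and> v \<noteq> 0 \<and> sgn v \<in> D}
          \<subseteq> {t \<in> UNIV. \<not> \<gamma> differentiable (at t)}"
        using vector_derivative_works by blast
    qed
    then have "dir_null e \<sigma> F" by (simp add: dir_null_def)
    with F(1,2) big show False unfolding dir_small_def by blast
  qed
  with that show thesis by (auto simp: D_def)
qed

section \<open>Points of almost maximal growth\<close>

lemma exists_inner_point_outside:
  fixes T M :: "real set"
  assumes T: "T \<in> sets lebesgue" and M: "M \<in> lmeasurable" and "0 \<le> l"
    and large: "measure lebesgue M + 2 * l < measure lebesgue (T \<inter> {a..b})"
  obtains t where "t \<in> T" "t \<notin> M" "a + l \<le> t" "t \<le> b - l"
proof -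
  have "\<exists>t\<in>T. t \<notin> M \<and> a + l \<le> t \<and> t \<le> b - l"
  proof (rule ccontr)
    assume "\<not> ?thesis"
    then have sub: "T \<inter> {a..b} \<subseteq> M \<union> ({a..a + l} \<union> {b - l..b})" by force
    have "measure lebesgue (T \<inter> {a..b}) \<le> measure lebesgue (M \<union> ({a..a + l} \<union> {b - l..b}))"
      using T M by (intro measure_mono_fmeasurable[OF sub]) (auto intro: fmeasurable.Un)
    also have "\<dots> \<le> measure lebesgue M + measure lebesgue ({a..a + l} \<union> {b - l..b})"
      using M by (intro measure_Un_le) auto
    also have "measure lebesgue ({a..a + l} \<union> {b - l..b}) \<le> measure lebesgue {a..a + l} + measure lebesgue {b - l..b}"
      by (intro measure_Un_le) auto
    also have "\<dots> = 2 * l" using \<open>0 \<le> l\<close> by simp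
    finally show False using large by simp
  qed
  with that show thesis by blast
qed

text \<open>The weak maximal inequality is applied to the loss \<open>L t - u t\<close>.\<close>
lemma exists_point_of_steep_growth:
  fixes u :: "real \<Rightarrow> real"
  assumes "a \<le> b" "0 < \<theta>" "0 \<le> l" and lip: "L-lipschitz_on UNIV u"
    and growth: "(L - \<kappa>) * (b - a) \<le> u b - u a"
    and T: "T \<in> sets lebesgue" "5 * \<kappa> / \<theta> * (b - a) + 2 * l < measure lebesgue (T \<inter> {a..b})"
  obtains t where "t \<in> T" "a + l \<le> t" "t \<le> b - l"
    "\<And>s. t \<le> s \<Longrightarrow> s \<le> b \<Longrightarrow> (L - \<theta>) * (s - t) \<le> u s - u t"
    "\<And>s. a \<le> s \<Longrightarrow> s \<le> t \<Longrightarrow> (L - \<theta>) * (t - s) \<le> u t - u s"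
proof -
  define loss where "loss t = L * t - u t" for t
  have "mono loss"
  proof (rule monoI)
    fix s t :: real assume "s \<le> t"
    then show "loss s \<le> loss t"
      using lipschitz_onD[OF lip, of t s] by (simp add: loss_def dist_real_def abs_le_iff algebra_simps)
  qed
  then have mono: "mono_on {a..b} loss" by (rule mono_on_subset) auto
  define B where "B = {t. \<exists>p q. a \<le> p \<and> q \<le> b \<and> t \<in> {p..q} \<and> steep_on loss \<theta> p q}"
  obtain M where M: "B \<subseteq> M" "M \<in> lmeasurable" "\<theta> * measure lebesgue M \<le> 5 * (loss b - loss a)"
    using weak_maximal_inequality[OF mono \<open>a \<le> b\<close> \<open>0 < \<theta>\<close>, of B] unfolding B_def by blast
  note M(3)
  also have "5 * (loss b - loss a) \<le> 5 * (\<kappa> * (b - a))"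
    using growth by (simp add: loss_def algebra_simps)
  finally have "measure lebesgue M \<le> 5 * \<kappa> / \<theta> * (b - a)" using \<open>0 < \<theta>\<close> by (simp add: field_simps)
  then have "measure lebesgue M + 2 * l < measure lebesgue (T \<inter> {a..b})" using T(2) by linarith
  then obtain t where t: "t \<in> T" "t \<notin> M" "a + l \<le> t" "t \<le> b - l"
    using exists_inner_point_outside[OF T(1) M(2) \<open>0 \<le> l\<close>] by blast
  have steep: "(L - \<theta>) * (d - c) \<le> u d - u c" if "a \<le> c" "c \<le> d" "d \<le> b" "t = c \<or> t = d" for c d
  proof (cases "c = d")
    case False
    then have "\<not> steep_on loss \<theta> c d"
      using that t(2) M(1) unfolding B_def by auto
    then have "\<not> \<theta> * (d - c) \<le> loss d - loss c" using False that(2) by (simp add: steep_on_def)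
    then show ?thesis by (simp add: loss_def algebra_simps)
  qed simp
  show thesis
  proof (rule that[OF t(1,3,4)])
    show "(L - \<theta>) * (s - t) \<le> u s - u t" if "t \<le> s" "s \<le> b" for s
      using steep[of t s] that t(3) \<open>0 \<le> l\<close> by simp
    show "(L - \<theta>) * (t - s) \<le> u t - u s" if "a \<le> s" "s \<le> t" for s
      using steep[of s t] that t(4) \<open>0 \<le> l\<close> by simp
  qed
qed

lemma norm_add_scaled_le:
  fixes e w :: "'a::real_inner"
  assumes "norm e = 1" "0 < T" "norm w \<le> T"
  shows "norm (w + T *\<^sub>R e) \<le> T + e \<bullet> w + (norm w)\<^sup>2 / (2 * T)"
proof (rule power2_le_imp_le)
  define c where "c = e \<bullet> w + (norm w)\<^sup>2 / (2 * T)"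
  have "(norm (w + T *\<^sub>R e))\<^sup>2 = (norm w)\<^sup>2 + 2 * T * (e \<bullet> w) + T\<^sup>2"
    using assms(1) unfolding power2_norm_eq_inner
    by (simp add: inner_add_left inner_add_right inner_commute norm_eq_1 power2_eq_square algebra_simps)
  also have "\<dots> \<le> (T + c)\<^sup>2"
    using assms(2) zero_le_power2[of c] by (simp add: c_def power2_sum distrib_left)
  finally show "(norm (w + T *\<^sub>R e))\<^sup>2 \<le> (T + e \<bullet> w + (norm w)\<^sup>2 / (2 * T))\<^sup>2" by (simp add: c_def add.assoc)
  have "\<bar>e \<bullet> w\<bar> \<le> T" using Cauchy_Schwarz_ineq2[of e w] assms by simp
  moreover have "0 \<le> (norm w)\<^sup>2 / (2 * T)" using assms by simp
  ultimately show "0 \<le> T + e \<bullet> w + (norm w)\<^sup>2 / (2 * T)" by linarith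
qed

text \<open>Compare \<open>x + w\<close> with the points \<open>x \<plusminus> T e\<close>, \<open>T = N |w|\<close>: the detour caused by the component of
  \<open>w\<close> across \<open>e\<close> costs only \<open>|w|\<^sup>2 / (2 T)\<close>.\<close>
lemma almost_gradient_if_steep:
  fixes h :: "'a::real_inner \<Rightarrow> real"
  assumes lip: "1-lipschitz_on UNIV h" and e: "norm e = 1" and N: "1 \<le> N"
    and fwd: "\<And>s. 0 \<le> s \<Longrightarrow> s \<le> R \<Longrightarrow> (1 - 1 / N\<^sup>2) * s \<le> h (x + s *\<^sub>R e) - h x"
    and bwd: "\<And>s. 0 \<le> s \<Longrightarrow> s \<le> R \<Longrightarrow> (1 - 1 / N\<^sup>2) * s \<le> h x - h (x - s *\<^sub>R e)"
    and w: "N * norm w \<le> R"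
  shows "\<bar>h (x + w) - h x - e \<bullet> w\<bar> \<le> 2 / N * norm w"
proof (cases "w = 0")
  case False
  define T where "T = N * norm w"
  have T: "0 < T" "norm w \<le> T" "T \<le> R" using False N w by (auto simp: T_def)
  have loss: "1 / N\<^sup>2 * T + (norm w)\<^sup>2 / (2 * T) \<le> 2 / N * norm w"
    using N False by (simp add: T_def power2_eq_square field_simps)
  have le: "h y \<le> h z + norm (y - z)" for y z
    using lipschitz_onD[OF lip, of y z] by (simp add: dist_norm abs_le_iff)
  have "h (x + w) \<le> h (x - T *\<^sub>R e) + norm (w + T *\<^sub>R e)"
    using le[of "x + w" "x - T *\<^sub>R e"] by (simp add: algebra_simps)
  also have "\<dots> \<le> h x - (1 - 1 / N\<^sup>2) * T + (T + e \<bullet> w + (norm w)\<^sup>2 / (2 * T))"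
    using bwd[of T] T norm_add_scaled_le[OF e T(1,2)] by simp
  finally have up: "h (x + w) - h x - e \<bullet> w \<le> 1 / N\<^sup>2 * T + (norm w)\<^sup>2 / (2 * T)"
    by (simp add: algebra_simps)
  have "h (x + T *\<^sub>R e) \<le> h (x + w) + norm (- w + T *\<^sub>R e)"
    using le[of "x + T *\<^sub>R e" "x + w"] by (simp add: algebra_simps)
  also have "\<dots> \<le> h (x + w) + (T + e \<bullet> (- w) + (norm (- w))\<^sup>2 / (2 * T))"
    using norm_add_scaled_le[OF e T(1), of "- w"] T by simp
  finally have "h x + (1 - 1 / N\<^sup>2) * T \<le> h (x + w) + (T - e \<bullet> w + (norm w)\<^sup>2 / (2 * T))"
    using fwd[of T] T by simp
  then have "- (h (x + w) - h x - e \<bullet> w) \<le> 1 / N\<^sup>2 * T + (norm w)\<^sup>2 / (2 * T)"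
    by (simp add: algebra_simps)
  with up loss show ?thesis by linarith
qed simp

lemma sets_near_curve_preimage:
  fixes \<gamma> :: "real \<Rightarrow> 'a::euclidean_space"
  assumes "\<gamma> \<in> near_curves e \<sigma>" "norm e = 1" "closed K"
  shows "{t. \<gamma> t \<in> K} \<in> sets lebesgue"
proof -
  have "continuous_on UNIV \<gamma>"
    using near_curve_lipschitz[OF assms(1,2)] by (rule lipschitz_on_continuous_on)
  then have "closed (\<gamma> -` K)"
    using assms(3) by (simp add: closed_vimage continuous_on_eq_continuous_at)
  then show ?thesis by (simp add: vimage_def borel_closed sets_completionI_sets)
qed

lemma exists_almost_gradient_on_curve:
  fixes h :: "'a::euclidean_space \<Rightarrow> real"
  assumes lip: "1-lipschitz_on UNIV h" and e: "norm e = 1" and N: "1 \<le> N" and \<sigma>: "\<sigma> = 1 / (50 * N\<^sup>2)"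
    and \<gamma>: "\<gamma> \<in> near_curves e \<sigma>" and "a < b" and "closed K"
    and dense: "9 / 10 * (b - a) < measure lebesgue ({t. \<gamma> t \<in> K} \<inter> {a..b})"
    and growth: "(1 - 2 * \<sigma>) * (b - a) \<le> h (\<gamma> b) - h (\<gamma> a)"
  obtains x where "x \<in> K" "\<And>w. N * norm w \<le> (b - a) / 4 \<Longrightarrow> \<bar>h (x + w) - h x - e \<bullet> w\<bar> \<le> 2 / N * norm w"
proof -
  define l where "l = (b - a) / 4"
  have rate: "5 * (3 * \<sigma>) / (1 / N\<^sup>2) = 3 / 10" using N by (simp add: \<sigma>)
  have "5 * (3 * \<sigma>) / (1 / N\<^sup>2) * (b - a) + 2 * l < 9 / 10 * (b - a)"
    unfolding rate l_def using \<open>a < b\<close> by argo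
  then have large: "5 * (3 * \<sigma>) / (1 / N\<^sup>2) * (b - a) + 2 * l < measure lebesgue ({t. \<gamma> t \<in> K} \<inter> {a..b})"
    using dense by (rule less_trans)
  have "(1 * (1 + \<sigma>))-lipschitz_on UNIV (\<lambda>t. h (\<gamma> t))"
    using near_curve_lipschitz[OF \<gamma> e] lipschitz_on_subset[OF lip] by (rule lipschitz_on_compose2) simp
  then have lip': "(1 + \<sigma>)-lipschitz_on UNIV (\<lambda>t. h (\<gamma> t))" by simp
  have growth': "(1 + \<sigma> - 3 * \<sigma>) * (b - a) \<le> h (\<gamma> b) - h (\<gamma> a)" using growth by (simp add: algebra_simps)
  have "0 < 1 / N\<^sup>2" "0 \<le> l" using N \<open>a < b\<close> by (simp_all add: l_def)
  then obtain t where "t \<in> {t. \<gamma> t \<in> K}" and t: "a + l \<le> t" "t \<le> b - l"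
    "\<And>s. t \<le> s \<Longrightarrow> s \<le> b \<Longrightarrow> (1 + \<sigma> - 1 / N\<^sup>2) * (s - t) \<le> h (\<gamma> s) - h (\<gamma> t)"
    "\<And>s. a \<le> s \<Longrightarrow> s \<le> t \<Longrightarrow> (1 + \<sigma> - 1 / N\<^sup>2) * (t - s) \<le> h (\<gamma> t) - h (\<gamma> s)"
    by (rule exists_point_of_steep_growth[OF less_imp_le[OF \<open>a < b\<close>] _ _ lip' growth'
          sets_near_curve_preimage[OF \<gamma> e \<open>closed K\<close>] large]) (rule that)
  then have "\<gamma> t \<in> K" by simp
  have le: "\<bar>h y - h z\<bar> \<le> norm (y - z)" for y z
    using lipschitz_onD[OF lip, of y z] by (simp add: dist_norm dist_real_def)
  show thesis
  proof (rule that[OF \<open>\<gamma> t \<in> K\<close>], rule almost_gradient_if_steep[OF lip e N])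
    fix s assume "0 \<le> s" "s \<le> (b - a) / 4"
    then have s: "0 \<le> s" "s \<le> l" by (simp_all add: l_def)
    have "norm (\<gamma> (t + s) - (\<gamma> t + s *\<^sub>R e)) \<le> \<sigma> * s"
      using near_curvesD[OF \<gamma>, of "t + s" t] s by (simp add: algebra_simps)
    moreover have "(1 + \<sigma> - 1 / N\<^sup>2) * s \<le> h (\<gamma> (t + s)) - h (\<gamma> t)"
      using t(3)[of "t + s"] t(2) s by simp
    ultimately show "(1 - 1 / N\<^sup>2) * s \<le> h (\<gamma> t + s *\<^sub>R e) - h (\<gamma> t)"
      using le[of "\<gamma> (t + s)" "\<gamma> t + s *\<^sub>R e"] by (simp add: algebra_simps abs_le_iff)
    have "norm (\<gamma> (t - s) - (\<gamma> t - s *\<^sub>R e)) \<le> \<sigma> * s"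
      using near_curvesD[OF \<gamma>, of "t - s" t] s by (simp add: algebra_simps)
    moreover have "(1 + \<sigma> - 1 / N\<^sup>2) * s \<le> h (\<gamma> t) - h (\<gamma> (t - s))"
      using t(4)[of "t - s"] t(1) s by simp
    ultimately show "(1 - 1 / N\<^sup>2) * s \<le> h (\<gamma> t) - h (\<gamma> t - s *\<^sub>R e)"
      using le[of "\<gamma> (t - s)" "\<gamma> t - s *\<^sub>R e"] by (simp add: algebra_simps abs_le_iff)
  qed
qed

lemma affine_growth_along_near_curve:
  fixes e :: "'a::real_inner"
  assumes \<gamma>: "\<gamma> \<in> near_curves e \<sigma>" and e: "norm e = 1" and "a \<le> b"
  shows "(1 - \<sigma>) * (b - a) \<le> e \<bullet> (\<gamma> b - \<gamma> a)"
proof -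
  let ?w = "\<gamma> b - \<gamma> a - (b - a) *\<^sub>R e"
  have "\<bar>e \<bullet> ?w\<bar> \<le> \<sigma> * (b - a)"
    using Cauchy_Schwarz_ineq2[of e ?w] near_curvesD[OF \<gamma>, of b a] e \<open>a \<le> b\<close> by simp
  moreover have "e \<bullet> (\<gamma> b - \<gamma> a) = (b - a) + e \<bullet> ?w"
    using e by (simp add: inner_diff_right norm_eq_1)
  ultimately show ?thesis by (simp add: algebra_simps)
qed

lemma exists_dense_near_curve:
  fixes x :: "'a::euclidean_space"
  assumes big: "\<not> dir_small e \<sigma> X" and X: "X \<subseteq> cball x (\<rho> / 2)" and "0 < \<rho>" and e: "norm e = 1" and "\<sigma> < 1"
  obtains \<gamma> a b where "\<gamma> \<in> near_curves e \<sigma>" "a < b" "b - a < \<rho>" "\<gamma> ` {a..b} \<subseteq> cball x \<rho>"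
    "9 / 10 * (b - a) < measure lebesgue ({t. \<gamma> t \<in> ideal_kernel (dir_small e \<sigma>) X} \<inter> {a..b})"
proof -
  define K where "K = ideal_kernel (dir_small e \<sigma>) X"
  have "closed K" unfolding K_def by (rule closed_ideal_kernel[OF sigma_ideal_dir_small])
  have "closure X \<subseteq> cball x (\<rho> / 2)" using X by (simp add: closure_minimal)
  then have K: "K \<subseteq> cball x (\<rho> / 2)"
    unfolding K_def using ideal_kernel_subset_closure[OF sigma_ideal_dir_small] by blast
  obtain \<gamma> where \<gamma>: "\<gamma> \<in> near_curves e \<sigma>" "\<not> negligible {t. \<gamma> t \<in> K}"
    using not_dir_null_kernel[OF big] by (auto simp: dir_null_def K_def)
  obtain a b where ab: "a < b" "b - a < \<rho> / 4" "9 / 10 * (b - a) < measure lebesgue ({t. \<gamma> t \<in> K} \<inter> {a..b})"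
    using exists_dense_interval[OF sets_near_curve_preimage[OF \<gamma>(1) e \<open>closed K\<close>] \<gamma>(2), of "9 / 10" "\<rho> / 4"] \<open>0 < \<rho>\<close>
    by auto
  have "{t. \<gamma> t \<in> K} \<inter> {a..b} \<noteq> {}"
  proof
    assume "{t. \<gamma> t \<in> K} \<inter> {a..b} = {}"
    with ab(1,3) show False by simp
  qed
  then obtain t0 where t0: "\<gamma> t0 \<in> K" "t0 \<in> {a..b}" by blast
  have "\<gamma> t \<in> cball x \<rho>" if "t \<in> {a..b}" for t
  proof -
    have "\<bar>t0 - t\<bar> \<le> \<rho> / 4" using t0(2) that ab(2) unfolding atLeastAtMost_iff by linarith
    then have "(1 + \<sigma>) * dist t0 t \<le> 2 * (\<rho> / 4)" using \<open>\<sigma> < 1\<close> by (intro mult_mono) (auto simp: dist_real_def)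
    then have "dist (\<gamma> t0) (\<gamma> t) \<le> \<rho> / 2"
      using lipschitz_onD[OF near_curve_lipschitz[OF \<gamma>(1) e], of t0 t] by simp
    moreover have "dist x (\<gamma> t0) \<le> \<rho> / 2" using K t0(1) by auto
    ultimately show ?thesis using dist_triangle[of x "\<gamma> t" "\<gamma> t0"] by simp
  qed
  then have "\<gamma> ` {a..b} \<subseteq> cball x \<rho>" by blast
  moreover have "b - a < \<rho>" using ab(2) \<open>0 < \<rho>\<close> by simp
  ultimately show thesis using that \<gamma>(1) ab(1,3) unfolding K_def by blast
qed

text \<open>The move of the player who wants differentiability.\<close>
lemma robust_almost_gradient:
  fixes f :: "'a::euclidean_space \<Rightarrow> real"
  assumes N: "1 \<le> N" and \<sigma>: "\<sigma> = 1 / (50 * N\<^sup>2)" and e: "norm e = 1" and "0 < \<rho>"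
    and affine: "\<And>y. y \<in> cball x \<rho> \<Longrightarrow> f y = f x + e \<bullet> (y - x)"
    and X: "X \<subseteq> cball x (\<rho> / 2)" "\<not> dir_small e \<sigma> X"
  obtains r \<delta> where "0 < r" "r \<le> \<rho>" "0 < \<delta>"
    "\<And>h. 1-lipschitz_on UNIV h \<Longrightarrow> (\<And>y. y \<in> cball x \<rho> \<Longrightarrow> \<bar>h y - f y\<bar> \<le> \<delta>) \<Longrightarrow>
      \<exists>x'\<in>ideal_kernel (dir_small e \<sigma>) X. \<forall>w. norm w \<le> r \<longrightarrow> \<bar>h (x' + w) - h x' - e \<bullet> w\<bar> \<le> 2 / N * norm w"
proof -
  have "1 \<le> N\<^sup>2" using N by (simp add: one_le_power)
  then have "0 < N\<^sup>2" "1 < 50 * N\<^sup>2" by linarith+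
  then have \<sigma>_bounds: "0 < \<sigma>" "\<sigma> < 1" by (simp_all add: \<sigma>)
  obtain \<gamma> a b where \<gamma>: "\<gamma> \<in> near_curves e \<sigma>" "a < b" "b - a < \<rho>" "\<gamma> ` {a..b} \<subseteq> cball x \<rho>"
    "9 / 10 * (b - a) < measure lebesgue ({t. \<gamma> t \<in> ideal_kernel (dir_small e \<sigma>) X} \<inter> {a..b})"
    using exists_dense_near_curve[OF X(2,1) \<open>0 < \<rho>\<close> e \<sigma>_bounds(2)] by blast
  define r where "r = (b - a) / 4 / N"
  show thesis
  proof (rule that)
    show "0 < r" using \<gamma>(2) N by (simp add: r_def)
    have "r \<le> (b - a) / 4 / 1" unfolding r_def using N \<gamma>(2) by (intro divide_left_mono) auto
    then show "r \<le> \<rho>" using \<gamma>(2,3) by simp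
    show "0 < \<sigma> * (b - a) / 2" using \<sigma>_bounds \<gamma>(2) by simp
    fix h :: "'a \<Rightarrow> real"
    assume h: "1-lipschitz_on UNIV h" and close: "\<And>y. y \<in> cball x \<rho> \<Longrightarrow> \<bar>h y - f y\<bar> \<le> \<sigma> * (b - a) / 2"
    have ends: "\<gamma> a \<in> cball x \<rho>" "\<gamma> b \<in> cball x \<rho>" using \<gamma>(2,4) by (simp_all add: image_subset_iff)
    have "(1 - \<sigma>) * (b - a) \<le> f (\<gamma> b) - f (\<gamma> a)"
      using affine_growth_along_near_curve[OF \<gamma>(1) e less_imp_le[OF \<gamma>(2)]] affine[OF ends(1)] affine[OF ends(2)]
      by (simp add: inner_diff_right)
    then have "(1 - 2 * \<sigma>) * (b - a) \<le> h (\<gamma> b) - h (\<gamma> a)"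
      using close[OF ends(1)] close[OF ends(2)] unfolding abs_le_iff by argo
    then obtain x' where x': "x' \<in> ideal_kernel (dir_small e \<sigma>) X"
      "\<And>w. N * norm w \<le> (b - a) / 4 \<Longrightarrow> \<bar>h (x' + w) - h x' - e \<bullet> w\<bar> \<le> 2 / N * norm w"
      using exists_almost_gradient_on_curve[OF h e N \<sigma> \<gamma>(1,2) closed_ideal_kernel[OF sigma_ideal_dir_small] \<gamma>(5)]
      by blast
    have "N * norm w \<le> (b - a) / 4" if "norm w \<le> r" for w :: 'a
      using that N by (simp add: r_def field_simps)
    with x' show "\<exists>x'\<in>ideal_kernel (dir_small e \<sigma>) X.
        \<forall>w. norm w \<le> r \<longrightarrow> \<bar>h (x' + w) - h x' - e \<bullet> w\<bar> \<le> 2 / N * norm w" by blast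
  qed
qed

section \<open>The Banach--Mazur game\<close>

abbreviation unit_cube :: "'a::euclidean_space set" where
  "unit_cube \<equiv> cbox 0 One"

definition close_on :: "'a set \<Rightarrow> real \<Rightarrow> ('a \<Rightarrow> real) \<Rightarrow> ('a \<Rightarrow> real) \<Rightarrow> bool" where
  "close_on S d f g \<longleftrightarrow> (\<forall>y\<in>S. \<bar>f y - g y\<bar> \<le> d)"

text \<open>Nowhere density in \<open>Lip\<^sub>1\<close>, for functions not required to be extensional.\<close>
definition avoidable :: "('a::euclidean_space \<Rightarrow> real) set \<Rightarrow> bool" where
  "avoidable M \<longleftrightarrow> (\<forall>f \<epsilon>. 1-lipschitz_on unit_cube f \<longrightarrow> 0 < \<epsilon> \<longrightarrow>
     (\<exists>h \<eta>. 1-lipschitz_on unit_cube h \<and> 0 < \<eta> \<and> close_on unit_cube \<epsilon> h f \<and>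
        (\<forall>k. 1-lipschitz_on unit_cube k \<longrightarrow> close_on unit_cube \<eta> k h \<longrightarrow> restrict k unit_cube \<notin> M)))"

lemma avoidableI:
  assumes "\<And>f \<epsilon>. 1-lipschitz_on unit_cube f \<Longrightarrow> 0 < \<epsilon> \<Longrightarrow>
    \<exists>h \<eta>. 1-lipschitz_on unit_cube h \<and> 0 < \<eta> \<and> close_on unit_cube \<epsilon> h f \<and>
      (\<forall>k. 1-lipschitz_on unit_cube k \<longrightarrow> close_on unit_cube \<eta> k h \<longrightarrow> restrict k unit_cube \<notin> M)"
  shows "avoidable M"
  using assms unfolding avoidable_def by blast

lemma avoidable_subset: "avoidable M \<Longrightarrow> N \<subseteq> M \<Longrightarrow> avoidable N"
  unfolding avoidable_def by (meson subsetD)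

lemma avoidable_empty: "avoidable {}"
  unfolding avoidable_def close_on_def by (auto intro!: exI[of _ 1])

definition cyl :: "(nat \<Rightarrow> nat) \<Rightarrow> nat \<Rightarrow> (nat \<Rightarrow> nat) set" where
  "cyl z n = {y. \<forall>i<n. y i = z i}"

text \<open>Position after a move: all later functions stay within \<open>budget\<close> of \<open>fn\<close>, which is affine with
  gradient \<open>dir\<close> on the ball of radius \<open>rad\<close> around \<open>pt\<close>; the point of the analytic set sought has
  a code extending the first \<open>n\<close> entries of \<open>code\<close>; \<open>fn\<close> is almost affine around \<open>pt\<close> up to \<open>scale\<close>.\<close>
record 'a stage =
  fn :: "'a \<Rightarrow> real"
  budget :: real
  code :: "nat \<Rightarrow> nat"
  pt :: 'a
  rad :: real
  dir :: 'a
  scale :: real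

definition target :: "((nat \<Rightarrow> nat) \<Rightarrow> 'a::metric_space) \<Rightarrow> nat \<Rightarrow> 'a stage \<Rightarrow> 'a set" where
  "target g n s = g ` cyl (code s) n \<inter> cball (pt s) (rad s / 2)"

definition tol :: "nat \<Rightarrow> real" where "tol n = 1 / (50 * (2 ^ n)\<^sup>2)"

definition err :: "nat \<Rightarrow> real" where "err n = 3 / 2 ^ n"

definition stage_inv :: "((nat \<Rightarrow> nat) \<Rightarrow> 'a::euclidean_space) \<Rightarrow> nat \<Rightarrow> 'a stage \<Rightarrow> bool" where
  "stage_inv g n s \<longleftrightarrow> 1-lipschitz_on UNIV (fn s) \<and> 0 < budget s \<and> 0 < rad s \<and>
     cball (pt s) (rad s) \<subseteq> box 0 One \<and> norm (dir s) = 1 \<and>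
     (\<forall>y\<in>cball (pt s) (rad s). fn s y = fn s (pt s) + dir s \<bullet> (y - pt s)) \<and>
     \<not> dir_small (dir s) (tol n) (target g n s)"

definition stage_refines :: "nat \<Rightarrow> 'a::euclidean_space stage \<Rightarrow> 'a stage \<Rightarrow> bool" where
  "stage_refines n s s' \<longleftrightarrow>
     (\<forall>i<n. code s' i = code s i) \<and>
     cball (pt s') (rad s') \<subseteq> cball (pt s) (3 / 4 * rad s) \<and>
     norm (dir s' - dir s) \<le> 2 * tol n \<and>
     0 < scale s' \<and> scale s' \<le> rad s \<and> rad s' \<le> scale s' / 2 \<and>
     (\<forall>y\<in>cball (pt s') (scale s').
        \<bar>fn s' y - fn s' (pt s') - dir s' \<bullet> (y - pt s')\<bar> \<le> err n * norm (y - pt s'))"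

definition stage_commits ::
    "('a::euclidean_space \<Rightarrow> real) set \<Rightarrow> nat \<Rightarrow> 'a stage \<Rightarrow> 'a stage \<Rightarrow> bool" where
  "stage_commits M n s s' \<longleftrightarrow>
     (\<forall>k. 1-lipschitz_on unit_cube k \<longrightarrow> close_on unit_cube (budget s') k (fn s') \<longrightarrow>
        restrict k unit_cube \<notin> M \<and> close_on unit_cube (budget s) k (fn s) \<and>
        close_on unit_cube (err n * scale s') k (fn s))"

lemma close_on_mono: "close_on S d f g \<Longrightarrow> d \<le> d' \<Longrightarrow> close_on S d' f g"
  by (force simp: close_on_def)

lemma close_on_trans: "close_on S d f g \<Longrightarrow> close_on S d' g h \<Longrightarrow> close_on S (d + d') f h"
  by (force simp: close_on_def)

lemma close_on_limit:
  assumes "\<And>y. y \<in> S \<Longrightarrow> (\<lambda>n. F n y) \<longlonglongrightarrow> f y" "\<forall>\<^sub>F n in sequentially. close_on S d (F n) g"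
  shows "close_on S d f g"
  unfolding close_on_def
proof
  fix y assume "y \<in> S"
  show "\<bar>f y - g y\<bar> \<le> d"
  proof (rule tendsto_upperbound)
    show "(\<lambda>n. \<bar>F n y - g y\<bar>) \<longlonglongrightarrow> \<bar>f y - g y\<bar>" using assms(1)[OF \<open>y \<in> S\<close>] by (intro tendsto_intros)
    show "\<forall>\<^sub>F n in sequentially. \<bar>F n y - g y\<bar> \<le> d"
      using assms(2) by eventually_elim (use \<open>y \<in> S\<close> in \<open>simp add: close_on_def\<close>)
  qed simp
qed

lemma lipschitz_on_limit:
  fixes f :: "'a::metric_space \<Rightarrow> 'b::metric_space"
  assumes "\<And>n. L-lipschitz_on S (F n)" "\<And>y. y \<in> S \<Longrightarrow> (\<lambda>n. F n y) \<longlonglongrightarrow> f y"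
  shows "L-lipschitz_on S f"
proof (rule lipschitz_onI)
  show "0 \<le> L" using assms(1) by (rule lipschitz_on_nonneg)
  fix x y assume "x \<in> S" "y \<in> S"
  then have "(\<lambda>n. dist (F n x) (F n y)) \<longlonglongrightarrow> dist (f x) (f y)" "\<And>n. dist (F n x) (F n y) \<le> L * dist x y"
    using assms(2) lipschitz_onD[OF assms(1)] by (auto intro!: tendsto_dist)
  then show "dist (f x) (f y) \<le> L * dist x y" by (intro Lim_bounded) auto
qed

lemma lipschitz_on_inner:
  fixes e :: "'a::real_inner"
  assumes "norm e \<le> L"
  shows "L-lipschitz_on UNIV (\<lambda>y. e \<bullet> y)"
proof (rule lipschitz_onI)
  show "0 \<le> L" using assms norm_ge_zero[of e] by linarith
  fix y z
  have "\<bar>e \<bullet> (y - z)\<bar> \<le> norm e * norm (y - z)" by (rule Cauchy_Schwarz_ineq2)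
  also have "\<dots> \<le> L * norm (y - z)" using assms by (intro mult_right_mono) auto
  finally show "dist (e \<bullet> y) (e \<bullet> z) \<le> L * dist y z"
    by (simp add: dist_norm inner_diff_right)
qed

lemma tol_pos: "0 < tol n" and tol_less_1: "tol n < 1" and tol_le: "2 * tol n \<le> 1 / 2 ^ n"
proof -
  have p: "1 \<le> (2::real) ^ n" by simp
  then have sq: "(2::real) ^ n \<le> (2 ^ n)\<^sup>2" by (simp add: power2_eq_square)
  show "0 < tol n" by (simp add: tol_def)
  have "1 < 50 * ((2::real) ^ n)\<^sup>2" using sq p by linarith
  then show "tol n < 1" by (simp add: tol_def)
  have "2 * 2 ^ n \<le> 50 * ((2::real) ^ n)\<^sup>2" using sq p by linarith
  then show "2 * tol n \<le> 1 / 2 ^ n" by (simp add: tol_def field_simps)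
qed

lemma err_pos: "0 < err n"
  by (simp add: err_def)

lemma err_tendsto_0: "err \<longlonglongrightarrow> 0"
  unfolding err_def[abs_def] using tendsto_mult[OF tendsto_const LIMSEQ_inverse_realpow_zero[of 2], of 3]
  by (simp add: divide_inverse power_inverse)

lemma truncate_to_affine:
  fixes h :: "'a::euclidean_space \<Rightarrow> real" and x :: 'a
  assumes lip: "1-lipschitz_on UNIV h" and e: "norm e = 1" and "0 < \<rho>"
  defines "l \<equiv> \<lambda>y. h x + e \<bullet> (y - x)"
  obtains f where "1-lipschitz_on UNIV f" "\<And>y. \<bar>f y - h y\<bar> \<le> \<rho>" "\<And>y. \<bar>f y - l y\<bar> \<le> \<bar>h y - l y\<bar>"
    "\<And>y. y \<in> cball x (\<rho> / 2) \<Longrightarrow> f y = l y"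
proof -
  \<comment> \<open>the median of the three values lies between \<open>h\<close> and \<open>l\<close>\<close>
  define f where "f y = max (h y - \<rho>) (min (l y) (h y + \<rho>))" for y
  have h_le: "\<bar>h y - h z\<bar> \<le> norm (y - z)" for y z
    using lipschitz_onD[OF lip, of y z] by (simp add: dist_norm dist_real_def)
  have l_le: "\<bar>l y - l z\<bar> \<le> norm (y - z)" for y z
    using lipschitz_onD[OF lipschitz_on_inner[of e 1], of y z] e
    by (simp add: l_def dist_norm dist_real_def inner_diff_right)
  show thesis
  proof (rule that[of f])
    show "1-lipschitz_on UNIV f"
    proof (rule lipschitz_onI)
      show "dist (f y) (f z) \<le> 1 * dist y z" for y z
        using h_le[of y z] l_le[of y z] unfolding f_def dist_norm dist_real_def by (simp; linarith)
    qed simp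
    show "\<bar>f y - h y\<bar> \<le> \<rho>" for y unfolding f_def using \<open>0 < \<rho>\<close> by linarith
    show "\<bar>f y - l y\<bar> \<le> \<bar>h y - l y\<bar>" for y unfolding f_def using \<open>0 < \<rho>\<close> by linarith
    show "f y = l y" if "y \<in> cball x (\<rho> / 2)" for y
    proof -
      have "norm (y - x) \<le> \<rho> / 2" using that by (simp add: dist_norm norm_minus_commute)
      moreover have "l x = h x" by (simp add: l_def)
      ultimately show ?thesis unfolding f_def using h_le[of y x] l_le[of y x] by linarith
    qed
  qed
qed

lemma avoidable_response:
  assumes "avoidable M" and f: "1-lipschitz_on UNIV f" and "0 < \<epsilon>"
  obtains h \<eta> where "1-lipschitz_on UNIV h" "0 < \<eta>" "close_on unit_cube \<epsilon> h f"
    "\<And>k. 1-lipschitz_on unit_cube k \<Longrightarrow> close_on unit_cube \<eta> k h \<Longrightarrow> restrict k unit_cube \<notin> M"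
proof -
  have "1-lipschitz_on unit_cube f" using f by (rule lipschitz_on_subset) simp
  then obtain h0 \<eta> where h0: "1-lipschitz_on unit_cube h0" "0 < \<eta>" "close_on unit_cube \<epsilon> h0 f"
    "\<And>k. 1-lipschitz_on unit_cube k \<Longrightarrow> close_on unit_cube \<eta> k h0 \<Longrightarrow> restrict k unit_cube \<notin> M"
    using assms(1,3) unfolding avoidable_def by meson
  obtain h where "1-lipschitz_on UNIV h" "\<And>y. y \<in> unit_cube \<Longrightarrow> h y = h0 y"
    using lipschitz_extend_real[OF h0(1)] by blast
  with h0(2-4) show thesis by (intro that[of h \<eta>]) (simp_all add: close_on_def)
qed

lemma almost_gradient_tilt:
  fixes e e' :: "'a::real_inner"
  assumes "\<bar>h y - h x - e \<bullet> (y - x)\<bar> \<le> a * norm (y - x)" "norm (e' - e) \<le> b"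
  shows "\<bar>h y - h x - e' \<bullet> (y - x)\<bar> \<le> (a + b) * norm (y - x)"
proof -
  have "\<bar>(e' - e) \<bullet> (y - x)\<bar> \<le> norm (e' - e) * norm (y - x)" by (rule Cauchy_Schwarz_ineq2)
  also have "\<dots> \<le> b * norm (y - x)" using assms(2) by (intro mult_right_mono) auto
  finally show ?thesis
    using assms(1) inner_diff_left[of e' e "y - x"] unfolding distrib_right by linarith
qed

lemma not_ideal_extend_code:
  assumes I: "sigma_ideal I" and big: "\<not> I (g ` cyl z n \<inter> U)"
  obtains j where "\<not> I (g ` cyl (z(n := j)) (Suc n) \<inter> U)"
proof -
  have "\<exists>j. \<not> I (g ` cyl (z(n := j)) (Suc n) \<inter> U)"
  proof (rule ccontr)
    assume "\<not> ?thesis"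
    then have "I (\<Union>(range (\<lambda>j. g ` cyl (z(n := j)) (Suc n) \<inter> U)))"
      by (intro sigma_ideal_Union[OF I]) auto
    moreover have "g ` cyl z n \<inter> U \<subseteq> \<Union>(range (\<lambda>j. g ` cyl (z(n := j)) (Suc n) \<inter> U))"
    proof
      fix p assume "p \<in> g ` cyl z n \<inter> U"
      then obtain y where "y \<in> cyl z n" "p = g y" "p \<in> U" by blast
      moreover from this have "y \<in> cyl (z(n := y n)) (Suc n)" by (auto simp: cyl_def less_Suc_eq)
      ultimately show "p \<in> \<Union>(range (\<lambda>j. g ` cyl (z(n := j)) (Suc n) \<inter> U))" by blast
    qed
    ultimately have "I (g ` cyl z n \<inter> U)" by (rule sigma_ideal_subset[OF I])
    with big show False ..
  qed
  with that show thesis by blast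
qed

lemma refine_direction_and_code:
  fixes g :: "(nat \<Rightarrow> nat) \<Rightarrow> 'a::euclidean_space"
  assumes x: "x \<in> ideal_kernel (dir_small e (tol n)) (g ` cyl z n \<inter> U)" and e: "norm e = 1" and "0 < \<rho>"
  obtains e' j where "norm e' = 1" "norm (e' - e) \<le> 2 * tol n"
    "\<not> dir_small e' (tol (Suc n)) (g ` cyl (z(n := j)) (Suc n) \<inter> cball x \<rho>)"
proof -
  have "\<not> dir_small e (tol n) (g ` cyl z n \<inter> U \<inter> ball x \<rho>)"
    using x \<open>0 < \<rho>\<close> by (simp add: ideal_kernel_def)
  then obtain e' where e': "norm e' = 1" "norm (e' - e) \<le> 2 * tol n"
    "\<not> dir_small e' (tol (Suc n)) (g ` cyl z n \<inter> U \<inter> ball x \<rho>)"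
    using not_dir_small_refine[OF _ e tol_less_1 tol_pos] by metis
  have "g ` cyl z n \<inter> U \<inter> ball x \<rho> \<subseteq> g ` cyl z n \<inter> cball x \<rho>" by auto
  then have "\<not> dir_small e' (tol (Suc n)) (g ` cyl z n \<inter> cball x \<rho>)"
    using e'(3) sigma_ideal_subset[OF sigma_ideal_dir_small] by blast
  then obtain j where "\<not> dir_small e' (tol (Suc n)) (g ` cyl (z(n := j)) (Suc n) \<inter> cball x \<rho>)"
    by (rule not_ideal_extend_code[OF sigma_ideal_dir_small])
  with e'(1,2) that show thesis by blast
qed

lemma truncate_to_tilted_affine:
  fixes h :: "'a::euclidean_space \<Rightarrow> real"
  assumes h: "1-lipschitz_on UNIV h" and "0 < \<eta>" and e': "norm e' = 1" "norm (e' - e) \<le> b"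
    and gradient: "\<And>w. norm w \<le> r \<Longrightarrow> \<bar>h (x + w) - h x - e \<bullet> w\<bar> \<le> a * norm w"
  obtains f where "1-lipschitz_on UNIV f" "\<And>y. \<bar>f y - h y\<bar> \<le> \<eta>"
    "\<And>y. y \<in> cball x (\<eta> / 2) \<Longrightarrow> f y = f x + e' \<bullet> (y - x)"
    "\<And>y. y \<in> cball x r \<Longrightarrow> \<bar>f y - f x - e' \<bullet> (y - x)\<bar> \<le> (a + b) * norm (y - x)"
proof -
  obtain f where f: "1-lipschitz_on UNIV f" "\<And>y. \<bar>f y - h y\<bar> \<le> \<eta>"
    "\<And>y. \<bar>f y - (h x + e' \<bullet> (y - x))\<bar> \<le> \<bar>h y - (h x + e' \<bullet> (y - x))\<bar>"
    "\<And>y. y \<in> cball x (\<eta> / 2) \<Longrightarrow> f y = h x + e' \<bullet> (y - x)"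
    using truncate_to_affine[OF h e'(1) \<open>0 < \<eta>\<close>, of x] by auto
  have fx: "f x = h x" using f(3)[of x] by simp
  show thesis
  proof (rule that[OF f(1,2)])
    show "f y = f x + e' \<bullet> (y - x)" if "y \<in> cball x (\<eta> / 2)" for y using f(4)[OF that] fx by simp
    fix y assume "y \<in> cball x r"
    then have "\<bar>h y - h x - e \<bullet> (y - x)\<bar> \<le> a * norm (y - x)"
      using gradient[of "y - x"] by (simp add: dist_norm norm_minus_commute)
    then have "\<bar>h y - h x - e' \<bullet> (y - x)\<bar> \<le> (a + b) * norm (y - x)"
      using e'(2) by (rule almost_gradient_tilt)
    then show "\<bar>f y - f x - e' \<bullet> (y - x)\<bar> \<le> (a + b) * norm (y - x)"
      using f(3)[of y] fx by (simp add: diff_diff_eq)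
  qed
qed

lemma ideal_kernel_target_near_pt:
  assumes "x \<in> ideal_kernel (dir_small e \<sigma>) (target g n s)"
  shows "dist (pt s) x \<le> rad s / 2"
proof -
  have "closure (target g n s) \<subseteq> cball (pt s) (rad s / 2)"
    by (intro closure_minimal) (auto simp: target_def)
  then show ?thesis
    using assms ideal_kernel_subset_closure[OF sigma_ideal_dir_small] by (metis mem_cball subsetD)
qed

lemma stage_refine_exists:
  fixes g :: "(nat \<Rightarrow> nat) \<Rightarrow> 'a::euclidean_space"
  assumes inv: "stage_inv g n s" and h: "1-lipschitz_on UNIV h"
    and x: "x \<in> ideal_kernel (dir_small (dir s) (tol n)) (target g n s)"
    and r: "0 < r" "r \<le> rad s" and "0 < \<eta>"
    and gradient: "\<And>w. norm w \<le> r \<Longrightarrow> \<bar>h (x + w) - h x - dir s \<bullet> w\<bar> \<le> 2 / 2 ^ n * norm w"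
  obtains s' where "stage_inv g (Suc n) s'" "stage_refines n s s'" "scale s' = r" "budget s' = \<eta>"
    "\<And>y. \<bar>fn s' y - h y\<bar> \<le> \<eta>"
proof -
  have s: "0 < rad s" "cball (pt s) (rad s) \<subseteq> box 0 One" "norm (dir s) = 1"
    using inv unfolding stage_inv_def by blast+
  define \<rho> where "\<rho> = min (\<eta> / 2) (min (r / 2) (rad s / 4))"
  have \<rho>: "0 < \<rho>" "\<rho> \<le> \<eta> / 2" "\<rho> \<le> r / 2" "\<rho> \<le> rad s / 4"
    using r(1) s(1) \<open>0 < \<eta>\<close> by (auto simp: \<rho>_def)
  obtain e j where e: "norm e = 1" "norm (e - dir s) \<le> 2 * tol n"
    and j: "\<not> dir_small e (tol (Suc n)) (g ` cyl ((code s)(n := j)) (Suc n) \<inter> cball x (\<rho> / 2))"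
    using refine_direction_and_code[OF x[unfolded target_def] s(3), of "\<rho> / 2"] \<rho>(1) by auto
  obtain f where f: "1-lipschitz_on UNIV f" "\<And>y. \<bar>f y - h y\<bar> \<le> \<eta>"
    "\<And>y. y \<in> cball x (\<eta> / 2) \<Longrightarrow> f y = f x + e \<bullet> (y - x)"
    "\<And>y. y \<in> cball x r \<Longrightarrow> \<bar>f y - f x - e \<bullet> (y - x)\<bar> \<le> (2 / 2 ^ n + 1 / 2 ^ n) * norm (y - x)"
    by (rule truncate_to_tilted_affine[OF h \<open>0 < \<eta>\<close> e(1) order_trans[OF e(2) tol_le] gradient])
      (assumption | rule that)+
  define s' where
    "s' = \<lparr>fn = f, budget = \<eta>, code = (code s)(n := j), pt = x, rad = \<rho>, dir = e, scale = r\<rparr>"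
  have sub: "cball x \<rho> \<subseteq> cball (pt s) (3 / 4 * rad s)"
    using ideal_kernel_target_near_pt[OF x] \<rho>(4) by (simp add: cball_subset_cball_iff dist_commute)
  have "stage_inv g (Suc n) s'"
  proof -
    have "cball x \<rho> \<subseteq> cball (pt s) (rad s)"
      using sub s(1) subset_cball[of "3 / 4 * rad s" "rad s" "pt s"] by auto
    then have "cball x \<rho> \<subseteq> box 0 One" using s(2) by blast
    moreover have "f y = f x + e \<bullet> (y - x)" if "y \<in> cball x \<rho>" for y
      using f(3)[of y] that \<rho>(2) by simp
    ultimately show ?thesis
      using f(1) \<rho>(1) \<open>0 < \<eta>\<close> e(1) j unfolding stage_inv_def target_def s'_def stage.select_convs by blast
  qed
  moreover have "stage_refines n s s'"
    using sub e(2) r \<rho>(3) f(4) unfolding stage_refines_def s'_def stage.select_convs by (simp add: err_def)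
  ultimately show thesis using that f(2) by (simp add: s'_def)
qed

lemma stage_commits_if_close:
  assumes h: "close_on unit_cube \<beta> h (fn s)" "\<And>y. \<bar>fn s' y - h y\<bar> \<le> budget s'"
    and avoids: "\<And>k. 1-lipschitz_on unit_cube k \<Longrightarrow> close_on unit_cube \<eta> k h \<Longrightarrow> restrict k unit_cube \<notin> M"
    and small: "2 * budget s' \<le> \<eta>" "2 * budget s' \<le> \<beta>" "2 * \<beta> \<le> budget s" "2 * \<beta> \<le> err n * scale s'"
  shows "stage_commits M n s s'"
  unfolding stage_commits_def
proof (intro allI impI)
  fix k assume k: "1-lipschitz_on unit_cube k" "close_on unit_cube (budget s') k (fn s')"
  have "close_on unit_cube (budget s') (fn s') h" using h(2) by (simp add: close_on_def)
  with k(2) have near: "close_on unit_cube (2 * budget s') k h" unfolding mult_2 by (rule close_on_trans)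
  have "close_on unit_cube (2 * \<beta>) k (fn s)"
    unfolding mult_2 by (rule close_on_trans[OF close_on_mono[OF near small(2)] h(1)])
  then show "restrict k unit_cube \<notin> M \<and> close_on unit_cube (budget s) k (fn s) \<and>
      close_on unit_cube (err n * scale s') k (fn s)"
    using avoids[OF k(1) close_on_mono[OF near small(1)]] small(3,4) by (simp add: close_on_mono)
qed

lemma stage_step_exists:
  fixes g :: "(nat \<Rightarrow> nat) \<Rightarrow> 'a::euclidean_space"
  assumes inv: "stage_inv g n s" and M: "avoidable M"
  obtains s' where "stage_inv g (Suc n) s'" "stage_refines n s s'" "stage_commits M n s s'"
proof -
  have s: "1-lipschitz_on UNIV (fn s)" "0 < budget s" "0 < rad s"
    "cball (pt s) (rad s) \<subseteq> box 0 One" "norm (dir s) = 1"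
    "\<And>y. y \<in> cball (pt s) (rad s) \<Longrightarrow> fn s y = fn s (pt s) + dir s \<bullet> (y - pt s)"
    "\<not> dir_small (dir s) (tol n) (target g n s)"
    using inv unfolding stage_inv_def by blast+
  obtain r \<delta> where r: "0 < r" "r \<le> rad s" and "0 < \<delta>"
    and reply: "\<And>h. 1-lipschitz_on UNIV h \<Longrightarrow> (\<And>y. y \<in> cball (pt s) (rad s) \<Longrightarrow> \<bar>h y - fn s y\<bar> \<le> \<delta>) \<Longrightarrow>
      \<exists>x\<in>ideal_kernel (dir_small (dir s) (tol n)) (target g n s).
        \<forall>w. norm w \<le> r \<longrightarrow> \<bar>h (x + w) - h x - dir s \<bullet> w\<bar> \<le> 2 / 2 ^ n * norm w"
    by (rule robust_almost_gradient[OF _ tol_def s(5,3,6) _ s(7)]) (auto simp: target_def)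
  define \<beta> where "\<beta> = min \<delta> (min (budget s) (err n * r)) / 2"
  have \<beta>: "0 < \<beta>" "\<beta> \<le> \<delta>" "2 * \<beta> \<le> budget s" "2 * \<beta> \<le> err n * r"
    using \<open>0 < \<delta>\<close> s(2) mult_pos_pos[OF err_pos r(1)] by (auto simp: \<beta>_def min_def)
  obtain h \<eta>0 where h: "1-lipschitz_on UNIV h" "0 < \<eta>0" "close_on unit_cube \<beta> h (fn s)"
    "\<And>k. 1-lipschitz_on unit_cube k \<Longrightarrow> close_on unit_cube \<eta>0 k h \<Longrightarrow> restrict k unit_cube \<notin> M"
    by (rule avoidable_response[OF M s(1) \<beta>(1)]) (rule that)
  have "\<bar>h y - fn s y\<bar> \<le> \<delta>" if "y \<in> cball (pt s) (rad s)" for y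
  proof -
    have "y \<in> unit_cube" using that s(4) box_subset_cbox by blast
    then show ?thesis using h(3) \<beta>(2) by (force simp: close_on_def)
  qed
  then obtain x where x: "x \<in> ideal_kernel (dir_small (dir s) (tol n)) (target g n s)"
    "\<And>w. norm w \<le> r \<Longrightarrow> \<bar>h (x + w) - h x - dir s \<bullet> w\<bar> \<le> 2 / 2 ^ n * norm w"
    using reply[OF h(1)] by blast
  define \<eta> where "\<eta> = min \<eta>0 \<beta> / 2"
  have \<eta>: "0 < \<eta>" "2 * \<eta> \<le> \<eta>0" "2 * \<eta> \<le> \<beta>" using h(2) \<beta>(1) by (auto simp: \<eta>_def)
  obtain s' where s': "stage_inv g (Suc n) s'" "stage_refines n s s'" "scale s' = r" "budget s' = \<eta>"
    "\<And>y. \<bar>fn s' y - h y\<bar> \<le> \<eta>"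
    using stage_refine_exists[OF inv h(1) x(1) r \<eta>(1) x(2)] by blast
  have "stage_commits M n s s'"
    using h(3,4) s'(5) \<eta>(2,3) \<beta>(3,4)
    by (intro stage_commits_if_close[where \<beta> = \<beta> and h = h and \<eta> = \<eta>0]) (simp_all add: s'(3,4))
  with that s'(1,2) show thesis by blast
qed

lemma tendsto_baire_cylinder:
  assumes "\<And>n. y n \<in> cyl z n"
  shows "y \<longlonglongrightarrow> z"
proof -
  have "limitin (product_topology (\<lambda>i. euclidean) UNIV) y z sequentially"
    unfolding limitin_componentwise
  proof (intro conjI ballI)
    fix i
    have "\<forall>\<^sub>F n in sequentially. y n i = z i"
      using assms unfolding cyl_def eventually_sequentially by (intro exI[of _ "Suc i"]) auto
    then show "limitin euclidean (\<lambda>n. y n i) (z i) sequentially"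
      by (simp add: tendsto_eventually)
  qed auto
  then show ?thesis by (simp add: euclidean_product_topology)
qed

lemma convergent_geometric_steps:
  fixes e :: "nat \<Rightarrow> 'a::banach"
  assumes "\<And>n. norm (e (Suc n) - e n) \<le> 1 / 2 ^ n"
  shows "convergent e"
proof -
  have "summable (\<lambda>n. e (Suc n) - e n)"
  proof (rule summable_comparison_test)
    show "\<exists>N. \<forall>n\<ge>N. norm (e (Suc n) - e n) \<le> (1 / 2) ^ n"
      using assms by (simp add: power_one_over)
  qed (simp add: summable_geometric)
  then have "convergent (\<lambda>n. \<Sum>i<n. e (Suc i) - e i)" by (simp add: summable_iff_convergent)
  then have "convergent (\<lambda>n. (e n - e 0) + e 0)"
    unfolding sum_lessThan_telescope by (intro convergent_add convergent_const)
  then show ?thesis by simp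
qed

lemma almost_affine_recenter:
  fixes F :: "'a::euclidean_space \<Rightarrow> real"
  assumes affine: "\<And>y. y \<in> cball p \<rho> \<Longrightarrow> F y = F p + e \<bullet> (y - p)"
    and almost: "\<And>y. y \<in> cball p r \<Longrightarrow> \<bar>F y - F p - e \<bullet> (y - p)\<bar> \<le> c * norm (y - p)"
    and x: "x \<in> cball p (3 / 4 * \<rho>)" and "0 \<le> c" "0 < \<rho>" "\<rho> \<le> r / 2" and y: "norm (y - x) \<le> r / 2"
  shows "\<bar>F y - F x - e \<bullet> (y - x)\<bar> \<le> 4 * c * norm (y - x)"
proof -
  have xp: "norm (x - p) \<le> 3 / 4 * \<rho>" using x by (simp add: dist_norm norm_minus_commute)
  have Fx: "F x = F p + e \<bullet> (x - p)" using affine[of x] x \<open>0 < \<rho>\<close> by simp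
  have recenter: "F y - F x - e \<bullet> (y - x) = F y - F p - e \<bullet> (y - p)"
    unfolding Fx by (simp add: inner_diff_right)
  have tri: "norm (y - p) \<le> norm (y - x) + norm (x - p)"
    using norm_triangle_ineq[of "y - x" "x - p"] by simp
  show ?thesis
  proof (cases "y \<in> cball p \<rho>")
    case True
    then show ?thesis using affine[OF True] \<open>0 \<le> c\<close> unfolding recenter by simp
  next
    case False
    then have yp: "\<rho> < norm (y - p)" by (simp add: dist_norm norm_minus_commute)
    have le: "norm (y - p) \<le> 4 * norm (y - x)" using tri xp yp by linarith
    have "norm (y - p) \<le> r" using tri xp y \<open>\<rho> \<le> r / 2\<close> \<open>0 < \<rho>\<close> by linarith
    then have "\<bar>F y - F p - e \<bullet> (y - p)\<bar> \<le> c * norm (y - p)"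
      by (intro almost) (simp add: dist_norm norm_minus_commute)
    also have "\<dots> \<le> c * (4 * norm (y - x))" using le \<open>0 \<le> c\<close> by (rule mult_left_mono)
    finally show ?thesis unfolding recenter by (simp add: mult_ac)
  qed
qed

locale banach_mazur_run =
  fixes g :: "(nat \<Rightarrow> nat) \<Rightarrow> 'a::euclidean_space"
    and M :: "nat \<Rightarrow> ('a \<Rightarrow> real) set"
    and S :: "nat \<Rightarrow> 'a stage"
  assumes continuous_coding: "continuous_on UNIV g"
    and inv: "stage_inv g n (S n)"
    and refines: "stage_refines n (S n) (S (Suc n))"
    and commits: "stage_commits (M n) n (S n) (S (Suc n))"
begin

lemma fn_lipschitz: "1-lipschitz_on UNIV (fn (S n))"
  and budget_pos: "0 < budget (S n)"
  and rad_pos: "0 < rad (S n)"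
  and cball_subset_box: "cball (pt (S n)) (rad (S n)) \<subseteq> box 0 One"
  and fn_affine: "y \<in> cball (pt (S n)) (rad (S n)) \<Longrightarrow>
    fn (S n) y = fn (S n) (pt (S n)) + dir (S n) \<bullet> (y - pt (S n))"
  and target_big: "\<not> dir_small (dir (S n)) (tol n) (target g n (S n))"
  using inv[of n] unfolding stage_inv_def by blast+

lemma code_Suc: "i < n \<Longrightarrow> code (S (Suc n)) i = code (S n) i"
  and cball_Suc_subset: "cball (pt (S (Suc n))) (rad (S (Suc n))) \<subseteq> cball (pt (S n)) (3 / 4 * rad (S n))"
  and dir_Suc_near: "norm (dir (S (Suc n)) - dir (S n)) \<le> 2 * tol n"
  and scale_pos: "0 < scale (S (Suc n))"
  and scale_le_rad: "scale (S (Suc n)) \<le> rad (S n)"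
  and rad_le_scale: "rad (S (Suc n)) \<le> scale (S (Suc n)) / 2"
  and fn_almost_affine: "y \<in> cball (pt (S (Suc n))) (scale (S (Suc n))) \<Longrightarrow>
    \<bar>fn (S (Suc n)) y - fn (S (Suc n)) (pt (S (Suc n))) - dir (S (Suc n)) \<bullet> (y - pt (S (Suc n)))\<bar>
      \<le> err n * norm (y - pt (S (Suc n)))"
  using refines[of n] unfolding stage_refines_def by blast+

lemma rad_tendsto_0: "(\<lambda>n. rad (S n)) \<longlonglongrightarrow> 0"
proof (rule tendsto_sandwich[OF _ _ tendsto_const])
  have "rad (S n) \<le> rad (S 0) / 2 ^ n" for n
  proof (induction n)
    case (Suc n)
    have "rad (S (Suc n)) \<le> rad (S n) / 2"
      using rad_le_scale[of n] scale_le_rad[of n] by linarith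
    with Suc show ?case by simp
  qed simp
  then show "\<forall>\<^sub>F n in sequentially. rad (S n) \<le> rad (S 0) / 2 ^ n" by simp
  show "(\<lambda>n. rad (S 0) / 2 ^ n) \<longlonglongrightarrow> 0"
    using tendsto_mult[OF tendsto_const LIMSEQ_inverse_realpow_zero[of 2], of "rad (S 0)"]
    by (simp add: divide_inverse power_inverse)
qed (simp add: less_imp_le[OF rad_pos])

lemma scale_tendsto_0: "(\<lambda>n. scale (S (Suc n))) \<longlonglongrightarrow> 0"
  by (rule tendsto_sandwich[OF _ _ tendsto_const rad_tendsto_0])
    (simp_all add: less_imp_le[OF scale_pos] scale_le_rad)

lemma cball_antimono:
  assumes "n \<le> m"
  shows "cball (pt (S m)) (rad (S m)) \<subseteq> cball (pt (S n)) (rad (S n))"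
proof (rule lift_Suc_antimono_le[OF _ assms])
  show "cball (pt (S (Suc n))) (rad (S (Suc n))) \<subseteq> cball (pt (S n)) (rad (S n))" for n
    using cball_Suc_subset[of n] rad_pos[of n] subset_cball[of "3 / 4 * rad (S n)" "rad (S n)" "pt (S n)"] by auto
qed

definition limit_code :: "nat \<Rightarrow> nat" where
  "limit_code i = code (S (Suc i)) i"

definition limit_point :: 'a where
  "limit_point = g limit_code"

lemma code_eq_limit_code: "i < n \<Longrightarrow> code (S n) i = limit_code i"
proof -
  assume "i < n"
  then have "Suc i \<le> n" by simp
  then show ?thesis
    by (induction rule: dec_induct) (simp_all add: limit_code_def code_Suc)
qed

lemma pt_tendsto: "(\<lambda>n. pt (S n)) \<longlonglongrightarrow> limit_point"
proof -
  have "\<exists>y\<in>cyl limit_code n. dist (pt (S n)) (g y) \<le> rad (S n)" for n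
  proof -
    have "target g n (S n) \<noteq> {}"
      using target_big[of n] sigma_ideal_empty[OF sigma_ideal_dir_small] by metis
    then obtain y where "y \<in> cyl (code (S n)) n" "dist (pt (S n)) (g y) \<le> rad (S n) / 2"
      unfolding target_def by auto
    moreover have "cyl (code (S n)) n = cyl limit_code n" by (simp add: cyl_def code_eq_limit_code)
    ultimately show ?thesis using rad_pos[of n] by (intro bexI[of _ y]) auto
  qed
  then obtain y where y: "\<And>n. y n \<in> cyl limit_code n" "\<And>n. dist (pt (S n)) (g (y n)) \<le> rad (S n)" by metis
  have "y \<longlonglongrightarrow> limit_code" using y(1) by (rule tendsto_baire_cylinder)
  then have lim: "(\<lambda>n. g (y n)) \<longlonglongrightarrow> limit_point"
    unfolding limit_point_def using continuous_on_tendsto_compose[OF continuous_coding] by simp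
  have "(\<lambda>n. dist (pt (S n)) (g (y n))) \<longlonglongrightarrow> 0"
    by (rule tendsto_sandwich[OF _ _ tendsto_const rad_tendsto_0]) (simp_all add: y(2))
  then have "(\<lambda>n. pt (S n) - g (y n)) \<longlonglongrightarrow> 0"
    unfolding dist_norm by (rule tendsto_norm_zero_cancel)
  with lim show ?thesis by (rule Lim_transform)
qed

lemma limit_point_in_cball: "limit_point \<in> cball (pt (S n)) (3 / 4 * rad (S n))"
proof (rule Lim_in_closed_set[OF closed_cball _ _ pt_tendsto])
  have "pt (S m) \<in> cball (pt (S n)) (3 / 4 * rad (S n))" if "Suc n \<le> m" for m
  proof -
    have "pt (S m) \<in> cball (pt (S m)) (rad (S m))" using rad_pos[of m] by simp
    then show ?thesis using cball_antimono[OF that] cball_Suc_subset[of n] by blast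
  qed
  then show "\<forall>\<^sub>F m in sequentially. pt (S m) \<in> cball (pt (S n)) (3 / 4 * rad (S n))"
    unfolding eventually_sequentially by blast
qed simp

lemma limit_point_in_box: "limit_point \<in> box 0 One"
proof -
  have "limit_point \<in> cball (pt (S 0)) (rad (S 0))"
    using limit_point_in_cball[of 0] rad_pos[of 0] by auto
  then show ?thesis using cball_subset_box by blast
qed

lemma close_on_budget:
  assumes "n \<le> m" and k: "1-lipschitz_on unit_cube k" and "close_on unit_cube (budget (S m)) k (fn (S m))"
  shows "close_on unit_cube (budget (S n)) k (fn (S n))"
  using assms(1,3)
proof (induction rule: dec_induct)
  case (step m)
  then show ?case using commits[of m] k unfolding stage_commits_def by blast
qed

lemma later_fn_lipschitz_cube: "1-lipschitz_on unit_cube (fn (S n))"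
  using fn_lipschitz by (rule lipschitz_on_subset) simp

lemma later_fn_close_budget:
  assumes "n \<le> m"
  shows "close_on unit_cube (budget (S n)) (fn (S m)) (fn (S n))"
  by (rule close_on_budget[OF assms later_fn_lipschitz_cube])
    (simp add: close_on_def less_imp_le[OF budget_pos])

lemma later_fn_close_scale:
  assumes "Suc n \<le> m"
  shows "close_on unit_cube (err n * scale (S (Suc n))) (fn (S m)) (fn (S n))"
  using commits[of n] later_fn_close_budget[OF assms] later_fn_lipschitz_cube
  unfolding stage_commits_def by blast

definition limit_fn :: "'a \<Rightarrow> real" where
  "limit_fn y = lim (\<lambda>n. fn (S n) y)"

lemma fn_tendsto:
  assumes y: "y \<in> unit_cube"
  shows "(\<lambda>n. fn (S n) y) \<longlonglongrightarrow> limit_fn y"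
proof -
  have gap: "(\<lambda>n. err n * scale (S (Suc n))) \<longlonglongrightarrow> 0"
    using tendsto_mult[OF err_tendsto_0 scale_tendsto_0] by simp
  have "convergent (\<lambda>n. fn (S n) y)"
  proof (rule Cauchy_convergent, rule metric_CauchyI)
    fix \<epsilon> :: real assume "0 < \<epsilon>"
    then have "\<forall>\<^sub>F n in sequentially. err n * scale (S (Suc n)) < \<epsilon> / 2"
      using gap by (intro order_tendstoD) auto
    then obtain n where n: "err n * scale (S (Suc n)) < \<epsilon> / 2" unfolding eventually_sequentially by blast
    show "\<exists>N. \<forall>m\<ge>N. \<forall>k\<ge>N. dist (fn (S m) y) (fn (S k) y) < \<epsilon>"
    proof (intro exI allI impI)
      fix m k assume "Suc n \<le> m" "Suc n \<le> k"
      then have "\<bar>fn (S m) y - fn (S n) y\<bar> < \<epsilon> / 2" "\<bar>fn (S k) y - fn (S n) y\<bar> < \<epsilon> / 2"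
        using later_fn_close_scale y n by (force simp: close_on_def)+
      then show "dist (fn (S m) y) (fn (S k) y) < \<epsilon>" unfolding dist_real_def by linarith
    qed
  qed
  then show ?thesis unfolding limit_fn_def by (simp add: convergent_LIMSEQ_iff)
qed

lemma limit_fn_lipschitz: "1-lipschitz_on unit_cube limit_fn"
  using later_fn_lipschitz_cube fn_tendsto by (rule lipschitz_on_limit)

lemma limit_fn_close_scale: "close_on unit_cube (err n * scale (S (Suc n))) limit_fn (fn (S n))"
  by (rule close_on_limit[OF fn_tendsto])
    (auto simp: eventually_sequentially intro: later_fn_close_scale)

lemma limit_fn_avoids: "restrict limit_fn unit_cube \<notin> M n"
proof -
  have "close_on unit_cube (budget (S (Suc n))) limit_fn (fn (S (Suc n)))"
    by (rule close_on_limit[OF fn_tendsto])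
      (auto simp: eventually_sequentially intro: later_fn_close_budget)
  with commits[of n] limit_fn_lipschitz show ?thesis unfolding stage_commits_def by blast
qed

definition limit_dir :: 'a where
  "limit_dir = lim (\<lambda>n. dir (S n))"

lemma dir_tendsto: "(\<lambda>n. dir (S n)) \<longlonglongrightarrow> limit_dir"
proof -
  have "norm (dir (S (Suc n)) - dir (S n)) \<le> 1 / 2 ^ n" for n
    using dir_Suc_near tol_le by (rule order_trans)
  then have "convergent (\<lambda>n. dir (S n))" by (rule convergent_geometric_steps)
  then show ?thesis unfolding limit_dir_def by (simp add: convergent_LIMSEQ_iff)
qed

lemma exists_matching_scale:
  assumes "0 < D" "D \<le> scale (S (Suc n)) / 2"
  obtains j where "n \<le> j" "scale (S (Suc (Suc j))) / 2 < D" "D \<le> scale (S (Suc j)) / 2"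
proof -
  have "\<forall>\<^sub>F j in sequentially. scale (S (Suc (Suc j))) < 2 * D"
    using LIMSEQ_Suc[OF scale_tendsto_0] \<open>0 < D\<close> by (intro order_tendstoD) auto
  then obtain j0 where "\<And>j. j0 \<le> j \<Longrightarrow> scale (S (Suc (Suc j))) < 2 * D"
    unfolding eventually_sequentially by blast
  from this[of "max j0 n"] have "\<exists>j\<ge>n. scale (S (Suc (Suc j))) / 2 < D"
    by (intro exI[of _ "max j0 n"]) auto
  then obtain j where j: "n \<le> j" "scale (S (Suc (Suc j))) / 2 < D"
    and least: "\<And>i. i < j \<Longrightarrow> \<not> (n \<le> i \<and> scale (S (Suc (Suc i))) / 2 < D)"
    using exists_least_iff[of "\<lambda>j. n \<le> j \<and> scale (S (Suc (Suc j))) / 2 < D"] by blast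
  have "D \<le> scale (S (Suc j)) / 2"
  proof (cases "j = n")
    case False
    with j(1) obtain i where "j = Suc i" "n \<le> i" by (cases j) auto
    with least[of i] show ?thesis by auto
  qed (use assms(2) in simp)
  with that j show thesis by blast
qed

lemma limit_fn_estimate:
  assumes y: "y \<in> unit_cube"
    and scale: "scale (S (Suc (Suc n))) / 2 < norm (y - limit_point)" "norm (y - limit_point) \<le> scale (S (Suc n)) / 2"
  shows "\<bar>limit_fn y - limit_fn limit_point - limit_dir \<bullet> (y - limit_point)\<bar>
    \<le> (4 * err n + 4 * err (Suc n) + norm (limit_dir - dir (S (Suc n)))) * norm (y - limit_point)"
proof -
  let ?F = "fn (S (Suc n))" and ?e = "dir (S (Suc n))" and ?x = limit_point and ?D = "norm (y - limit_point)"
  have F: "\<bar>?F y - ?F ?x - ?e \<bullet> (y - ?x)\<bar> \<le> 4 * err n * ?D"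
    by (rule almost_affine_recenter[OF fn_affine fn_almost_affine limit_point_in_cball
          less_imp_le[OF err_pos] rad_pos rad_le_scale scale(2)])
  have "err (Suc n) * scale (S (Suc (Suc n))) \<le> 2 * err (Suc n) * ?D"
    using mult_left_mono[of "scale (S (Suc (Suc n)))" "2 * ?D" "err (Suc n)"] scale(1) err_pos[of "Suc n"]
    by (simp add: mult_ac)
  then have close: "\<bar>limit_fn z - ?F z\<bar> \<le> 2 * err (Suc n) * ?D" if "z \<in> unit_cube" for z
    using limit_fn_close_scale[of "Suc n"] that by (fastforce simp: close_on_def)
  have "?x \<in> unit_cube" using limit_point_in_box box_subset_cbox by blast
  then have "\<bar>limit_fn y - limit_fn ?x - ?e \<bullet> (y - ?x)\<bar> \<le> 4 * err n * ?D + 4 * err (Suc n) * ?D"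
    using F close[OF y] close[of ?x] by linarith
  then have "\<bar>limit_fn y - limit_fn ?x - ?e \<bullet> (y - ?x)\<bar> \<le> (4 * err n + 4 * err (Suc n)) * ?D"
    by (simp only: distrib_right)
  then show ?thesis by (rule almost_gradient_tilt) simp
qed

lemma limit_fn_has_derivative: "(restrict limit_fn unit_cube has_derivative (\<lambda>w. limit_dir \<bullet> w)) (at limit_point)"
  unfolding has_derivative_at_alt
proof (intro conjI allI impI)
  let ?f = "restrict limit_fn unit_cube" and ?x = limit_point
  show "bounded_linear ((\<bullet>) limit_dir)" by (rule bounded_linear_inner_right)
  fix \<epsilon> :: real assume "0 < \<epsilon>"
  let ?loss = "\<lambda>n. 4 * err n + 4 * err (Suc n) + norm (limit_dir - dir (S (Suc n)))"
  have "?loss \<longlonglongrightarrow> 4 * 0 + 4 * 0 + norm (limit_dir - limit_dir)"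
    using err_tendsto_0 dir_tendsto by (intro tendsto_intros LIMSEQ_Suc)
  then have "\<forall>\<^sub>F n in sequentially. ?loss n < \<epsilon>" using \<open>0 < \<epsilon>\<close> by (intro order_tendstoD) auto
  then obtain n where n: "\<And>j. n \<le> j \<Longrightarrow> ?loss j < \<epsilon>" unfolding eventually_sequentially by blast
  obtain d where d: "d > 0" "ball ?x d \<subseteq> box 0 One"
    using limit_point_in_box open_contains_ball[of "box 0 (One::'a)"] by auto
  show "\<exists>d>0. \<forall>y. norm (y - ?x) < d \<longrightarrow> norm (?f y - ?f ?x - limit_dir \<bullet> (y - ?x)) \<le> \<epsilon> * norm (y - ?x)"
  proof (intro exI[of _ "min d (scale (S (Suc n)) / 2)"] conjI allI impI)
    show "0 < min d (scale (S (Suc n)) / 2)" using d(1) scale_pos by simp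
    fix y assume y: "norm (y - ?x) < min d (scale (S (Suc n)) / 2)"
    then have "y \<in> ball ?x d" by (simp add: dist_norm norm_minus_commute)
    then have cube: "y \<in> unit_cube" "?x \<in> unit_cube" using d(2) limit_point_in_box box_subset_cbox by blast+
    show "norm (?f y - ?f ?x - limit_dir \<bullet> (y - ?x)) \<le> \<epsilon> * norm (y - ?x)"
    proof (cases "y = ?x")
      case False
      then obtain j where j: "n \<le> j" "scale (S (Suc (Suc j))) / 2 < norm (y - ?x)" "norm (y - ?x) \<le> scale (S (Suc j)) / 2"
        using exists_matching_scale[of "norm (y - ?x)" n] y by auto
      have "norm (?f y - ?f ?x - limit_dir \<bullet> (y - ?x)) \<le> ?loss j * norm (y - ?x)"
        using limit_fn_estimate[OF cube(1) j(2,3)] cube by simp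
      also have "\<dots> \<le> \<epsilon> * norm (y - ?x)" using n[OF j(1)] by (intro mult_right_mono) auto
      finally show ?thesis .
    qed simp
  qed
qed

end

lemma initial_stage_exists:
  fixes A :: "'a::euclidean_space set"
  assumes A: "A \<subseteq> box 0 One" and g: "range g = A"
    and not_covered: "\<nexists>P. A \<subseteq> P \<and> fsigma_in euclidean P \<and> purely_unrectifiable P"
  obtains s where "stage_inv g 0 s"
proof -
  obtain e :: 'a where e: "norm e = 1" "\<not> dir_small e (tol 0) A"
    using not_dir_small_if_not_covered[OF not_covered tol_pos] by blast
  obtain x where x: "x \<in> A" "x \<in> ideal_kernel (dir_small e (tol 0)) A"
    using ideal_kernel_point[OF sigma_ideal_dir_small e(2)] by blast
  obtain \<rho> where \<rho>: "\<rho> > 0" "cball x \<rho> \<subseteq> box 0 One"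
    using A x(1) open_box open_contains_cball by (metis subsetD)
  define s where "s = \<lparr>fn = \<lambda>y. e \<bullet> y, budget = 1, code = \<lambda>_. 0, pt = x, rad = \<rho>, dir = e, scale = 1\<rparr>"
  have "\<not> dir_small e (tol 0) (A \<inter> ball x (\<rho> / 2))" using x(2) \<rho>(1) by (simp add: ideal_kernel_def)
  moreover have "A \<inter> ball x (\<rho> / 2) \<subseteq> target g 0 s" using g by (auto simp: target_def cyl_def s_def)
  ultimately have "\<not> dir_small e (tol 0) (target g 0 s)"
    using sigma_ideal_subset[OF sigma_ideal_dir_small] by blast
  then have "stage_inv g 0 s"
    using \<rho> e(1) lipschitz_on_inner[of e 1] by (simp add: stage_inv_def s_def inner_diff_right)
  then show thesis by (rule that)
qed

proposition differentiable_function_avoiding: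
  fixes A :: "'a::euclidean_space set"
  assumes A: "A \<subseteq> box 0 One" "analytic_set A"
    and not_covered: "\<nexists>P. A \<subseteq> P \<and> fsigma_in euclidean P \<and> purely_unrectifiable P"
    and M: "\<And>n. avoidable (M n)"
  obtains f x where "1-lipschitz_on unit_cube f" "\<And>n::nat. restrict f unit_cube \<notin> M n"
    "x \<in> A" "restrict f unit_cube differentiable (at x)"
proof -
  have "fsigma_in euclidean ({} :: 'a set)" "purely_unrectifiable ({} :: 'a set)"
    by (simp_all add: purely_unrectifiable_def)
  then have "A \<noteq> {}" using not_covered by blast
  then obtain g :: "(nat \<Rightarrow> nat) \<Rightarrow> 'a" where g: "continuous_on UNIV g" "range g = A"
    using A(2) unfolding analytic_set_def by blast
  obtain s where "stage_inv g 0 s"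
    using initial_stage_exists[OF A(1) g(2) not_covered] by blast
  moreover have "\<exists>s'. stage_inv g (Suc n) s' \<and> stage_refines n s s' \<and> stage_commits (M n) n s s'"
    if "stage_inv g n s" for n s
    using stage_step_exists[OF that M] by blast
  ultimately obtain S where "\<And>n. stage_inv g n (S n)"
    "\<And>n. stage_refines n (S n) (S (Suc n)) \<and> stage_commits (M n) n (S n) (S (Suc n))"
    using dependent_nat_choice[of "stage_inv g" "\<lambda>n s s'. stage_refines n s s' \<and> stage_commits (M n) n s s'"]
    by blast
  with g(1) interpret banach_mazur_run g M S by unfold_locales auto
  have "limit_point \<in> A" using g(2) by (auto simp: limit_point_def)
  then show thesis
    using that limit_fn_lipschitz limit_fn_avoids differentiableI[OF limit_fn_has_derivative] by blast
qed

section \<open>Steepness of typical functions\<close>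

lemma bounded_lipschitz_image:
  fixes f :: "'a::heine_borel \<Rightarrow> 'b::heine_borel"
  assumes "L-lipschitz_on S f" "bounded S"
  shows "bounded (f ` S)"
  using lipschitz_on_uniformly_continuous[OF assms(1)] assms(2) by (rule bounded_uniformly_continuous_image)

lemma lipschitz_strict_approximation:
  fixes f :: "'a::heine_borel \<Rightarrow> real"
  assumes lip: "1-lipschitz_on S f" and "bounded S" "0 < \<epsilon>"
  obtains \<delta> f' where "0 < \<delta>" "\<delta> < 1" "(1 - \<delta>)-lipschitz_on S f'" "close_on S \<epsilon> f' f"
proof -
  obtain B where B: "0 < B" "\<And>y. y \<in> S \<Longrightarrow> \<bar>f y\<bar> \<le> B"
    using bounded_lipschitz_image[OF assms(1,2)] by (auto simp: bounded_pos)
  define \<delta> where "\<delta> = min (1 / 2) (\<epsilon> / B)"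
  have \<delta>: "0 < \<delta>" "\<delta> < 1" "\<delta> \<le> \<epsilon> / B" using B(1) \<open>0 < \<epsilon>\<close> by (auto simp: \<delta>_def)
  show thesis
  proof (rule that[OF \<delta>(1,2)])
    show "(1 - \<delta>)-lipschitz_on S (\<lambda>y. (1 - \<delta>) * f y)"
      using lipschitz_on_cmult_real_nonneg[OF lip, of "1 - \<delta>"] \<delta>(2) by simp
    have "\<bar>\<delta> * f y\<bar> \<le> \<epsilon>" if "y \<in> S" for y
    proof -
      have "\<bar>\<delta> * f y\<bar> \<le> \<epsilon> / B * B"
        unfolding abs_mult using \<delta> B(2)[OF that] by (intro mult_mono) auto
      with B(1) show ?thesis by simp
    qed
    then show "close_on S \<epsilon> (\<lambda>y. (1 - \<delta>) * f y) f"
      by (simp add: close_on_def left_diff_distrib)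
  qed
qed

lemma mcshane_extension_near:
  assumes lip: "1-lipschitz_on Q f" and "Z \<subseteq> Q" "y \<in> Q" and z: "z \<in> Z" "dist z y \<le> r"
  shows "f y \<le> mcshane_extension 1 Z f y" "mcshane_extension 1 Z f y \<le> f y + 2 * r"
proof -
  have le: "f a \<le> f b + dist a b" if "a \<in> Q" "b \<in> Q" for a b
    using lipschitz_onD[OF lip that] by (simp add: dist_real_def)
  show "f y \<le> mcshane_extension 1 Z f y"
  proof (rule mcshane_extension_greatest)
    show "f y \<le> f s + 1 * dist y s" if "s \<in> Z" for s
      using le[of y s] that \<open>Z \<subseteq> Q\<close> \<open>y \<in> Q\<close> by auto
  qed (use z(1) in blast)
  have "mcshane_extension 1 Z f y \<le> f z + 1 * dist y z"
    using lipschitz_on_subset[OF lip \<open>Z \<subseteq> Q\<close>] z(1) by (rule mcshane_extension_le)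
  then show "mcshane_extension 1 Z f y \<le> f y + 2 * r"
    using le[of z y] z \<open>Z \<subseteq> Q\<close> \<open>y \<in> Q\<close> by (auto simp: dist_commute)
qed

lemma mcshane_extension_minimizer_near:
  assumes lip: "(1 - \<delta>)-lipschitz_on Z f" and "0 \<le> \<delta>"
    and z: "z \<in> Z" "mcshane_extension 1 Z f x = f z + dist x z" and z': "z' \<in> Z" "dist z' x \<le> r"
  shows "\<delta> * dist x z \<le> 2 * r"
proof -
  have "1-lipschitz_on Z f" using lip by (rule lipschitz_on_le) (use \<open>0 \<le> \<delta>\<close> in simp)
  then have "f z + dist x z \<le> f z' + dist x z'"
    using mcshane_extension_le[of 1 Z f z' x] z' z(2) by simp
  moreover have "f z' - f z \<le> (1 - \<delta>) * dist z' z"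
    using lipschitz_onD[OF lip z'(1) z(1)] by (simp add: dist_real_def)
  moreover have "(1 - \<delta>) * dist z' z \<le> (1 - \<delta>) * (dist z' x + dist x z)"
    using lipschitz_on_nonneg[OF lip] by (intro mult_left_mono dist_triangle) auto
  moreover have "(1 - \<delta>) * (dist z' x + dist x z) = dist z' x + dist x z - \<delta> * dist z' x - \<delta> * dist x z"
    by (simp add: algebra_simps)
  moreover have "0 \<le> \<delta> * dist z' x" using \<open>0 \<le> \<delta>\<close> by simp
  ultimately show ?thesis using z'(2) by (simp add: dist_commute)
qed

lemma mcshane_extension_rise:
  assumes lip: "(1 - \<delta>)-lipschitz_on Z f" and z: "z \<in> Z"
    and far: "\<And>z'. z' \<in> Z \<Longrightarrow> z' \<noteq> z \<Longrightarrow> 2 * dist z y \<le> \<delta> * dist z z'"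
  shows "f z + dist z y \<le> mcshane_extension 1 Z f y"
proof (rule mcshane_extension_greatest)
  fix z' assume z': "z' \<in> Z"
  show "f z + dist z y \<le> f z' + 1 * dist y z'"
  proof (cases "z' = z")
    case False
    have "f z - f z' \<le> (1 - \<delta>) * dist z z'"
      using lipschitz_onD[OF lip z z'] by (simp add: dist_real_def)
    also have "\<dots> \<le> dist z z' - 2 * dist z y"
      using far[OF z' False] by (simp add: algebra_simps)
    also have "\<dots> \<le> dist y z' - dist z y" using dist_triangle[of z z' y] by simp
    finally show ?thesis by simp
  qed (simp add: dist_commute)
qed (use z in blast)

lemma cube_neighbour:
  fixes z :: "'a::euclidean_space"
  assumes "z \<in> unit_cube" "0 \<le> \<tau>" "\<tau> \<le> 1 / 2"
  obtains y where "y \<in> unit_cube" "dist z y = \<tau>"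
proof -
  obtain b :: 'a where b: "b \<in> Basis" using nonempty_Basis by blast
  define s where "s = (if z \<bullet> b \<le> 1 / 2 then \<tau> else - \<tau>)"
  have "z + s *\<^sub>R b \<in> unit_cube"
    using assms b by (auto simp: mem_box inner_add_left inner_Basis s_def)
  moreover have "dist z (z + s *\<^sub>R b) = \<tau>"
    using b assms(2) by (simp add: dist_norm s_def)
  ultimately show thesis using that by blast
qed

lemma mcshane_extension_steep:
  fixes Z :: "'a::euclidean_space set"
  assumes Z: "finite Z" "Z \<subseteq> unit_cube" and net: "unit_cube \<subseteq> (\<Union>z\<in>Z. ball z r)"
    and lip: "(1 - \<delta>)-lipschitz_on Z f" and "0 < \<delta>" "2 * r < \<delta> * d"
    and \<tau>: "0 < \<tau>" "\<tau> \<le> d / 2" "\<tau> \<le> 1 / 2"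
    and separated: "\<And>z z'. z \<in> Z \<Longrightarrow> z' \<in> Z \<Longrightarrow> z \<noteq> z' \<Longrightarrow> 2 * \<tau> \<le> \<delta> * dist z z'"
    and x: "x \<in> unit_cube"
  obtains y where "y \<in> unit_cube" "y \<noteq> x" "dist x y < d"
    "dist x y / 2 + \<tau> / 16 < \<bar>mcshane_extension 1 Z f y - mcshane_extension 1 Z f x\<bar>"
proof -
  let ?h = "mcshane_extension 1 Z f"
  obtain z' where z': "z' \<in> Z" "dist z' x < r" using net x by auto
  obtain z where z: "z \<in> Z" "?h x = f z + dist x z"
    using mcshane_extension_attained[OF Z(1), of 1 f x] z'(1) by auto
  have zQ: "z \<in> unit_cube" using z(1) Z(2) by blast
  show thesis
  proof (cases "\<tau> / 4 \<le> dist x z")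
    case True
    have "\<delta> * dist x z \<le> 2 * r"
      using z' \<open>0 < \<delta>\<close> by (intro mcshane_extension_minimizer_near[OF lip _ z]) auto
    also have "\<dots> < \<delta> * d" by fact
    finally have "dist x z < d" using \<open>0 < \<delta>\<close> by simp
    moreover have "?h z \<le> f z"
      using mcshane_extension_le[OF lipschitz_on_le[OF lip] z(1), of 1 z] \<open>0 < \<delta>\<close> by simp
    ultimately show thesis using that[OF zQ] True \<tau>(1) z(2) by fastforce
  next
    case False
    obtain y where y: "y \<in> unit_cube" "dist z y = \<tau>"
      using cube_neighbour[OF zQ, of \<tau>] \<tau>(1,3) by auto
    have rise: "f z + \<tau> \<le> ?h y"
      using mcshane_extension_rise[OF lip z(1), of y] separated[OF z(1)] y(2) by auto
    have dist: "dist x y < 5 / 4 * \<tau>" "3 / 4 * \<tau> < dist x y"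
      using False y(2) dist_triangle[of x y z] dist_triangle[of z y x] dist_commute[of x z] by linarith+
    then have "y \<noteq> x" "dist x y < d" using \<tau>(1,2) by auto
    moreover have "dist x y / 2 + \<tau> / 16 < \<bar>?h y - ?h x\<bar>" using rise z(2) dist False \<tau>(1) by linarith
    ultimately show thesis using that y(1) by blast
  qed
qed

definition flat_somewhere :: "real \<Rightarrow> ('a::euclidean_space \<Rightarrow> real) set" where
  "flat_somewhere d = {f. \<exists>x\<in>unit_cube. \<forall>y\<in>unit_cube. y \<noteq> x \<longrightarrow> dist x y < d \<longrightarrow> \<bar>f y - f x\<bar> \<le> dist x y / 2}"

lemma not_flat_somewhere_if_close_to_steep:
  assumes steep: "\<And>x. x \<in> unit_cube \<Longrightarrow>
      \<exists>y\<in>unit_cube. y \<noteq> x \<and> dist x y < d \<and> dist x y / 2 + 2 * \<eta> < \<bar>h y - h x\<bar>"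
    and close: "close_on unit_cube \<eta> k h"
  shows "restrict k unit_cube \<notin> flat_somewhere d"
proof
  assume "restrict k unit_cube \<in> flat_somewhere d"
  then obtain x where x: "x \<in> unit_cube"
    "\<And>y. y \<in> unit_cube \<Longrightarrow> y \<noteq> x \<Longrightarrow> dist x y < d \<Longrightarrow> \<bar>k y - k x\<bar> \<le> dist x y / 2"
    by (auto simp: flat_somewhere_def)
  obtain y where y: "y \<in> unit_cube" "y \<noteq> x" "dist x y < d" "dist x y / 2 + 2 * \<eta> < \<bar>h y - h x\<bar>"
    using steep[OF x(1)] by blast
  have "\<bar>k y - h y\<bar> \<le> \<eta>" "\<bar>k x - h x\<bar> \<le> \<eta>" using close x(1) y(1) by (auto simp: close_on_def)
  with x(2)[OF y(1-3)] y(4) show False by linarith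
qed

lemma separated_net_exists:
  fixes S :: "'a::euclidean_space set"
  assumes "bounded S" "0 < r"
  obtains Z \<sigma> where "finite Z" "Z \<subseteq> S" "S \<subseteq> (\<Union>z\<in>Z. ball z r)" "0 < \<sigma>"
    "\<And>z z'. z \<in> Z \<Longrightarrow> z' \<in> Z \<Longrightarrow> z \<noteq> z' \<Longrightarrow> \<sigma> \<le> dist z z'"
proof -
  obtain Z where Z: "finite Z" "Z \<subseteq> S" "S \<subseteq> (\<Union>z\<in>Z. ball z r)"
    using bounded_finite_net[OF assms] .
  have "uniform_discrete Z" using Z(1) uniform_discrete_finite_iff by blast
  then obtain \<sigma> where "0 < \<sigma>" "\<And>z z'. z \<in> Z \<Longrightarrow> z' \<in> Z \<Longrightarrow> z \<noteq> z' \<Longrightarrow> \<sigma> \<le> dist z z'"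
    unfolding uniform_discrete_def by (meson not_less)
  with Z that show thesis by blast
qed

text \<open>Replacing a function by the lower envelope of cones of slope 1 over its values on a fine net
  moves it little, but makes it steep at a small scale around every point.\<close>
lemma steep_approximation_exists:
  fixes f :: "'a::euclidean_space \<Rightarrow> real"
  assumes lip: "1-lipschitz_on unit_cube f" and "0 < \<epsilon>" "0 < d"
  obtains h \<eta> where "1-lipschitz_on unit_cube h" "close_on unit_cube \<epsilon> h f" "0 < \<eta>"
    "\<And>x. x \<in> unit_cube \<Longrightarrow> \<exists>y\<in>unit_cube. y \<noteq> x \<and> dist x y < d \<and> dist x y / 2 + 2 * \<eta> < \<bar>h y - h x\<bar>"
proof -
  obtain \<delta> f' where \<delta>: "0 < \<delta>" "\<delta> < 1"
    and f': "(1 - \<delta>)-lipschitz_on unit_cube f'" "close_on unit_cube (\<epsilon> / 2) f' f"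
    using lipschitz_strict_approximation[OF lip bounded_cbox, of "\<epsilon> / 2"] \<open>0 < \<epsilon>\<close> by auto
  define r where "r = min (\<epsilon> / 4) (\<delta> * d / 4)"
  have r: "0 < r" "2 * r \<le> \<epsilon> / 2" "2 * r < \<delta> * d"
    using \<open>0 < \<epsilon>\<close> mult_pos_pos[OF \<delta>(1) \<open>0 < d\<close>] unfolding r_def by linarith+
  obtain Z :: "'a set" and \<sigma> where Z: "finite Z" "Z \<subseteq> unit_cube" "unit_cube \<subseteq> (\<Union>z\<in>Z. ball z r)"
    and \<sigma>: "0 < \<sigma>" "\<And>z z'. z \<in> Z \<Longrightarrow> z' \<in> Z \<Longrightarrow> z \<noteq> z' \<Longrightarrow> \<sigma> \<le> dist z z'"
    by (rule separated_net_exists[OF bounded_cbox r(1)]) (rule that)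
  define h where "h = mcshane_extension 1 Z f'"
  have lipZ: "(1 - \<delta>)-lipschitz_on Z f'" using f'(1) Z(2) by (rule lipschitz_on_subset)
  have lip1: "1-lipschitz_on unit_cube f'" using f'(1) by (rule lipschitz_on_le) (use \<delta> in simp)
  obtain \<tau> where \<tau>: "0 < \<tau>" "\<tau> \<le> d / 2" "\<tau> \<le> 1 / 2" "2 * \<tau> \<le> \<delta> * \<sigma>"
    using \<delta>(1) \<sigma>(1) \<open>0 < d\<close> by (intro that[of "min (\<delta> * \<sigma> / 2) (min (d / 2) (1 / 2))"]) auto
  have separated: "2 * \<tau> \<le> \<delta> * dist z z'" if "z \<in> Z" "z' \<in> Z" "z \<noteq> z'" for z z'
    using \<tau>(4) mult_left_mono[OF \<sigma>(2)[OF that], of \<delta>] \<delta>(1) by linarith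
  show thesis
  proof (rule that[of h "\<tau> / 32"])
    have "Z \<noteq> {}" using Z(3) by (auto simp: mem_box)
    then have "1-lipschitz_on UNIV h"
      unfolding h_def by (intro lipschitz_on_mcshane_extension lipschitz_on_subset[OF lip1 Z(2)])
    then show "1-lipschitz_on unit_cube h" by (rule lipschitz_on_subset) simp
    have "close_on unit_cube (2 * r) h f'"
      unfolding close_on_def
    proof
      fix y :: 'a assume y: "y \<in> unit_cube"
      then obtain z where z: "z \<in> Z" "dist z y \<le> r" using Z(3) by force
      show "\<bar>h y - f' y\<bar> \<le> 2 * r"
        using mcshane_extension_near[OF lip1 Z(2) y z] unfolding h_def by linarith
    qed
    then have "close_on unit_cube (2 * r + \<epsilon> / 2) h f" using f'(2) by (rule close_on_trans)
    then show "close_on unit_cube \<epsilon> h f" by (rule close_on_mono) (use r(2) in simp)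
    fix x :: 'a assume x: "x \<in> unit_cube"
    obtain y where "y \<in> unit_cube" "y \<noteq> x" "dist x y < d" "dist x y / 2 + \<tau> / 16 < \<bar>h y - h x\<bar>"
      by (rule mcshane_extension_steep[OF Z lipZ \<delta>(1) r(3) \<tau>(1-3) _ x, folded h_def],
          erule (2) separated, rule that)
    then show "\<exists>y\<in>unit_cube. y \<noteq> x \<and> dist x y < d \<and> dist x y / 2 + 2 * (\<tau> / 32) < \<bar>h y - h x\<bar>"
      by (intro bexI[of _ y]) simp_all
  qed (use \<tau>(1) in simp)
qed

lemma avoidable_flat_somewhere:
  assumes "0 < d"
  shows "avoidable (flat_somewhere d :: ('a::euclidean_space \<Rightarrow> real) set)"
proof (rule avoidableI)
  fix f :: "'a \<Rightarrow> real" and \<epsilon> :: real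
  assume "1-lipschitz_on unit_cube f" "0 < \<epsilon>"
  then obtain h \<eta> where h: "1-lipschitz_on unit_cube h" "close_on unit_cube \<epsilon> h f" "0 < \<eta>"
    "\<And>x. x \<in> unit_cube \<Longrightarrow> \<exists>y\<in>unit_cube. y \<noteq> x \<and> dist x y < d \<and> dist x y / 2 + 2 * \<eta> < \<bar>h y - h x\<bar>"
    using assms by (rule steep_approximation_exists) (rule that)
  have "restrict k unit_cube \<notin> flat_somewhere d" if "close_on unit_cube \<eta> k h" for k
    using h(4) that by (rule not_flat_somewhere_if_close_to_steep)
  with h(1-3) show "\<exists>h \<eta>. 1-lipschitz_on unit_cube h \<and> 0 < \<eta> \<and> close_on unit_cube \<epsilon> h f \<and>
      (\<forall>k. 1-lipschitz_on unit_cube k \<longrightarrow> close_on unit_cube \<eta> k h \<longrightarrow> restrict k unit_cube \<notin> flat_somewhere d)"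
    by blast
qed

section \<open>The potential of a set that is short on graphs\<close>

definition graph_curves :: "'a::real_inner \<Rightarrow> real \<Rightarrow> (real \<Rightarrow> 'a) set" where
  "graph_curves e \<alpha> = {\<gamma> \<in> near_curves e \<alpha>. \<forall>s. \<gamma> s \<bullet> e = s}"

lemma lipschitz_on_concat_UNIV:
  fixes f g :: "real \<Rightarrow> 'a::metric_space"
  assumes f: "L-lipschitz_on {..b} f" and g: "L-lipschitz_on {b..} g" and "f b = g b"
  shows "L-lipschitz_on UNIV (\<lambda>s. if s \<le> b then f s else g s)"
proof (rule lipschitz_onI)
  fix s t :: real
  let ?l = "min s t" and ?u = "max s t"
  have "L-lipschitz_on {?l..b} f" "L-lipschitz_on {b..?u} g"
    using f g by (auto intro: lipschitz_on_subset)
  then have "L-lipschitz_on {?l..?u} (\<lambda>s. if s \<le> b then f s else g s)"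
    using \<open>f b = g b\<close> by (rule lipschitz_on_concat)
  then show "dist (if s \<le> b then f s else g s) (if t \<le> b then f t else g t) \<le> L * dist s t"
    by (rule lipschitz_onD) auto
qed (rule lipschitz_on_nonneg[OF f])

lemma graph_curve_continue:
  fixes e :: "'a::real_inner"
  assumes \<gamma>: "\<gamma> \<in> graph_curves e \<alpha>" and e: "norm e = 1" and w: "w \<bullet> e = 0" "norm w \<le> \<alpha>"
  shows "(\<lambda>s. if s \<le> b then \<gamma> s else \<gamma> b + (s - b) *\<^sub>R (e + w)) \<in> graph_curves e \<alpha>" (is "?\<psi> \<in> _")
proof -
  have lip: "\<alpha>-lipschitz_on UNIV (\<lambda>s. \<gamma> s - s *\<^sub>R e)" and orth: "\<And>s. \<gamma> s \<bullet> e = s"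
    using \<gamma> by (auto simp: graph_curves_def near_curves_def)
  have "\<alpha>-lipschitz_on {b..} (\<lambda>s. (\<gamma> b - b *\<^sub>R e) + (s - b) *\<^sub>R w)"
  proof (rule lipschitz_onI)
    show "0 \<le> \<alpha>" using lip by (rule lipschitz_on_nonneg)
    show "dist ((\<gamma> b - b *\<^sub>R e) + (s - b) *\<^sub>R w) ((\<gamma> b - b *\<^sub>R e) + (t - b) *\<^sub>R w) \<le> \<alpha> * dist s t" for s t
    proof -
      have "dist ((\<gamma> b - b *\<^sub>R e) + (s - b) *\<^sub>R w) ((\<gamma> b - b *\<^sub>R e) + (t - b) *\<^sub>R w) = norm ((s - t) *\<^sub>R w)"
        by (simp add: dist_norm algebra_simps)
      also have "\<dots> \<le> \<alpha> * dist s t"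
        using mult_right_mono[OF w(2), of "\<bar>s - t\<bar>"] by (simp add: dist_real_def mult.commute)
      finally show ?thesis .
    qed
  qed
  then have "\<alpha>-lipschitz_on UNIV (\<lambda>s. if s \<le> b then \<gamma> s - s *\<^sub>R e else (\<gamma> b - b *\<^sub>R e) + (s - b) *\<^sub>R w)"
    by (intro lipschitz_on_concat_UNIV lipschitz_on_subset[OF lip]) auto
  also have "(\<lambda>s. if s \<le> b then \<gamma> s - s *\<^sub>R e else (\<gamma> b - b *\<^sub>R e) + (s - b) *\<^sub>R w) = (\<lambda>s. ?\<psi> s - s *\<^sub>R e)"
    by (auto simp: algebra_simps)
  finally have "?\<psi> \<in> near_curves e \<alpha>" by (simp only: near_curves_def mem_Collect_eq)
  moreover have "?\<psi> s \<bullet> e = s" for s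
    using orth w(1) e by (simp add: inner_add_left norm_eq_1)
  ultimately show ?thesis by (simp add: graph_curves_def)
qed

lemma line_in_graph_curves:
  fixes e :: "'a::real_inner"
  assumes "norm e = 1" "0 \<le> \<alpha>"
  shows "(\<lambda>s. x + (s - x \<bullet> e) *\<^sub>R e) \<in> graph_curves e \<alpha>"
  using assms
  by (auto simp: graph_curves_def near_curves_def inner_add_left norm_eq_1 lipschitz_on_def dist_norm algebra_simps)

lemma abs_le_norm_graph_curve:
  fixes e :: "'a::real_inner"
  assumes "\<gamma> \<in> graph_curves e \<alpha>" "norm e = 1"
  shows "\<bar>s\<bar> \<le> norm (\<gamma> s)"
  using assms Cauchy_Schwarz_ineq2[of "\<gamma> s" e] by (simp add: graph_curves_def)

lemma lmeasurable_graph_curve_preimage: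
  fixes e :: "'a::euclidean_space"
  assumes \<gamma>: "\<gamma> \<in> graph_curves e \<alpha>" and e: "norm e = 1" and G: "open G" "bounded G"
  shows "{s. \<gamma> s \<in> G} \<in> lmeasurable"
proof (rule lmeasurable_open)
  have "\<gamma> \<in> near_curves e \<alpha>" using \<gamma> by (simp add: graph_curves_def)
  then have "continuous_on UNIV \<gamma>"
    using near_curve_lipschitz[OF _ e] lipschitz_on_continuous_on by blast
  then show "open {s. \<gamma> s \<in> G}" using G(1) open_vimage[of G \<gamma>] by (simp add: vimage_def)
  obtain R where "\<And>y. y \<in> G \<Longrightarrow> norm y \<le> R" using G(2) bounded_iff by blast
  then have "\<bar>s\<bar> \<le> R" if "\<gamma> s \<in> G" for s
    using that abs_le_norm_graph_curve[OF \<gamma> e, of s] by force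
  then show "bounded {s. \<gamma> s \<in> G}" unfolding bounded_iff by auto
qed

definition passage_time :: "'a set \<Rightarrow> (real \<Rightarrow> 'a) \<Rightarrow> real \<Rightarrow> real" where
  "passage_time G \<gamma> b = measure lebesgue {s. s \<le> b \<and> \<gamma> s \<in> G}"

text \<open>The penalty \<open>a\<close> for ending above \<open>x\<close> instead of at \<open>x\<close> makes the potential 1-Lipschitz along \<open>e\<close>.\<close>
definition paths_to :: "'a::real_inner \<Rightarrow> real \<Rightarrow> 'a \<Rightarrow> ((real \<Rightarrow> 'a) \<times> real) set" where
  "paths_to e \<alpha> x = {(\<gamma>, a). \<gamma> \<in> graph_curves e \<alpha> \<and> 0 \<le> a \<and> \<gamma> (x \<bullet> e + a) = x + a *\<^sub>R e}"

definition potential :: "'a::real_inner \<Rightarrow> real \<Rightarrow> 'a set \<Rightarrow> 'a \<Rightarrow> real" where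
  "potential e \<alpha> G x = (SUP (\<gamma>, a)\<in>paths_to e \<alpha> x. passage_time G \<gamma> (x \<bullet> e + a) - a)"

locale short_on_graphs =
  fixes e :: "'a::euclidean_space" and \<alpha> \<epsilon> :: real and G :: "'a set"
  assumes unit: "norm e = 1" and \<alpha>_pos: "0 < \<alpha>" and G: "open G" "bounded G"
    and short: "\<gamma> \<in> graph_curves e \<alpha> \<Longrightarrow> measure lebesgue {s. \<gamma> s \<in> G} \<le> \<epsilon>"
begin

lemma lmeasurable_passage:
  assumes "\<gamma> \<in> graph_curves e \<alpha>"
  shows "{s. \<gamma> s \<in> G} \<in> lmeasurable" "{s. s \<le> b \<and> \<gamma> s \<in> G} \<in> lmeasurable"
proof -
  show m: "{s. \<gamma> s \<in> G} \<in> lmeasurable" by (rule lmeasurable_graph_curve_preimage[OF assms unit G])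
  have "{s. s \<le> b \<and> \<gamma> s \<in> G} = {..b} \<inter> {s. \<gamma> s \<in> G}" by auto
  then show "{s. s \<le> b \<and> \<gamma> s \<in> G} \<in> lmeasurable" using m by (simp add: sets_Int_fmeasurable)
qed

lemma passage_time_le: "\<gamma> \<in> graph_curves e \<alpha> \<Longrightarrow> passage_time G \<gamma> b \<le> \<epsilon>"
  unfolding passage_time_def
  using lmeasurable_passage by (intro order_trans[OF measure_mono_fmeasurable short]) auto

lemma passage_time_mono:
  assumes "\<gamma> \<in> graph_curves e \<alpha>" "\<psi> \<in> graph_curves e \<alpha>" "b \<le> b'" "\<And>s. s \<le> b \<Longrightarrow> \<psi> s = \<gamma> s"
  shows "passage_time G \<gamma> b \<le> passage_time G \<psi> b'"
  unfolding passage_time_def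
  using lmeasurable_passage assms by (intro measure_mono_fmeasurable) auto

lemma passage_time_inside:
  assumes \<gamma>: "\<gamma> \<in> graph_curves e \<alpha>" and "b \<le> b'" and inside: "\<And>s. b < s \<Longrightarrow> s \<le> b' \<Longrightarrow> \<gamma> s \<in> G"
  shows "passage_time G \<gamma> b + (b' - b) = passage_time G \<gamma> b'"
proof -
  let ?A = "{s. s \<le> b \<and> \<gamma> s \<in> G}" and ?J = "{b<..b'}"
  have J: "?J \<in> lmeasurable" by (rule fmeasurableI2[of "{b..b'}"]) auto
  have "?A \<inter> ?J = {}" by auto
  then have "measure lebesgue (?A \<union> ?J) = measure lebesgue ?A + measure lebesgue ?J"
    using measure_Un3[OF lmeasurable_passage(2)[OF \<gamma>] J] by simp
  moreover have "?A \<union> ?J = {s. s \<le> b' \<and> \<gamma> s \<in> G}" using inside \<open>b \<le> b'\<close> by force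
  ultimately show ?thesis using \<open>b \<le> b'\<close> by (simp add: passage_time_def)
qed

abbreviation pot :: "'a \<Rightarrow> real" where
  "pot \<equiv> potential e \<alpha> G"

lemma potential_ge:
  assumes "(\<gamma>, a) \<in> paths_to e \<alpha> x"
  shows "passage_time G \<gamma> (x \<bullet> e + a) - a \<le> pot x"
proof -
  have "bdd_above ((\<lambda>(\<gamma>, a). passage_time G \<gamma> (x \<bullet> e + a) - a) ` paths_to e \<alpha> x)"
  proof (rule bdd_aboveI2)
    fix p assume "p \<in> paths_to e \<alpha> x"
    then obtain \<gamma> a where "p = (\<gamma>, a)" "\<gamma> \<in> graph_curves e \<alpha>" "0 \<le> a" by (auto simp: paths_to_def)
    then show "(case p of (\<gamma>, a) \<Rightarrow> passage_time G \<gamma> (x \<bullet> e + a) - a) \<le> \<epsilon>"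
      using passage_time_le[of \<gamma> "x \<bullet> e + a"] by simp
  qed
  from cSUP_upper[OF assms this] show ?thesis by (simp add: potential_def)
qed

lemma line_in_paths_to: "(\<lambda>s. x + (s - x \<bullet> e) *\<^sub>R e, 0) \<in> paths_to e \<alpha> x"
  using line_in_graph_curves[OF unit, of \<alpha> x] \<alpha>_pos by (simp add: paths_to_def)

lemma potential_le:
  assumes "\<And>\<gamma> a. (\<gamma>, a) \<in> paths_to e \<alpha> x \<Longrightarrow> passage_time G \<gamma> (x \<bullet> e + a) - a \<le> c"
  shows "pot x \<le> c"
  unfolding potential_def by (rule cSUP_least) (use line_in_paths_to assms in auto)

lemma potential_nonneg: "0 \<le> pot x"
proof -
  have "0 \<le> passage_time G (\<lambda>s. x + (s - x \<bullet> e) *\<^sub>R e) (x \<bullet> e + 0)"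
    unfolding passage_time_def by (rule measure_nonneg)
  with potential_ge[OF line_in_paths_to, of x] show ?thesis by linarith
qed

lemma potential_le_bound: "pot x \<le> \<epsilon>"
proof (rule potential_le)
  fix \<gamma> a assume "(\<gamma>, a) \<in> paths_to e \<alpha> x"
  then show "passage_time G \<gamma> (x \<bullet> e + a) - a \<le> \<epsilon>"
    using passage_time_le[of \<gamma> "x \<bullet> e + a"] by (auto simp: paths_to_def)
qed

lemma inner_along: "(x + t *\<^sub>R e) \<bullet> e = x \<bullet> e + t"
  using unit by (simp add: inner_add_left norm_eq_1)

lemma shorten_path:
  assumes "(\<gamma>, a) \<in> paths_to e \<alpha> x" "t \<le> a"
  shows "(\<gamma>, a - t) \<in> paths_to e \<alpha> (x + t *\<^sub>R e)"
  using assms by (simp add: paths_to_def inner_along flip: scaleR_add_left)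

lemma extend_path:
  assumes path: "(\<gamma>, a) \<in> paths_to e \<alpha> x" and "a \<le> t"
  obtains \<psi> where "(\<psi>, 0) \<in> paths_to e \<alpha> (x + t *\<^sub>R e)" "\<And>s. s \<le> x \<bullet> e + a \<Longrightarrow> \<psi> s = \<gamma> s"
    "\<And>s. a < s \<Longrightarrow> \<psi> (x \<bullet> e + s) = x + s *\<^sub>R e"
proof -
  let ?b = "x \<bullet> e + a"
  have \<gamma>: "\<gamma> \<in> graph_curves e \<alpha>" "\<gamma> ?b = x + a *\<^sub>R e" using path by (auto simp: paths_to_def)
  define \<psi> where "\<psi> s = (if s \<le> ?b then \<gamma> s else \<gamma> ?b + (s - ?b) *\<^sub>R (e + 0))" for s
  have "\<psi> \<in> graph_curves e \<alpha>"
    unfolding \<psi>_def[abs_def] using \<alpha>_pos by (intro graph_curve_continue[OF \<gamma>(1) unit]) auto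
  moreover have along: "\<psi> (x \<bullet> e + s) = x + s *\<^sub>R e" if "a \<le> s" for s
    using that \<gamma>(2) by (auto simp: \<psi>_def simp flip: scaleR_add_left)
  ultimately have "(\<psi>, 0) \<in> paths_to e \<alpha> (x + t *\<^sub>R e)"
    using \<open>a \<le> t\<close> by (simp add: paths_to_def inner_along)
  then show thesis
  proof (rule that)
    show "\<psi> s = \<gamma> s" if "s \<le> ?b" for s using that by (simp add: \<psi>_def)
    show "\<psi> (x \<bullet> e + s) = x + s *\<^sub>R e" if "a < s" for s using along that by simp
  qed
qed

lemma path_gain:
  assumes path: "(\<gamma>, a) \<in> paths_to e \<alpha> x" and "0 \<le> t"
  shows "passage_time G \<gamma> (x \<bullet> e + a) - a \<le> pot (x + t *\<^sub>R e)"
    and "(\<And>s. 0 \<le> s \<Longrightarrow> s \<le> t \<Longrightarrow> x + s *\<^sub>R e \<in> G) \<Longrightarrow>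
      passage_time G \<gamma> (x \<bullet> e + a) - a + t \<le> pot (x + t *\<^sub>R e)"
proof -
  let ?b = "x \<bullet> e + a"
  have \<gamma>: "\<gamma> \<in> graph_curves e \<alpha>" "0 \<le> a" using path by (auto simp: paths_to_def)
  have "passage_time G \<gamma> ?b - a \<le> pot (x + t *\<^sub>R e) \<and>
    ((\<forall>s. 0 \<le> s \<longrightarrow> s \<le> t \<longrightarrow> x + s *\<^sub>R e \<in> G) \<longrightarrow> passage_time G \<gamma> ?b - a + t \<le> pot (x + t *\<^sub>R e))"
  proof (cases "t \<le> a")
    case True
    then show ?thesis using potential_ge[OF shorten_path[OF path True]] \<open>0 \<le> t\<close> by (simp add: inner_along)
  next
    case False
    then obtain \<psi> where \<psi>: "(\<psi>, 0) \<in> paths_to e \<alpha> (x + t *\<^sub>R e)" "\<And>s. s \<le> ?b \<Longrightarrow> \<psi> s = \<gamma> s"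
      "\<And>s. a < s \<Longrightarrow> \<psi> (x \<bullet> e + s) = x + s *\<^sub>R e"
      using extend_path[OF path, of t] by auto
    have \<psi>': "\<psi> \<in> graph_curves e \<alpha>" using \<psi>(1) by (simp add: paths_to_def)
    have "passage_time G \<psi> (x \<bullet> e + t) \<le> pot (x + t *\<^sub>R e)"
      using potential_ge[OF \<psi>(1)] by (simp add: inner_along)
    moreover have "passage_time G \<gamma> ?b \<le> passage_time G \<psi> (x \<bullet> e + t)"
      using False \<psi>(2) by (intro passage_time_mono[OF \<gamma>(1) \<psi>']) auto
    moreover have "passage_time G \<gamma> ?b + (t - a) \<le> passage_time G \<psi> (x \<bullet> e + t)"
      if inside: "\<forall>s. 0 \<le> s \<longrightarrow> s \<le> t \<longrightarrow> x + s *\<^sub>R e \<in> G"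
    proof -
      have "\<psi> s \<in> G" if "?b < s" "s \<le> x \<bullet> e + t" for s
        using \<psi>(3)[of "s - x \<bullet> e"] inside[rule_format, of "s - x \<bullet> e"] that \<gamma>(2) by simp
      then have "passage_time G \<psi> ?b + (t - a) = passage_time G \<psi> (x \<bullet> e + t)"
        using passage_time_inside[OF \<psi>', of ?b "x \<bullet> e + t"] False by simp
      moreover have "passage_time G \<gamma> ?b \<le> passage_time G \<psi> ?b"
        using \<psi>(2) by (intro passage_time_mono[OF \<gamma>(1) \<psi>']) auto
      ultimately show ?thesis by simp
    qed
    ultimately show ?thesis using \<gamma>(2) by (smt (verit))
  qed
  then show "passage_time G \<gamma> ?b - a \<le> pot (x + t *\<^sub>R e)"
    and "(\<And>s. 0 \<le> s \<Longrightarrow> s \<le> t \<Longrightarrow> x + s *\<^sub>R e \<in> G) \<Longrightarrow> passage_time G \<gamma> ?b - a + t \<le> pot (x + t *\<^sub>R e)"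
    by blast+
qed

lemma potential_mono_along: "0 \<le> t \<Longrightarrow> pot x \<le> pot (x + t *\<^sub>R e)"
  by (rule potential_le) (rule path_gain(1))

lemma potential_unit_speed_inside:
  assumes "0 \<le> t" "\<And>s. 0 \<le> s \<Longrightarrow> s \<le> t \<Longrightarrow> x + s *\<^sub>R e \<in> G"
  shows "pot x + t \<le> pot (x + t *\<^sub>R e)"
proof -
  have "pot x \<le> pot (x + t *\<^sub>R e) - t"
  proof (rule potential_le)
    fix \<gamma> a assume "(\<gamma>, a) \<in> paths_to e \<alpha> x"
    from path_gain(2)[OF this assms] show "passage_time G \<gamma> (x \<bullet> e + a) - a \<le> pot (x + t *\<^sub>R e) - t" by simp
  qed
  then show ?thesis by simp
qed

lemma potential_speed_le:
  assumes "0 \<le> t"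
  shows "pot (x + t *\<^sub>R e) \<le> pot x + t"
proof (rule potential_le)
  fix \<gamma> a assume "(\<gamma>, a) \<in> paths_to e \<alpha> (x + t *\<^sub>R e)"
  then have "(\<gamma>, t + a) \<in> paths_to e \<alpha> x"
    using assms by (simp add: paths_to_def inner_along add.assoc scaleR_add_left)
  from potential_ge[OF this] show "passage_time G \<gamma> ((x + t *\<^sub>R e) \<bullet> e + a) - a \<le> pot x + t"
    by (simp add: inner_along add.assoc)
qed

lemma potential_across:
  assumes w: "w \<bullet> e = 0"
  shows "pot (x + w) \<le> pot x + norm w / \<alpha>"
proof (cases "w = 0")
  case False
  show ?thesis
  proof (rule potential_le)
    fix \<gamma> a assume path: "(\<gamma>, a) \<in> paths_to e \<alpha> (x + w)"
    let ?b = "x \<bullet> e + a" and ?l = "norm w / \<alpha>"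
    have xw: "(x + w) \<bullet> e = x \<bullet> e" using w by (simp add: inner_add_left)
    have \<gamma>: "\<gamma> \<in> graph_curves e \<alpha>" "0 \<le> a" "\<gamma> ?b = x + w + a *\<^sub>R e"
      using path unfolding paths_to_def xw by auto
    have l: "0 < ?l" using False \<alpha>_pos by simp
    define u where "u = (- \<alpha> / norm w) *\<^sub>R w"
    have u: "u \<bullet> e = 0" "norm u = \<alpha>" "?l *\<^sub>R u = - w" using w False \<alpha>_pos by (simp_all add: u_def)
    define \<psi> where "\<psi> s = (if s \<le> ?b then \<gamma> s else \<gamma> ?b + (s - ?b) *\<^sub>R (e + u))" for s
    have \<psi>: "\<psi> \<in> graph_curves e \<alpha>"
      unfolding \<psi>_def[abs_def] using u by (intro graph_curve_continue[OF \<gamma>(1) unit]) auto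
    have "\<psi> (x \<bullet> e + (a + ?l)) = x + (a + ?l) *\<^sub>R e"
      using l \<gamma>(3) u(3) by (simp add: \<psi>_def scaleR_add_right scaleR_add_left)
    then have "(\<psi>, a + ?l) \<in> paths_to e \<alpha> x" using \<psi> \<gamma>(2) l by (simp add: paths_to_def)
    from potential_ge[OF this] have "passage_time G \<psi> (x \<bullet> e + (a + ?l)) - (a + ?l) \<le> pot x" .
    moreover have "passage_time G \<gamma> ?b \<le> passage_time G \<psi> (x \<bullet> e + (a + ?l))"
      using l by (intro passage_time_mono[OF \<gamma>(1) \<psi>]) (auto simp: \<psi>_def)
    ultimately show "passage_time G \<gamma> ((x + w) \<bullet> e + a) - a \<le> pot x + ?l" unfolding xw by linarith
  qed
qed simp

end

lemma norm_along_across_le: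
  fixes e w :: "'a::real_inner"
  assumes e: "norm e = 1" and w: "w \<bullet> e = 0" and "0 \<le> a" "0 \<le> \<delta>" and q: "\<bar>q\<bar> \<le> a + norm w * \<delta>"
  shows "norm (q *\<^sub>R e + w) \<le> (1 + \<delta>) * norm (a *\<^sub>R e + w)"
proof (rule power2_le_imp_le)
  define n where "n = norm (a *\<^sub>R e + w)"
  have pythagoras: "(norm (c *\<^sub>R e + w))\<^sup>2 = c\<^sup>2 + (norm w)\<^sup>2" for c
    unfolding power2_norm_eq_inner using w e
    by (simp add: inner_add_left inner_add_right inner_commute[of e w] norm_eq_1 power2_eq_square)
  have n: "0 \<le> n" "n\<^sup>2 = a\<^sup>2 + (norm w)\<^sup>2" by (simp_all add: n_def pythagoras)
  have le: "a \<le> n" "norm w \<le> n"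
    using power2_le_imp_le[OF _ n(1), of a] power2_le_imp_le[OF _ n(1), of "norm w"] n(2) by simp_all
  have "q\<^sup>2 \<le> (a + norm w * \<delta>)\<^sup>2" using q by (simp add: abs_le_square_iff[symmetric])
  then have "(norm (q *\<^sub>R e + w))\<^sup>2 \<le> (a + norm w * \<delta>)\<^sup>2 + (norm w)\<^sup>2" by (simp add: pythagoras)
  also have "\<dots> = n\<^sup>2 + 2 * \<delta> * (a * norm w) + \<delta>\<^sup>2 * (norm w)\<^sup>2"
    unfolding n(2) by (simp add: power2_eq_square algebra_simps)
  also have "\<dots> \<le> n\<^sup>2 + 2 * \<delta> * (n * n) + \<delta>\<^sup>2 * n\<^sup>2"
    using le \<open>0 \<le> a\<close> \<open>0 \<le> \<delta>\<close> by (intro add_mono mult_left_mono mult_mono power_mono) auto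
  also have "\<dots> = ((1 + \<delta>) * n)\<^sup>2" by (simp add: power2_eq_square algebra_simps)
  finally show "(norm (q *\<^sub>R e + w))\<^sup>2 \<le> ((1 + \<delta>) * norm (a *\<^sub>R e + w))\<^sup>2" by (simp add: n_def)
  show "0 \<le> (1 + \<delta>) * norm (a *\<^sub>R e + w)" using \<open>0 \<le> \<delta>\<close> by simp
qed

lemma lipschitz_on_potential_shift:
  fixes g :: "'a::real_inner \<Rightarrow> real"
  assumes e: "norm e = 1" and "0 \<le> \<delta>"
    and mono: "\<And>x t. 0 \<le> t \<Longrightarrow> g x \<le> g (x + t *\<^sub>R e)"
    and speed: "\<And>x t. 0 \<le> t \<Longrightarrow> g (x + t *\<^sub>R e) \<le> g x + t"
    and across: "\<And>x w. w \<bullet> e = 0 \<Longrightarrow> g (x + w) \<le> g x + norm w * \<delta>"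
  shows "(1 + \<delta>)-lipschitz_on UNIV (\<lambda>x. x - g x *\<^sub>R e)"
proof (rule lipschitz_onI)
  have upward: "norm ((y - g y *\<^sub>R e) - (x - g x *\<^sub>R e)) \<le> (1 + \<delta>) * norm (y - x)" if "0 \<le> (y - x) \<bullet> e" for x y
  proof -
    define a w where "a = (y - x) \<bullet> e" and "w = (y - x) - a *\<^sub>R e"
    have a: "0 \<le> a" using that by (simp add: a_def)
    have w: "w \<bullet> e = 0" using e by (simp add: w_def a_def inner_diff_left norm_eq_1)
    have y: "y = (x + w) + a *\<^sub>R e" by (simp add: w_def)
    have "g (x + w) \<le> g y" "g y \<le> g (x + w) + a" using mono[OF a, of "x + w"] speed[OF a, of "x + w"] y by auto
    moreover have "g (x + w) \<le> g x + norm w * \<delta>" using across[OF w] .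
    moreover have "g x \<le> g (x + w) + norm w * \<delta>" using across[of "- w" "x + w"] w by simp
    ultimately have "\<bar>a - (g y - g x)\<bar> \<le> a + norm w * \<delta>" using a by linarith
    then have "norm ((a - (g y - g x)) *\<^sub>R e + w) \<le> (1 + \<delta>) * norm (a *\<^sub>R e + w)"
      by (rule norm_along_across_le[OF e w a \<open>0 \<le> \<delta>\<close>])
    moreover have "(y - g y *\<^sub>R e) - (x - g x *\<^sub>R e) = (a - (g y - g x)) *\<^sub>R e + w"
      by (simp add: w_def algebra_simps)
    moreover have "a *\<^sub>R e + w = y - x" by (simp add: w_def)
    ultimately show ?thesis by (simp only:)
  qed
  show "dist (x - g x *\<^sub>R e) (y - g y *\<^sub>R e) \<le> (1 + \<delta>) * dist x y" for x y
  proof (cases "0 \<le> (y - x) \<bullet> e")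
    case True
    then show ?thesis using upward[of y x] by (simp only: dist_norm norm_minus_commute)
  next
    case False
    then have "0 \<le> (x - y) \<bullet> e" by (simp add: inner_diff_left)
    then show ?thesis using upward[of x y] by (simp only: dist_norm)
  qed
qed (use \<open>0 \<le> \<delta>\<close> in simp)

section \<open>Graphs through neighbourhoods of a purely unrectifiable set\<close>

lemma purely_unrectifiable_subset:
  assumes "purely_unrectifiable P" "K \<subseteq> P"
  shows "purely_unrectifiable K"
  unfolding purely_unrectifiable_iff
proof (intro allI impI)
  fix \<gamma> :: "real \<Rightarrow> 'a" assume "lipschitz_curve_on {0..1} \<gamma>"
  then have "negligible {t \<in> {0..1}. \<gamma> t \<in> P}" using assms(1) by (simp add: purely_unrectifiable_iff)
  then show "negligible {t \<in> {0..1}. \<gamma> t \<in> K}"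
    by (rule negligible_subset) (use assms(2) in auto)
qed

lemma lipschitz_curve_on_if_affine_component:
  fixes \<gamma> :: "real \<Rightarrow> 'a::euclidean_space"
  assumes "a < b" and lip: "L-lipschitz_on {a..b} \<gamma>" and e: "norm e = 1" and "0 < c"
    and component: "\<And>t. t \<in> {a..b} \<Longrightarrow> \<gamma> t \<bullet> e = c * t + d"
  shows "lipschitz_curve_on {a..b} \<gamma>"
proof -
  have speed: "c \<le> norm v" if t: "t \<in> {a..b}" and v: "(\<gamma> has_vector_derivative v) (at t within {a..b})" for t v
  proof -
    have "((\<lambda>t. \<gamma> t \<bullet> e) has_vector_derivative v \<bullet> e) (at t within {a..b})"
      using v by (rule bounded_linear.has_vector_derivative[OF bounded_linear_inner_left])
    then have "((\<lambda>t. c * t + d) has_vector_derivative v \<bullet> e) (at t within {a..b})"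
      by (rule has_vector_derivative_transform[OF t, rotated]) (simp add: component)
    moreover have "((\<lambda>t. c * t + d) has_vector_derivative c) (at t within {a..b})"
      by (auto intro!: derivative_eq_intros simp: has_real_derivative_iff_has_vector_derivative[symmetric])
    ultimately have "v \<bullet> e = c"
      using t \<open>a < b\<close> by (intro vector_derivative_unique_within_closed_interval[of a b t]) auto
    then show ?thesis using Cauchy_Schwarz_ineq2[of v e] e \<open>0 < c\<close> by simp
  qed
  have "{t \<in> {a..b}. \<nexists>v. (\<gamma> has_vector_derivative v) (at t within {a..b}) \<and> c \<le> norm v}
      \<subseteq> {t \<in> {a..b}. \<not> \<gamma> differentiable (at t within {a..b})}"
    using speed vector_derivative_works by blast
  then have "negligible {t \<in> {a..b}. \<nexists>v. (\<gamma> has_vector_derivative v) (at t within {a..b}) \<and> c \<le> norm v}"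
    by (rule negligible_subset[OF negligible_not_differentiable_lipschitz[OF lip]])
  then show ?thesis using lip \<open>0 < c\<close> by (auto simp: lipschitz_curve_on_iff)
qed

lemma purely_unrectifiable_graph_null:
  fixes e :: "'a::euclidean_space"
  assumes pu: "purely_unrectifiable K" and e: "norm e = 1" and "a < b"
    and lip: "L-lipschitz_on {a..b} \<gamma>" and graph: "\<And>s. s \<in> {a..b} \<Longrightarrow> \<gamma> s \<bullet> e = s"
  shows "negligible {s \<in> {a..b}. \<gamma> s \<in> K}"
proof -
  define c where "c = b - a"
  have c: "0 < c" using \<open>a < b\<close> by (simp add: c_def)
  have range: "c * t + a \<in> {a..b}" if t: "t \<in> {0..1}" for t
  proof -
    have "0 \<le> c * t" "c * t \<le> c" using t c by auto
    then show ?thesis by (simp add: c_def)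
  qed
  have "(L * c)-lipschitz_on {0..1} (\<lambda>t. \<gamma> (c * t + a))"
  proof (rule lipschitz_on_compose2[where f = "\<lambda>t. c * t + a"])
    show "c-lipschitz_on {0..1} (\<lambda>t. c * t + a)"
      using c by (auto simp: lipschitz_on_def dist_real_def abs_mult simp flip: right_diff_distrib)
    show "L-lipschitz_on ((\<lambda>t. c * t + a) ` {0..1}) \<gamma>"
      using lip by (rule lipschitz_on_subset) (use range in blast)
  qed
  then have "lipschitz_curve_on {0..1} (\<lambda>t. \<gamma> (c * t + a))"
    by (rule lipschitz_curve_on_if_affine_component[OF zero_less_one _ e c]) (simp only: graph[OF range])
  then have "negligible {t \<in> {0..1}. \<gamma> (c * t + a) \<in> K}"
    using pu by (simp add: purely_unrectifiable_iff)
  then have "negligible {s. inverse c * s + (- a / c) \<in> {t \<in> {0..1}. \<gamma> (c * t + a) \<in> K}}"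
    by (rule negligible_affine_preimage) (use c in simp)
  moreover have "{s \<in> {a..b}. \<gamma> s \<in> K} \<subseteq> {s. inverse c * s + (- a / c) \<in> {t \<in> {0..1}. \<gamma> (c * t + a) \<in> K}}"
  proof
    fix s assume s: "s \<in> {s \<in> {a..b}. \<gamma> s \<in> K}"
    have t: "inverse c * s + (- a / c) = (s - a) / c" using c by (simp add: field_split_simps)
    have "(s - a) / c \<in> {0..1}" "c * ((s - a) / c) + a = s" using s c by (auto simp: c_def)
    with s show "s \<in> {s. inverse c * s + (- a / c) \<in> {t \<in> {0..1}. \<gamma> (c * t + a) \<in> K}}"
      unfolding mem_Collect_eq t by simp
  qed
  ultimately show ?thesis by (rule negligible_subset)
qed

definition thickening :: "'a::metric_space set \<Rightarrow> real \<Rightarrow> 'a set" where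
  "thickening K r = (\<Union>k\<in>K. ball k r)"

lemma open_thickening: "open (thickening K r)"
  unfolding thickening_def by blast

lemma thickening_mono: "r \<le> s \<Longrightarrow> thickening K r \<subseteq> thickening K s"
  by (auto simp: thickening_def)

lemma norm_thickening_le:
  fixes K :: "'a::real_normed_vector set"
  assumes "y \<in> thickening K r" "\<And>k. k \<in> K \<Longrightarrow> norm k \<le> R"
  shows "norm y \<le> R + r"
proof -
  obtain k where "k \<in> K" "dist k y < r" using assms(1) by (auto simp: thickening_def)
  then show ?thesis
    using assms(2)[of k] norm_triangle_sub[of y k] by (simp add: dist_norm norm_minus_commute)
qed

lemma bounded_thickening:
  fixes K :: "'a::real_normed_vector set"
  assumes "bounded K"
  shows "bounded (thickening K r)"
proof -
  obtain R where "\<And>k. k \<in> K \<Longrightarrow> norm k \<le> R" using assms by (auto simp: bounded_iff)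
  then show ?thesis unfolding bounded_iff using norm_thickening_le by blast
qed

lemma closure_if_frequently_in_thickening:
  assumes lim: "x \<longlonglongrightarrow> l" and r: "r \<longlonglongrightarrow> 0" and freq: "\<exists>\<^sub>F n in sequentially. x n \<in> thickening K (r n)"
  shows "l \<in> closure K"
  unfolding closure_approachable
proof (intro allI impI)
  fix \<delta> :: real assume "0 < \<delta>"
  have "\<forall>\<^sub>F n in sequentially. dist (x n) l < \<delta> / 2" using lim \<open>0 < \<delta>\<close> by (intro tendstoD) auto
  moreover have "\<forall>\<^sub>F n in sequentially. r n < \<delta> / 2" using r \<open>0 < \<delta>\<close> by (intro order_tendstoD) auto
  ultimately have "\<forall>\<^sub>F n in sequentially. dist (x n) l < \<delta> / 2 \<and> r n < \<delta> / 2" by (rule eventually_conj)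
  then obtain n where n: "dist (x n) l < \<delta> / 2" "r n < \<delta> / 2" "x n \<in> thickening K (r n)"
    using frequently_ex[OF frequently_eventually_frequently[OF freq]] by blast
  then obtain k where "k \<in> K" "dist k (x n) < r n" by (auto simp: thickening_def)
  with n(1,2) have "dist k l < \<delta>" using dist_triangle[of k l "x n"] by linarith
  with \<open>k \<in> K\<close> show "\<exists>y\<in>K. dist y l < \<delta>" by blast
qed

lemma measure_frequently_ge:
  fixes E :: "nat \<Rightarrow> 'a set"
  assumes E: "\<And>n. E n \<in> fmeasurable M" "\<And>n. E n \<subseteq> J" and J: "J \<in> fmeasurable M"
    and ge: "\<And>n. \<epsilon> \<le> measure M (E n)"
  shows "\<epsilon> \<le> measure M {s. \<exists>\<^sub>F n in sequentially. s \<in> E n}"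
proof -
  define U where "U n = (\<Union>j\<in>{n..}. E j)" for n
  have U: "U n \<in> fmeasurable M" for n
  proof (rule fmeasurableI2[OF J])
    show "U n \<subseteq> J" using E(2) by (auto simp: U_def)
    show "U n \<in> sets M" unfolding U_def using E(1) by (intro sets.countable_UN') auto
  qed
  have "(\<lambda>n. measure M (U n)) \<longlonglongrightarrow> measure M (\<Inter>n. U n)"
  proof (rule Lim_measure_decseq)
    show "range U \<subseteq> sets M" using U by auto
    show "decseq U" unfolding decseq_def U_def by (intro allI impI UN_mono) auto
    show "emeasure M (U n) \<noteq> \<infinity>" for n using fmeasurableD2[OF U[of n]] by (simp only: infinity_ennreal_def) simp
  qed
  moreover have "\<epsilon> \<le> measure M (U n)" for n
    using ge[of n] measure_mono_fmeasurable[of "E n" "U n" M] E(1)[of n] U[of n] by (force simp: U_def)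
  ultimately have "\<epsilon> \<le> measure M (\<Inter>n. U n)" by (intro Lim_bounded2) auto
  also have "(\<Inter>n. U n) = {s. \<exists>\<^sub>F n in sequentially. s \<in> E n}"
    by (auto simp: U_def frequently_sequentially)
  finally show ?thesis .
qed

lemma graph_curve_norm_le:
  assumes \<gamma>: "\<gamma> \<in> graph_curves e \<alpha>" and e: "norm e = 1" and t: "norm (\<gamma> t) \<le> R" and s: "\<bar>s\<bar> \<le> R"
  shows "norm (\<gamma> s) \<le> R + (1 + \<alpha>) * (2 * R)"
proof -
  have near: "\<gamma> \<in> near_curves e \<alpha>" using \<gamma> by (simp add: graph_curves_def)
  have "\<bar>t\<bar> \<le> R" using abs_le_norm_graph_curve[OF \<gamma> e] t by (rule order_trans)
  have lip: "(1 + \<alpha>)-lipschitz_on UNIV \<gamma>" by (rule near_curve_lipschitz[OF near e])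
  have "norm (\<gamma> s - \<gamma> t) \<le> (1 + \<alpha>) * \<bar>s - t\<bar>" using lipschitz_onD[OF lip, of s t] by (simp add: dist_norm)
  also have "\<dots> \<le> (1 + \<alpha>) * (2 * R)"
    using lipschitz_on_nonneg[OF lip] \<open>\<bar>t\<bar> \<le> R\<close> s by (intro mult_left_mono) auto
  finally show ?thesis using t norm_triangle_sub[of "\<gamma> s" "\<gamma> t"] by linarith
qed

lemma graph_curves_subsequence:
  fixes e :: "'a::euclidean_space"
  assumes \<gamma>: "\<And>n. \<gamma> n \<in> graph_curves e \<alpha>" and e: "norm e = 1"
    and bounded: "\<And>n s. s \<in> {a..b} \<Longrightarrow> norm (\<gamma> n s) \<le> B"
  obtains k \<zeta> where "strict_mono (k :: nat \<Rightarrow> nat)" "(1 + \<alpha>)-lipschitz_on {a..b} \<zeta>"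
    "\<And>s. s \<in> {a..b} \<Longrightarrow> \<zeta> s \<bullet> e = s" "\<And>s. s \<in> {a..b} \<Longrightarrow> (\<lambda>n. \<gamma> (k n) s) \<longlonglongrightarrow> \<zeta> s"
proof -
  have lip: "(1 + \<alpha>)-lipschitz_on UNIV (\<gamma> n)" for n
    using \<gamma>[of n] near_curve_lipschitz[OF _ e] by (simp add: graph_curves_def)
  obtain \<zeta> k where k: "strict_mono (k :: nat \<Rightarrow> nat)"
    "\<And>\<delta>. 0 < \<delta> \<Longrightarrow> \<exists>N. \<forall>n s. N \<le> n \<and> s \<in> {a..b} \<longrightarrow> norm (\<gamma> (k n) s - \<zeta> s) < \<delta>"
  proof (rule Arzela_Ascoli[of "{a..b}" \<gamma> B])
    fix s \<delta> :: real assume "0 < \<delta>"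
    define d where "d = \<delta> / (2 + \<alpha>)"
    have \<alpha>: "0 \<le> 1 + \<alpha>" using lip by (rule lipschitz_on_nonneg)
    then have d: "0 < d" "(2 + \<alpha>) * d = \<delta>" using \<open>0 < \<delta>\<close> by (simp_all add: d_def)
    have "norm (\<gamma> n s - \<gamma> n t) < \<delta>" if "norm (s - t) < d" for n t
    proof -
      have "norm (\<gamma> n s - \<gamma> n t) \<le> (1 + \<alpha>) * norm (s - t)"
        using lipschitz_onD[OF lip, of s t n] by (simp add: dist_norm)
      also have "\<dots> \<le> (1 + \<alpha>) * d" using that \<alpha> by (intro mult_left_mono) auto
      also have "\<dots> < \<delta>" using d by (simp add: distrib_right)
      finally show ?thesis .
    qed
    with d(1) show "\<exists>d>0. \<forall>n t. t \<in> {a..b} \<and> norm (s - t) < d \<longrightarrow> norm (\<gamma> n s - \<gamma> n t) < \<delta>" by blast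
  qed (use bounded in auto)
  have lim: "(\<lambda>n. \<gamma> (k n) s) \<longlonglongrightarrow> \<zeta> s" if "s \<in> {a..b}" for s
    unfolding LIMSEQ_iff using k(2) that by blast
  show thesis
  proof (rule that[OF k(1) _ _ lim])
    show "(1 + \<alpha>)-lipschitz_on {a..b} \<zeta>"
      by (rule lipschitz_on_limit[OF _ lim]) (auto intro: lipschitz_on_subset[OF lip])
    fix s assume "s \<in> {a..b}"
    then have "(\<lambda>n. \<gamma> (k n) s \<bullet> e) \<longlonglongrightarrow> \<zeta> s \<bullet> e" using lim by (intro tendsto_intros)
    moreover have "\<gamma> (k n) s \<bullet> e = s" for n using \<gamma> by (simp add: graph_curves_def)
    ultimately show "\<zeta> s \<bullet> e = s" by (simp add: LIMSEQ_const_iff)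
  qed
qed

lemma graph_curves_subsequence_if_meeting:
  fixes e :: "'a::euclidean_space"
  assumes \<gamma>: "\<And>n. \<gamma> n \<in> graph_curves e \<alpha>" and e: "norm e = 1" and meets: "\<And>n. \<exists>t. norm (\<gamma> n t) \<le> R"
  obtains k \<zeta> where "strict_mono (k :: nat \<Rightarrow> nat)" "(1 + \<alpha>)-lipschitz_on {- R..R} \<zeta>"
    "\<And>s. s \<in> {- R..R} \<Longrightarrow> \<zeta> s \<bullet> e = s" "\<And>s. s \<in> {- R..R} \<Longrightarrow> (\<lambda>n. \<gamma> (k n) s) \<longlonglongrightarrow> \<zeta> s"
proof -
  have bound: "norm (\<gamma> n s) \<le> R + (1 + \<alpha>) * (2 * R)" if "s \<in> {- R..R}" for n s
  proof -
    obtain t where "norm (\<gamma> n t) \<le> R" using meets by blast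
    moreover have "\<bar>s\<bar> \<le> R" using that by (simp add: abs_le_iff)
    ultimately show ?thesis by (intro graph_curve_norm_le[OF \<gamma> e])
  qed
  show thesis by (rule graph_curves_subsequence[of \<gamma>, OF \<gamma> e], erule bound, rule that)
qed

lemma negligible_frequently_in_thickening:
  fixes e :: "'a::euclidean_space"
  assumes K: "compact K" "purely_unrectifiable K" and e: "norm e = 1"
    and \<zeta>: "L-lipschitz_on {a..b} \<zeta>" "\<And>s. s \<in> {a..b} \<Longrightarrow> \<zeta> s \<bullet> e = s"
    and lim: "\<And>s. s \<in> {a..b} \<Longrightarrow> (\<lambda>n. \<gamma> n s) \<longlonglongrightarrow> \<zeta> s" and r: "r \<longlonglongrightarrow> 0"
  shows "negligible {s \<in> {a..b}. \<exists>\<^sub>F n in sequentially. \<gamma> n s \<in> thickening K (r n)}"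
proof (rule negligible_subset)
  show "negligible {s \<in> {a..b}. \<zeta> s \<in> K}"
  proof (cases "a < b")
    case True
    show ?thesis by (rule purely_unrectifiable_graph_null[OF K(2) e True \<zeta>])
  next
    case False
    then have "{s \<in> {a..b}. \<zeta> s \<in> K} \<subseteq> {b}" by auto
    then show ?thesis using negligible_subset[of "{b}"] by simp
  qed
  have "\<zeta> s \<in> K" if "s \<in> {a..b}" "\<exists>\<^sub>F n in sequentially. \<gamma> n s \<in> thickening K (r n)" for s
    using closure_if_frequently_in_thickening[OF lim[OF that(1)] r that(2)] K(1)
    by (simp add: compact_imp_closed closure_closed)
  then show "{s \<in> {a..b}. \<exists>\<^sub>F n in sequentially. \<gamma> n s \<in> thickening K (r n)} \<subseteq> {s \<in> {a..b}. \<zeta> s \<in> K}" by blast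
qed

lemma short_on_graphs_thickening:
  fixes e :: "'a::euclidean_space"
  assumes K: "compact K" "purely_unrectifiable K" and e: "norm e = 1" and "0 < \<alpha>" "0 < \<epsilon>"
  obtains r where "0 < r" "short_on_graphs e \<alpha> \<epsilon> (thickening K r)"
proof (rule ccontr)
  assume none: "\<not> thesis"
  define G where "G n = thickening K (1 / Suc n)" for n
  have G: "open (G n)" "bounded (G n)" for n
    using K(1) by (simp_all add: G_def open_thickening bounded_thickening compact_imp_bounded)
  have "\<exists>\<gamma>\<in>graph_curves e \<alpha>. \<epsilon> < measure lebesgue {s. \<gamma> s \<in> G n}" for n
  proof (rule ccontr)
    assume "\<not> ?thesis"
    then have "short_on_graphs e \<alpha> \<epsilon> (G n)"
      using e \<open>0 < \<alpha>\<close> G by unfold_locales (auto simp: not_less)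
    then show False using none that[of "1 / Suc n"] by (simp add: G_def)
  qed
  then obtain \<gamma> where \<gamma>: "\<And>n. \<gamma> n \<in> graph_curves e \<alpha>" "\<And>n. \<epsilon> < measure lebesgue {s. \<gamma> n s \<in> G n}" by metis
  have "G n \<subseteq> G 0" for n unfolding G_def by (rule thickening_mono) simp
  then obtain R where R: "\<And>n y. y \<in> G n \<Longrightarrow> norm y \<le> R" using G(2)[of 0] unfolding bounded_iff by blast
  have "{s. \<gamma> n s \<in> G n} \<noteq> {}" for n
  proof
    assume "{s. \<gamma> n s \<in> G n} = {}"
    then show False using \<gamma>(2)[of n] \<open>0 < \<epsilon>\<close> by simp
  qed
  then have "\<exists>t. norm (\<gamma> n t) \<le> R" for n using R by blast
  then obtain k \<zeta> where k: "strict_mono (k :: nat \<Rightarrow> nat)" and \<zeta>: "(1 + \<alpha>)-lipschitz_on {- R..R} \<zeta>"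
    "\<And>s. s \<in> {- R..R} \<Longrightarrow> \<zeta> s \<bullet> e = s" "\<And>s. s \<in> {- R..R} \<Longrightarrow> (\<lambda>n. \<gamma> (k n) s) \<longlonglongrightarrow> \<zeta> s"
    using graph_curves_subsequence_if_meeting[of \<gamma>, OF \<gamma>(1) e] by blast
  have in_interval: "s \<in> {- R..R}" if "\<gamma> n s \<in> G n" for n s
    using abs_le_norm_graph_curve[OF \<gamma>(1) e, of s n] R[OF that] by (simp add: abs_le_iff)
  let ?E = "\<lambda>j. {s. \<gamma> (k j) s \<in> G (k j)}"
  have "\<epsilon> \<le> measure lebesgue {s. \<exists>\<^sub>F j in sequentially. s \<in> ?E j}"
  proof (rule measure_frequently_ge)
    show "?E j \<in> lmeasurable" for j by (rule lmeasurable_graph_curve_preimage[OF \<gamma>(1) e G])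
    show "?E j \<subseteq> {- R..R}" for j using in_interval by blast
    show "\<epsilon> \<le> measure lebesgue (?E j)" for j using \<gamma>(2) by (rule less_imp_le)
  qed simp
  moreover have "(\<lambda>j. 1 / real (Suc (k j))) \<longlonglongrightarrow> 0"
    using LIMSEQ_subseq_LIMSEQ[OF LIMSEQ_Suc[OF lim_1_over_n] k] by (simp add: o_def)
  then have "negligible {s \<in> {- R..R}. \<exists>\<^sub>F j in sequentially. s \<in> ?E j}"
    using negligible_frequently_in_thickening[OF K e \<zeta>] by (simp add: G_def)
  moreover have "{s. \<exists>\<^sub>F j in sequentially. s \<in> ?E j} = {s \<in> {- R..R}. \<exists>\<^sub>F j in sequentially. s \<in> ?E j}"
    using frequently_ex in_interval by blast
  ultimately show False using \<open>0 < \<epsilon>\<close> negligible_imp_measure0 by fastforce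
qed

section \<open>Typical functions on purely unrectifiable sets\<close>

lemma collapsing_map_exists:
  fixes e :: "'a::euclidean_space"
  assumes K: "compact K" "purely_unrectifiable K" and e: "norm e = 1" and "0 < \<delta>" "0 < \<epsilon>"
  obtains \<psi> r where "(1 + \<delta>)-lipschitz_on UNIV \<psi>" "\<And>x. norm (\<psi> x - x) \<le> \<epsilon>" "0 < r"
    "\<And>x t. x \<in> K \<Longrightarrow> 0 \<le> t \<Longrightarrow> t < r \<Longrightarrow> \<psi> (x + t *\<^sub>R e) = \<psi> x"
proof -
  obtain r where r: "0 < r" "short_on_graphs e (1 / \<delta>) \<epsilon> (thickening K r)"
    using short_on_graphs_thickening[OF K e, of "1 / \<delta>" \<epsilon>] \<open>0 < \<delta>\<close> \<open>0 < \<epsilon>\<close> by auto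
  interpret short_on_graphs e "1 / \<delta>" \<epsilon> "thickening K r" by (rule r(2))
  show thesis
  proof (rule that[of "\<lambda>x. x - pot x *\<^sub>R e"])
    show "(1 + \<delta>)-lipschitz_on UNIV (\<lambda>x. x - pot x *\<^sub>R e)"
      using \<open>0 < \<delta>\<close> potential_mono_along potential_speed_le potential_across
      by (intro lipschitz_on_potential_shift[OF e]) auto
    show "norm (x - pot x *\<^sub>R e - x) \<le> \<epsilon>" for x
      using potential_nonneg[of x] potential_le_bound[of x] e by simp
    fix x t assume "x \<in> K" "0 \<le> t" "t < r"
    then have "x + s *\<^sub>R e \<in> thickening K r" if "0 \<le> s" "s \<le> t" for s
      using that e by (auto simp: thickening_def dist_norm intro!: bexI[of _ x])
    then have "pot (x + t *\<^sub>R e) = pot x + t"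
      using potential_unit_speed_inside[of t x] potential_speed_le[of t x] \<open>0 \<le> t\<close> by (intro antisym) auto
    then show "x + t *\<^sub>R e - pot (x + t *\<^sub>R e) *\<^sub>R e = x - pot x *\<^sub>R e"
      by (simp add: scaleR_add_left)
  qed (rule r(1))
qed

definition steep_along :: "'a::euclidean_space \<Rightarrow> real \<Rightarrow> 'a set \<Rightarrow> ('a \<Rightarrow> real) set" where
  "steep_along e d K = {f. \<exists>x\<in>K. \<forall>t. 0 < t \<longrightarrow> t < d \<longrightarrow> x + t *\<^sub>R e \<in> unit_cube \<longrightarrow>
      d * t \<le> \<bar>f (x + t *\<^sub>R e) - f x\<bar>}"

lemma not_steep_along_if_close_to_flat:
  assumes K: "K \<subseteq> unit_cube" and t: "0 < t" "t < d" and inside: "\<And>x. x \<in> K \<Longrightarrow> x + t *\<^sub>R e \<in> unit_cube"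
    and flat: "\<And>x. x \<in> K \<Longrightarrow> h (x + t *\<^sub>R e) = h x" and close: "close_on unit_cube (d * t / 4) k h"
  shows "restrict k unit_cube \<notin> steep_along e d K"
proof
  assume "restrict k unit_cube \<in> steep_along e d K"
  then obtain x where x: "x \<in> K" "d * t \<le> \<bar>restrict k unit_cube (x + t *\<^sub>R e) - restrict k unit_cube x\<bar>"
    using t inside unfolding steep_along_def by blast
  have cube: "x + t *\<^sub>R e \<in> unit_cube" "x \<in> unit_cube" using x(1) K inside by blast+
  then have "\<bar>k (x + t *\<^sub>R e) - h (x + t *\<^sub>R e)\<bar> \<le> d * t / 4" "\<bar>k x - h x\<bar> \<le> d * t / 4"
    using close by (auto simp: close_on_def)
  moreover have "d * t \<le> \<bar>k (x + t *\<^sub>R e) - k x\<bar>" using x(2) cube by simp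
  moreover have "0 < d * t" using t by simp
  ultimately show False using flat[OF x(1)] by linarith
qed

lemma locally_constant_along_approximation_exists:
  fixes f :: "'a::euclidean_space \<Rightarrow> real"
  assumes K: "compact K" "purely_unrectifiable K" and e: "norm e = 1"
    and lip: "1-lipschitz_on S f" and "bounded S" "0 < \<epsilon>"
  obtains h r where "1-lipschitz_on S h" "close_on S \<epsilon> h f" "0 < r"
    "\<And>x t. x \<in> K \<Longrightarrow> 0 \<le> t \<Longrightarrow> t < r \<Longrightarrow> h (x + t *\<^sub>R e) = h x"
proof -
  have "0 < \<epsilon> / 2" using \<open>0 < \<epsilon>\<close> by simp
  obtain \<delta> f' where \<delta>: "0 < \<delta>" "\<delta> < 1" and f': "(1 - \<delta>)-lipschitz_on S f'" "close_on S (\<epsilon> / 2) f' f"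
    using lipschitz_strict_approximation[OF lip \<open>bounded S\<close> \<open>0 < \<epsilon> / 2\<close>] .
  obtain F where F: "(1 - \<delta>)-lipschitz_on UNIV F" "\<And>y. y \<in> S \<Longrightarrow> F y = f' y"
    using lipschitz_extend_real[OF f'(1)] by blast
  obtain \<psi> r where \<psi>: "(1 + \<delta>)-lipschitz_on UNIV \<psi>" "\<And>x. norm (\<psi> x - x) \<le> \<epsilon> / 2" "0 < r"
    "\<And>x t. x \<in> K \<Longrightarrow> 0 \<le> t \<Longrightarrow> t < r \<Longrightarrow> \<psi> (x + t *\<^sub>R e) = \<psi> x"
    using collapsing_map_exists[OF K e \<delta>(1) \<open>0 < \<epsilon> / 2\<close>] by blast
  show thesis
  proof (rule that[of "\<lambda>x. F (\<psi> x)", OF _ _ \<psi>(3)])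
    have "((1 - \<delta>) * (1 + \<delta>))-lipschitz_on UNIV (\<lambda>x. F (\<psi> x))"
      using \<psi>(1) lipschitz_on_subset[OF F(1)] by (rule lipschitz_on_compose2) simp
    then show "1-lipschitz_on S (\<lambda>x. F (\<psi> x))"
      by (rule lipschitz_on_mono) (auto simp: algebra_simps)
    have "\<bar>F (\<psi> y) - f' y\<bar> \<le> \<epsilon> / 2" if "y \<in> S" for y
    proof -
      have "\<bar>F (\<psi> y) - F y\<bar> \<le> (1 - \<delta>) * norm (\<psi> y - y)"
        using lipschitz_onD[OF F(1), of "\<psi> y" y] by (simp add: dist_norm)
      also have "\<dots> \<le> 1 * (\<epsilon> / 2)" using \<psi>(2) \<delta> by (intro mult_mono) auto
      finally show ?thesis using F(2)[OF that] by simp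
    qed
    then have "close_on S (\<epsilon> / 2) (\<lambda>x. F (\<psi> x)) f'" by (simp add: close_on_def)
    then have "close_on S (\<epsilon> / 2 + \<epsilon> / 2) (\<lambda>x. F (\<psi> x)) f" using f'(2) by (rule close_on_trans)
    then show "close_on S \<epsilon> (\<lambda>x. F (\<psi> x)) f" by simp
    show "F (\<psi> (x + t *\<^sub>R e)) = F (\<psi> x)" if "x \<in> K" "0 \<le> t" "t < r" for x t using \<psi>(4)[OF that] by simp
  qed
qed

lemma avoidable_steep_along:
  fixes K :: "'a::euclidean_space set"
  assumes K: "compact K" "K \<subseteq> box 0 One" "purely_unrectifiable K" and e: "norm e = 1" and "0 < d"
  shows "avoidable (steep_along e d K)"
proof (rule avoidableI)
  fix f :: "'a \<Rightarrow> real" and \<epsilon> :: real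
  assume "1-lipschitz_on unit_cube f" "0 < \<epsilon>"
  then obtain h r where h: "1-lipschitz_on unit_cube h" "close_on unit_cube \<epsilon> h f" "0 < r"
    "\<And>x t. x \<in> K \<Longrightarrow> 0 \<le> t \<Longrightarrow> t < r \<Longrightarrow> h (x + t *\<^sub>R e) = h x"
    using locally_constant_along_approximation_exists[OF K(1,3) e _ bounded_cbox] by blast
  obtain \<rho> where \<rho>: "\<rho> > 0" "(\<Union>x\<in>K. cball x \<rho>) \<subseteq> box 0 One"
    using compact_subset_open_imp_cball_epsilon_subset[OF K(1) open_box K(2)] by blast
  define t where "t = min (d / 2) (min (r / 2) \<rho>)"
  have t: "0 < t" "t < d" "t < r" "t \<le> \<rho>" using \<open>0 < d\<close> h(3) \<rho>(1) by (auto simp: t_def min_less_iff_disj)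
  have inside: "x + t *\<^sub>R e \<in> unit_cube" if "x \<in> K" for x
  proof -
    have "x + t *\<^sub>R e \<in> cball x \<rho>" using t e by (simp add: dist_norm)
    then show ?thesis using that \<rho>(2) box_subset_cbox by blast
  qed
  have "K \<subseteq> unit_cube" using K(2) box_subset_cbox by blast
  then have "restrict k unit_cube \<notin> steep_along e d K" if "close_on unit_cube (d * t / 4) k h" for k
    using t inside h(4) that by (intro not_steep_along_if_close_to_flat[of K t d e h k]) auto
  moreover have "0 < d * t / 4" using \<open>0 < d\<close> t(1) by simp
  ultimately show "\<exists>h \<eta>. 1-lipschitz_on unit_cube h \<and> 0 < \<eta> \<and> close_on unit_cube \<epsilon> h f \<and>
      (\<forall>k. 1-lipschitz_on unit_cube k \<longrightarrow> close_on unit_cube \<eta> k h \<longrightarrow> restrict k unit_cube \<notin> steep_along e d K)"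
    using h(1,2) by blast
qed

lemma directional_derivative_zero:
  fixes f :: "'a::real_normed_vector \<Rightarrow> real"
  assumes D: "(f has_derivative D) (at x)" and e: "norm e = 1"
    and level: "\<And>n::nat. \<exists>t. 0 < t \<and> t < 1 / Suc n \<and> \<bar>f (x + t *\<^sub>R e) - f x\<bar> \<le> 1 / Suc n * t"
  shows "D e = 0"
proof -
  have "\<bar>D e\<bar> \<le> 0 + \<epsilon>" if "0 < \<epsilon>" for \<epsilon>
  proof -
    have "0 < \<epsilon> / 2" using \<open>0 < \<epsilon>\<close> by simp
    then obtain d where d: "d > 0" "\<And>y. norm (y - x) < d \<Longrightarrow> \<bar>f y - f x - D (y - x)\<bar> \<le> \<epsilon> / 2 * norm (y - x)"
      using D unfolding has_derivative_at_alt real_norm_def by blast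
    have "0 < min d (\<epsilon> / 2)" using d(1) \<open>0 < \<epsilon>\<close> by simp
    then obtain n where n: "1 / real (Suc n) < min d (\<epsilon> / 2)" using nat_approx_posE by blast
    obtain t where t: "0 < t" "t < 1 / Suc n" "\<bar>f (x + t *\<^sub>R e) - f x\<bar> \<le> 1 / Suc n * t"
      using level[of n] by blast
    have "norm (x + t *\<^sub>R e - x) = t" using e t(1) by simp
    then have "\<bar>f (x + t *\<^sub>R e) - f x - t * D e\<bar> \<le> \<epsilon> / 2 * t"
      using d(2)[of "x + t *\<^sub>R e"] t(2) n linear_scale[OF has_derivative_linear[OF D], of t e] by simp
    moreover have "1 / Suc n * t \<le> \<epsilon> / 2 * t" using n t(1) by (intro mult_right_mono) auto
    ultimately have "\<bar>t * D e\<bar> \<le> \<epsilon> / 2 * t + \<epsilon> / 2 * t" using t(3) by linarith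
    then have "t * \<bar>D e\<bar> \<le> t * \<epsilon>" using t(1) by (simp add: abs_mult mult.commute)
    then show ?thesis using t(1) by simp
  qed
  then have "\<bar>D e\<bar> \<le> 0" by (rule field_le_epsilon)
  then show ?thesis by simp
qed

lemma not_differentiable_if_neither_flat_nor_steep:
  fixes f :: "'a::euclidean_space \<Rightarrow> real"
  assumes x: "x \<in> K" "K \<subseteq> box 0 One"
    and not_steep: "\<And>b n. b \<in> Basis \<Longrightarrow> f \<notin> steep_along b (1 / Suc n) K"
    and not_flat: "\<And>n. f \<notin> flat_somewhere (1 / Suc n)"
  shows "\<not> f differentiable (at x)"
proof
  assume "f differentiable (at x)"
  then obtain D where D: "(f has_derivative D) (at x)" by (auto simp: differentiable_def)
  have "D b = 0" if b: "b \<in> Basis" for b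
  proof (rule directional_derivative_zero[OF D norm_Basis[OF b]])
    show "\<exists>t. 0 < t \<and> t < 1 / Suc n \<and> \<bar>f (x + t *\<^sub>R b) - f x\<bar> \<le> 1 / Suc n * t" for n
      using not_steep[OF b, of n] x(1) unfolding steep_along_def mem_Collect_eq by (meson le_cases)
  qed
  then have "D = (\<lambda>_. 0)"
    using linear_eq_stdbasis[OF has_derivative_linear[OF D] linear_zero] by blast
  with D obtain d where d: "d > 0" "\<And>y. norm (y - x) < d \<Longrightarrow> \<bar>f y - f x\<bar> \<le> 1 / 4 * norm (y - x)"
    unfolding has_derivative_at_alt by (auto elim!: allE[of _ "1 / 4"])
  obtain n where n: "1 / real (Suc n) < d" using nat_approx_posE[OF d(1)] by blast
  have "x \<in> unit_cube" using x box_subset_cbox by blast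
  then obtain y where y: "y \<noteq> x" "dist x y < 1 / Suc n" "dist x y / 2 < \<bar>f y - f x\<bar>"
    using not_flat[of n] unfolding flat_somewhere_def mem_Collect_eq by (meson not_le)
  then have "\<bar>f y - f x\<bar> \<le> 1 / 4 * dist x y"
    using d(2)[of y] n by (simp add: dist_norm norm_minus_commute)
  then show False using y(3) zero_le_dist[of x y] by linarith
qed

section \<open>Meagre subsets of the space of Lipschitz functions\<close>

lemma (in Metric_space) nowhere_dense_in_mtopology:
  "nowhere_dense_in mtopology S \<longleftrightarrow> S \<subseteq> M \<and>
    (\<forall>x\<in>M. \<forall>\<epsilon>>0. \<exists>y\<in>M. \<exists>\<eta>>0. d x y \<le> \<epsilon> \<and> (\<forall>z\<in>M. d y z \<le> \<eta> \<longrightarrow> z \<notin> S))"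
    (is "?nd \<longleftrightarrow> S \<subseteq> M \<and> ?holes")
proof
  assume nd: ?nd
  have ?holes
  proof (intro ballI allI impI)
    fix x and \<epsilon> :: real assume x: "x \<in> M" "0 < \<epsilon>"
    have "\<not> mball x \<epsilon> \<subseteq> mtopology closure_of S"
    proof
      assume "mball x \<epsilon> \<subseteq> mtopology closure_of S"
      then have "mball x \<epsilon> \<subseteq> mtopology interior_of (mtopology closure_of S)"
        by (rule interior_of_maximal) (rule openin_mball)
      then show False using nd x by (auto simp: nowhere_dense_in_def)
    qed
    then obtain y where "y \<in> mball x \<epsilon>" "y \<notin> mtopology closure_of S" by blast
    then have y: "y \<in> M" "d x y < \<epsilon>" "y \<notin> mtopology closure_of S" by simp_all
    then obtain \<eta> where "0 < \<eta>" "\<And>z. z \<in> S \<Longrightarrow> z \<notin> mball y \<eta>"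
      unfolding metric_closure_of by blast
    with y(1) have "\<forall>z\<in>M. d y z \<le> \<eta> / 2 \<longrightarrow> z \<notin> S" by force
    with y \<open>0 < \<eta>\<close> show "\<exists>y\<in>M. \<exists>\<eta>>0. d x y \<le> \<epsilon> \<and> (\<forall>z\<in>M. d y z \<le> \<eta> \<longrightarrow> z \<notin> S)"
      by (intro bexI[of _ y] exI[of _ "\<eta> / 2"]) auto
  qed
  with nd show "S \<subseteq> M \<and> ?holes" by (simp add: nowhere_dense_in_def)
next
  assume "S \<subseteq> M \<and> ?holes"
  then have S: "S \<subseteq> M" and holes: ?holes by blast+
  have "mtopology interior_of (mtopology closure_of S) = {}"
  proof (rule ccontr)
    assume "\<not> ?thesis"
    then obtain x where x: "x \<in> mtopology interior_of (mtopology closure_of S)" by blast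
    then obtain \<epsilon> where \<epsilon>: "0 < \<epsilon>" "mball x \<epsilon> \<subseteq> mtopology interior_of (mtopology closure_of S)"
      using openin_interior_of[of mtopology "mtopology closure_of S"] unfolding openin_mtopology by blast
    have "x \<in> M" using x interior_of_subset_topspace[of mtopology] by auto
    have "0 < \<epsilon> / 2" using \<epsilon>(1) by simp
    obtain y \<eta> where y: "y \<in> M" "0 < \<eta>" "d x y \<le> \<epsilon> / 2" "\<And>z. z \<in> M \<Longrightarrow> d y z \<le> \<eta> \<Longrightarrow> z \<notin> S"
      using bspec[OF holes \<open>x \<in> M\<close>] \<open>0 < \<epsilon> / 2\<close> by blast
    then have "y \<in> mball x \<epsilon>" using \<open>x \<in> M\<close> \<epsilon>(1) by simp
    then have "y \<in> mtopology closure_of S"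
      using subset_trans[OF \<epsilon>(2) interior_of_subset] by blast
    then obtain z where "z \<in> S" "z \<in> mball y \<eta>" using y(2) unfolding metric_closure_of by blast
    then show False using y(4)[of z] by simp
  qed
  with S show ?nd by (simp add: nowhere_dense_in_def)
qed

lemma mspace_Lip1: "f \<in> mspace Lip1_metric \<longleftrightarrow> f \<in> extensional unit_cube \<and> 1-lipschitz_on unit_cube f"
proof -
  have "Met_TC.mbounded (f ` unit_cube)" if "1-lipschitz_on unit_cube f"
    using bounded_lipschitz_image[OF that bounded_cbox] by (simp add: mbounded_iff_bounded)
  then show ?thesis by (auto simp: Lip1_metric_def Met_TC.fspace_def)
qed

lemma topspace_Lip1: "topspace Lip1_topology = mspace Lip1_metric"
  by (simp add: Lip1_topology_def)

lemma mdist_Lip1_le: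
  assumes "f \<in> mspace Lip1_metric" "g \<in> mspace Lip1_metric"
  shows "mdist Lip1_metric f g \<le> a \<longleftrightarrow> close_on unit_cube a f g"
proof -
  have "f \<in> mspace (funspace unit_cube euclidean_metric)" "g \<in> mspace (funspace unit_cube euclidean_metric)"
    using assms unfolding Lip1_metric_def mspace_submetric by blast+
  moreover have "unit_cube \<noteq> ({} :: 'a set)" by simp
  ultimately show ?thesis
    using funspace_mdist_le[of f unit_cube euclidean_metric g a]
    unfolding Lip1_metric_def mdist_submetric close_on_def by (simp add: dist_real_def)
qed

lemma restrict_in_Lip1:
  assumes "1-lipschitz_on unit_cube f"
  shows "restrict f unit_cube \<in> mspace Lip1_metric"
  using assms by (simp add: mspace_Lip1 lipschitz_on_def)

lemma ball_Lip1: "(\<forall>f\<in>mspace Lip1_metric. P f) \<longleftrightarrow> (\<forall>f. 1-lipschitz_on unit_cube f \<longrightarrow> P (restrict f unit_cube))"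
  by (metis extensional_restrict mspace_Lip1 restrict_in_Lip1)

lemma bex_Lip1: "(\<exists>f\<in>mspace Lip1_metric. P f) \<longleftrightarrow> (\<exists>f. 1-lipschitz_on unit_cube f \<and> P (restrict f unit_cube))"
  by (metis extensional_restrict mspace_Lip1 restrict_in_Lip1)

lemma nowhere_dense_Lip1_iff:
  "nowhere_dense_in Lip1_topology S \<longleftrightarrow> S \<subseteq> mspace Lip1_metric \<and> avoidable S"
proof -
  interpret L: Metric_space "mspace (Lip1_metric :: ('a \<Rightarrow> real) metric)" "mdist Lip1_metric"
    by (rule Metric_space_mspace_mdist)
  let ?L = "mspace (Lip1_metric :: ('a \<Rightarrow> real) metric)"
  have commute: "close_on unit_cube a f g \<longleftrightarrow> close_on unit_cube a g f" for a and f g :: "'a \<Rightarrow> real"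
    by (simp add: close_on_def abs_minus_commute)
  have "nowhere_dense_in Lip1_topology S \<longleftrightarrow> S \<subseteq> ?L \<and>
    (\<forall>f\<in>?L. \<forall>\<epsilon>>0. \<exists>h\<in>?L. \<exists>\<eta>>0. close_on unit_cube \<epsilon> h f \<and> (\<forall>k\<in>?L. close_on unit_cube \<eta> k h \<longrightarrow> k \<notin> S))"
    unfolding Lip1_topology_def mtopology_of_def L.nowhere_dense_in_mtopology
    by (simp add: mdist_Lip1_le commute cong: conj_cong)
  also have "\<dots> \<longleftrightarrow> S \<subseteq> ?L \<and> avoidable S"
    unfolding ball_Lip1 bex_Lip1 avoidable_def by (simp add: close_on_def)
  finally show ?thesis .
qed

lemma meagre_in_Lip1_iff:
  assumes "S \<subseteq> mspace Lip1_metric"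
  shows "meagre_in Lip1_topology S \<longleftrightarrow> (\<exists>\<N>. countable \<N> \<and> (\<forall>N\<in>\<N>. avoidable N) \<and> S \<subseteq> \<Union>\<N>)"
proof
  assume "meagre_in Lip1_topology S"
  then show "\<exists>\<N>. countable \<N> \<and> (\<forall>N\<in>\<N>. avoidable N) \<and> S \<subseteq> \<Union>\<N>"
    unfolding meagre_in_def union_of_def nowhere_dense_Lip1_iff by blast
next
  assume "\<exists>\<N>. countable \<N> \<and> (\<forall>N\<in>\<N>. avoidable N) \<and> S \<subseteq> \<Union>\<N>"
  then obtain \<N> where \<N>: "countable \<N>" "\<And>N. N \<in> \<N> \<Longrightarrow> avoidable N" "S \<subseteq> \<Union>\<N>" by blast
  have "nowhere_dense_in Lip1_topology (S \<inter> N)" if "N \<in> \<N>" for N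
    using assms avoidable_subset[OF \<N>(2)[OF that], of "S \<inter> N"] by (auto simp: nowhere_dense_Lip1_iff)
  then show "meagre_in Lip1_topology S"
    unfolding meagre_in_def union_of_def using \<N>(1,3)
    by (intro exI[of _ "(\<inter>) S ` \<N>"]) auto
qed

lemma compact_cover_if_fsigma_cover:
  fixes U :: "'a::euclidean_space set"
  assumes "open U" "A \<subseteq> U" "A \<subseteq> P" "fsigma_in euclidean P"
  obtains \<K> where "countable \<K>" "A \<subseteq> \<Union>\<K>" "\<And>K. K \<in> \<K> \<Longrightarrow> compact K \<and> K \<subseteq> U \<and> K \<subseteq> P"
proof -
  obtain \<C> where \<C>: "countable \<C>" "\<And>C. C \<in> \<C> \<Longrightarrow> closed C" "\<Union>\<C> = P"
    using assms(4) unfolding fsigma_in_def union_of_def closed_closedin by blast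
  obtain B where B: "\<And>n::nat. compact (B n)" "\<And>n. B n \<subseteq> U" "\<Union>(range B) = U"
    by (rule open_Union_compact_subsets[OF \<open>open U\<close>]) blast
  let ?\<K> = "(\<lambda>(C, n). C \<inter> B n) ` (\<C> \<times> UNIV)"
  have "countable ?\<K>" using \<C>(1) by (intro countable_image countable_SIGMA) auto
  moreover have "A \<subseteq> \<Union>?\<K>"
  proof
    fix x assume "x \<in> A"
    then have "x \<in> \<Union>\<C>" "x \<in> \<Union>(range B)" using assms(2,3) \<C>(3) B(3) by auto
    then show "x \<in> \<Union>?\<K>" by auto
  qed
  moreover have "compact K \<and> K \<subseteq> U \<and> K \<subseteq> P" if "K \<in> ?\<K>" for K
  proof -
    obtain C n where "K = C \<inter> B n" "C \<in> \<C>" using \<open>K \<in> ?\<K>\<close> by auto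
    then show ?thesis using closed_Int_compact[OF \<C>(2) B(1)] B(2) \<C>(3) by blast
  qed
  ultimately show thesis by (rule that)
qed

proposition avoidable_cover_of_differentiable:
  fixes A :: "'a::euclidean_space set"
  assumes A: "A \<subseteq> box 0 One" "A \<subseteq> P" and P: "fsigma_in euclidean P" "purely_unrectifiable P"
  obtains \<N> :: "('a \<Rightarrow> real) set set" where "countable \<N>" "\<And>N. N \<in> \<N> \<Longrightarrow> avoidable N"
    "{f. \<exists>x\<in>A. f differentiable (at x)} \<subseteq> \<Union>\<N>"
proof -
  obtain \<K> where \<K>: "countable \<K>" "A \<subseteq> \<Union>\<K>" "\<And>K. K \<in> \<K> \<Longrightarrow> compact K \<and> K \<subseteq> box 0 One \<and> K \<subseteq> P"
    using compact_cover_if_fsigma_cover[OF open_box A P(1)] by blast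
  let ?flat = "range (\<lambda>n::nat. flat_somewhere (1 / Suc n))"
  let ?steep = "(\<lambda>(b, n::nat, K). steep_along b (1 / Suc n) K) ` (Basis \<times> UNIV \<times> \<K>)"
  show thesis
  proof (rule that[of "?flat \<union> ?steep"])
    have "countable (Basis \<times> (UNIV :: nat set) \<times> \<K>)"
      using \<K>(1) by (intro countable_SIGMA) (auto intro: countable_finite)
    then show "countable (?flat \<union> ?steep)" by (intro countable_Un countable_image) auto
    fix N assume "N \<in> ?flat \<union> ?steep"
    then consider (flat) n where "N = flat_somewhere (1 / Suc n)"
      | (steep) b n K where "N = steep_along b (1 / Suc n) K" "b \<in> Basis" "K \<in> \<K>"
      by (auto simp del: of_nat_Suc)
    then show "avoidable N"
    proof cases
      case flat
      show ?thesis unfolding flat by (rule avoidable_flat_somewhere) simp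
    next
      case steep
      then have "purely_unrectifiable K" using P(2) \<K>(3) by (blast intro: purely_unrectifiable_subset)
      then show ?thesis unfolding steep(1) using \<K>(3) steep by (intro avoidable_steep_along) auto
    qed
  next
    have "\<not> f differentiable (at x)" if x: "x \<in> A" and not_in: "f \<notin> \<Union>(?flat \<union> ?steep)" for f x
    proof -
      obtain K where K: "K \<in> \<K>" "x \<in> K" using x \<K>(2) by blast
      show ?thesis
      proof (rule not_differentiable_if_neither_flat_nor_steep[OF K(2)])
        show "K \<subseteq> box 0 One" using \<K>(3) K(1) by blast
        show "f \<notin> steep_along b (1 / Suc n) K" if "b \<in> Basis" for b n
        proof -
          have "steep_along b (1 / Suc n) K \<in> ?steep"
            using \<open>b \<in> Basis\<close> K(1) by (intro image_eqI[of _ _ "(b, n, K)"]) auto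
          then show ?thesis using not_in by (meson UnI2 UnionI)
        qed
        show "f \<notin> flat_somewhere (1 / Suc n)" for n using not_in by blast
      qed
    qed
    then show "{f. \<exists>x\<in>A. f differentiable (at x)} \<subseteq> \<Union>(?flat \<union> ?steep)" by blast
  qed
qed

proposition fsigma_cover_if_avoidable_cover:
  fixes A :: "'a::euclidean_space set"
  assumes A: "A \<subseteq> box 0 One" "analytic_set A"
    and \<N>: "countable \<N>" "\<And>N. N \<in> \<N> \<Longrightarrow> avoidable N"
    and cover: "{f \<in> mspace Lip1_metric. \<exists>x\<in>A. f differentiable (at x)} \<subseteq> \<Union>\<N>"
  shows "\<exists>P. A \<subseteq> P \<and> fsigma_in euclidean P \<and> purely_unrectifiable P"
proof (rule ccontr)
  assume not_covered: "\<not> ?thesis"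
  let ?N = "from_nat_into (insert {} \<N>)"
  have range: "range ?N = insert {} \<N>" using \<N>(1) by (intro range_from_nat_into) auto
  have "avoidable N" if "N \<in> range ?N" for N
    using that \<N>(2) unfolding range by (auto simp: avoidable_empty)
  then obtain f x where f: "1-lipschitz_on unit_cube f" "\<And>n. restrict f unit_cube \<notin> ?N n"
    and x: "x \<in> A" "restrict f unit_cube differentiable (at x)"
    using differentiable_function_avoiding[OF A not_covered, of ?N] by blast
  have "restrict f unit_cube \<notin> \<Union>\<N>" using f(2) range by (metis UnionE insertI2 rangeE)
  with cover x restrict_in_Lip1[OF f(1)] show False by blast
qed

theorem theorem2p2:
  fixes A :: "'a::euclidean_space set"
  assumes "A \<subseteq> box 0 One"
    and "analytic_set A"
  shows "(\<exists>P. A \<subseteq> P \<and> fsigma_in euclidean P \<and> purely_unrectifiable P) \<longleftrightarrow>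
         residual_in Lip1_topology
           {f \<in> topspace (Lip1_topology :: ('a \<Rightarrow> real) topology).
              \<forall>x\<in>A. \<not> f differentiable (at x)}"
    (is "?covered \<longleftrightarrow> residual_in Lip1_topology ?nowhere")
proof -
  let ?somewhere = "{f \<in> mspace Lip1_metric. \<exists>x\<in>A. f differentiable (at x)}"
  have "?covered \<longleftrightarrow> (\<exists>\<N>. countable \<N> \<and> (\<forall>N\<in>\<N>. avoidable N) \<and> ?somewhere \<subseteq> \<Union>\<N>)" (is "_ \<longleftrightarrow> ?avoidable_cover")
  proof
    assume ?covered
    then obtain P where P: "A \<subseteq> P" "fsigma_in euclidean P" "purely_unrectifiable P" by blast
    show ?avoidable_cover by (rule avoidable_cover_of_differentiable[OF assms(1) P]) blast
  next
    assume ?avoidable_cover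
    then show ?covered using fsigma_cover_if_avoidable_cover[OF assms] by blast
  qed
  also have "\<dots> \<longleftrightarrow> meagre_in Lip1_topology ?somewhere"
    by (rule meagre_in_Lip1_iff[symmetric]) blast
  also have "?somewhere = topspace Lip1_topology - ?nowhere" unfolding topspace_Lip1 by blast
  also have "meagre_in Lip1_topology \<dots> \<longleftrightarrow> residual_in Lip1_topology ?nowhere"
    unfolding residual_in_def by auto
  finally show ?thesis .
qed

end
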